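(* Let $q$ be a prime power and $n\ge1$. Every element of $GA_n(q)$ is conjugate in $GA_n(q)$ to $J_{(\boldsymbol\lambda,k)}$ for some $(\boldsymbol\lambda,k)\in\mathscr P^{\mathsf a}_n(\Phi_q)$. Moreover $\{J_{(\boldsymbol\lambda,k)}\mid(\boldsymbol\lambda,k)\in\mathscr P^{\mathsf a}_n(\Phi_q)\}$ is a complete set of representatives of the conjugacy classes of $GA_n(q)$.
   Context: Vectors in $\mathbb F_q^n$ are columns. $\Phi_q$ is the set of monic irreducible polynomials in $\mathbb F_q[t]$ other than $t$. $\mathscr P_{m}(\Phi_q)$ is the set of maps $\boldsymbol\lambda$ from $\Phi_q$ to partitions, nonempty at only finitely many $f$, with $\sum_f\deg(f)|\boldsymbol\lambda(f)|=m$. Write $\boldsymbol\lambda(f)=(\boldsymbol\lambda_1(f),\boldsymbol\lambda_2(f),\dots)$. $GA_n(q)$ is the subgroup of $GL_n(q)$ of matrices $\begin{bmatrix}1&0\\ \alpha&g\end{bmatrix}$ with $g\in GL_{n-1}(q)$, $\alpha\in\mathbb F_q^{n-1}$. $\mathscr P^{\mathsf a}_n(\Phi_q)=\{(\boldsymbol\lambda,k)\in\mathscr P_{n-1}(\Phi_q)\times\mathbb Z_{\ge0}\mid k\text{ is a part of }\boldsymbol\lambda(t-1)\text{ whenever }k\ge1\}$. For $f=t^d-\sum_{i=1}^d a_it^{i-1}\in\Phi_q$, $J(f)$ is the companion matrix with $1$'s on the superdiagonal, last row $(a_1,\dots,a_d)$, and other entries $0$; $J_m(f)$ is the $dm\times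 dm$ block matrix with $m$ diagonal blocks $J(f)$, blocks $I_d$ on the block superdiagonal, and zeros elsewhere. For $\boldsymbol\lambda\in\mathscr P_{n-1}(\Phi_q)$ with $\boldsymbol\lambda(t-1)=(1^{m_1}2^{m_2}\cdots r^{m_r})$, $J_{\boldsymbol\lambda}=\mathrm{diag}(E^{(1)}_{\boldsymbol\lambda},\dots,E^{(r)}_{\boldsymbol\lambda},J^-_{\boldsymbol\lambda})$, where $E^{(i)}_{\boldsymbol\lambda}$ is the diagonal sum of $m_i$ copies of $J_i(t-1)$ and $J^-_{\boldsymbol\lambda}$ is the diagonal sum of the $J_{\boldsymbol\lambda_i(f)}(f)$ over $f\ne t-1$ and $i\ge1$ (in a fixed order). For $(\boldsymbol\lambda,k)\in\mathscr P^{\mathsf a}_n(\Phi_q)$, $J_{(\boldsymbol\lambda,k)}=\begin{bmatrix}1&0\\ \epsilon_k&J_{\boldsymbol\lambda}\end{bmatrix}$, where $\epsilon_0=0$ and, for $k\ge1$, $\epsilon_k\in\mathbb F_q^{n-1}$ has entry $1$ in the last coordinate of the rows of $E^{(k)}_{\boldsymbol\lambda}$ (position $m_1+2m_2+\cdots+km_k$) and zeros elsewhere. *)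

theory Defs
  imports
    "Jordan_Normal_Form.Determinant"
    "HOL-Algebra.Group_Action"
begin

section \<open>Partition-valued maps on irreducible polynomials\<close>

text \<open>Throughout, a type variable \<open>'a\<close> of classes \<open>field\<close> and \<open>finite\<close> plays the role of the field
  with \<open>q = CARD('a)\<close> elements.\<close>

text \<open>A partition is the weakly decreasing list of its (positive) parts; the empty list is the
  empty partition. The multiplicity of a part \<open>i\<close> is \<open>count_list \<mu> i\<close>.\<close>

definition is_partition :: "nat list \<Rightarrow> bool" where
  "is_partition \<mu> \<longleftrightarrow> sorted_wrt (\<ge>) \<mu> \<and> 0 \<notin> set \<mu>"

definition Phi :: "'a :: field poly set" where
  "Phi = {f. lead_coeff f = 1 \<and> irreducible f \<and> f \<noteq> [:0, 1:]}"

abbreviation t_minus_1 :: "'a :: field poly" where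
  "t_minus_1 \<equiv> [:-1, 1:]"

text \<open>Maps with domain \<^const>\<open>Phi\<close> are extensional functions, so that equality of such maps is
  equality of the HOL functions.\<close>

definition PPhi :: "nat \<Rightarrow> ('a :: field poly \<Rightarrow> nat list) set" where
  "PPhi m = {\<Lambda> \<in> Phi \<rightarrow>\<^sub>E {\<mu>. is_partition \<mu>}.
     finite {f \<in> Phi. \<Lambda> f \<noteq> []} \<and>
     (\<Sum>f \<in> {f \<in> Phi. \<Lambda> f \<noteq> []}. degree f * sum_list (\<Lambda> f)) = m}"

definition PaPhi :: "nat \<Rightarrow> (('a :: field poly \<Rightarrow> nat list) \<times> nat) set" where
  "PaPhi n = {(\<Lambda>, k). \<Lambda> \<in> PPhi (n - 1) \<and> (1 \<le> k \<longrightarrow> k \<in> set (\<Lambda> t_minus_1))}"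

section \<open>The affine group and conjugacy\<close>

definition GL :: "nat \<Rightarrow> 'a :: field mat monoid" where
  "GL n = units_of (ring_mat TYPE('a) n ())"

text \<open>The block matrix with rows \<open>(1, 0)\<close> and \<open>(\<alpha>, g)\<close>.\<close>

definition affine_mat :: "'a :: field vec \<Rightarrow> 'a mat \<Rightarrow> 'a mat" where
  "affine_mat \<alpha> g =
     four_block_mat (1\<^sub>m 1) (0\<^sub>m 1 (dim_col g)) (mat_of_cols (dim_vec \<alpha>) [\<alpha>]) g"

definition GA_set :: "nat \<Rightarrow> 'a :: field mat set" where
  "GA_set n = {affine_mat \<alpha> g |\<alpha> g. \<alpha> \<in> carrier_vec (n - 1) \<and> g \<in> carrier (GL (n - 1))}"

definition GA :: "nat \<Rightarrow> 'a :: field mat monoid" where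
  "GA n = (GL n)\<lparr>carrier := GA_set n\<rparr>"

definition conjugate_in :: "('g, 'b) monoid_scheme \<Rightarrow> 'g \<Rightarrow> 'g \<Rightarrow> bool" where
  "conjugate_in G x y \<longleftrightarrow> (\<exists>h \<in> carrier G. y = h \<otimes>\<^bsub>G\<^esub> x \<otimes>\<^bsub>G\<^esub> inv\<^bsub>G\<^esub> h)"

text \<open>The action used here is the one of \<open>group.action_by_conjugation\<close>.\<close>

definition conjugacy_classes :: "('g, 'b) monoid_scheme \<Rightarrow> 'g set set" where
  "conjugacy_classes G =
     orbits G (carrier G) (\<lambda>h. \<lambda>x \<in> carrier G. h \<otimes>\<^bsub>G\<^esub> x \<otimes>\<^bsub>G\<^esub> inv\<^bsub>G\<^esub> h)"

definition complete_class_reps :: "('g, 'b) monoid_scheme \<Rightarrow> 'g set \<Rightarrow> bool" where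
  "complete_class_reps G R \<longleftrightarrow>
     R \<subseteq> carrier G \<and> (\<forall>C \<in> conjugacy_classes G. \<exists>!x. x \<in> R \<and> x \<in> C)"

section \<open>The representatives\<close>

text \<open>Matrix indices start at \<open>0\<close>. Writing \<open>f = t^d - (\<Sum>i=1..d. a_i t^(i-1))\<close>, the last row
  \<open>(a_1, ..., a_d)\<close> has entry \<open>a_(j+1) = - coeff f j\<close> in column \<open>j\<close>.\<close>

definition companion_J :: "'a :: field poly \<Rightarrow> 'a mat" where
  "companion_J f = (let d = degree f in
     mat d d (\<lambda>(i, j). if i = d - 1 then - coeff f j else if j = i + 1 then 1 else 0))"

definition block_J :: "nat \<Rightarrow> 'a :: field poly \<Rightarrow> 'a mat" where
  "block_J m f = (let d = degree f in
     mat (d * m) (d * m) (\<lambda>(i, j).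
       if j div d = i div d then companion_J f $$ (i mod d, j mod d)
       else if j div d = i div d + 1 then 1\<^sub>m d $$ (i mod d, j mod d)
       else 0))"

text \<open>\<open>E^(i)\<close> for the partition \<open>\<mu> = \<Lambda>(t - 1)\<close>.\<close>

definition E_block :: "nat list \<Rightarrow> nat \<Rightarrow> 'a :: field mat" where
  "E_block \<mu> i = diag_block_mat (replicate (count_list \<mu> i) (block_J i t_minus_1))"

text \<open>The order of the blocks for \<open>f \<noteq> t - 1\<close> is an arbitrary but fixed choice: \<open>ord \<Lambda>\<close> lists,
  without repetition, the pairs \<open>(f, i)\<close> with \<open>f \<noteq> t - 1\<close> such that \<open>\<Lambda>(f)\<close> has an \<open>i\<close>-th part,
  where the index \<open>i\<close> of the part starts at \<open>0\<close>.\<close>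

definition is_block_order :: "(('a :: field poly \<Rightarrow> nat list) \<Rightarrow> ('a poly \<times> nat) list) \<Rightarrow> bool" where
  "is_block_order ord \<longleftrightarrow> (\<forall>m. \<forall>\<Lambda> \<in> PPhi m.
     distinct (ord \<Lambda>) \<and>
     set (ord \<Lambda>) = {(f, i). f \<in> Phi \<and> f \<noteq> t_minus_1 \<and> i < length (\<Lambda> f)})"

definition J_minus ::
  "(('a :: field poly \<Rightarrow> nat list) \<Rightarrow> ('a poly \<times> nat) list) \<Rightarrow> ('a poly \<Rightarrow> nat list) \<Rightarrow> 'a mat" where
  "J_minus ord \<Lambda> = diag_block_mat (map (\<lambda>(f, i). block_J (\<Lambda> f ! i) f) (ord \<Lambda>))"

text \<open>Here \<open>r\<close> is the largest part of \<open>\<Lambda>(t - 1)\<close> (or \<open>0\<close>).\<close>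

definition J_lambda ::
  "(('a :: field poly \<Rightarrow> nat list) \<Rightarrow> ('a poly \<times> nat) list) \<Rightarrow> ('a poly \<Rightarrow> nat list) \<Rightarrow> 'a mat" where
  "J_lambda ord \<Lambda> = (let \<mu> = \<Lambda> t_minus_1; r = Max (insert 0 (set \<mu>)) in
     diag_block_mat (map (E_block \<mu>) [1..<Suc r] @ [J_minus ord \<Lambda>]))"

definition epsilon_vec :: "nat \<Rightarrow> nat list \<Rightarrow> nat \<Rightarrow> 'a :: field vec" where
  "epsilon_vec l \<mu> k =
     (if k = 0 then 0\<^sub>v l else unit_vec l ((\<Sum>i = 1..k. i * count_list \<mu> i) - 1))"

definition J_affine ::
  "(('a :: field poly \<Rightarrow> nat list) \<Rightarrow> ('a poly \<times> nat) list) \<Rightarrow>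
   nat \<Rightarrow> ('a poly \<Rightarrow> nat list) \<Rightarrow> nat \<Rightarrow> 'a mat" where
  "J_affine ord n \<Lambda> k = affine_mat (epsilon_vec (n - 1) (\<Lambda> t_minus_1) k) (J_lambda ord \<Lambda>)"

end

theory Submission
  imports Defs "HOL-Library.Function_Algebras" "HOL-Library.Cardinality"
    "HOL-Combinatorics.Permutations"
begin

text \<open>A matrix \<open>g\<close> makes the column space \<open>V\<close> a finite module over the polynomial ring, and the
  affine matrix with rows \<open>(1, 0)\<close>, \<open>(\<alpha>, g)\<close> is determined up to conjugacy by this module together
  with the class of \<open>\<alpha>\<close> modulo \<open>(t - 1)V\<close>, up to module isomorphism. If \<open>\<alpha>\<close> is nonzero modulo
  \<open>(t - 1)V\<close>, a representative of minimal order \<open>(t - 1)\<^sup>k\<close> generates a direct summand of \<open>V\<close>, so it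
  can be taken as the generator of a block of size \<open>k\<close> in a primary decomposition of \<open>V\<close>.
  Conversely, the block types are determined by the cardinalities of the kernels of the \<open>p(g)\<^sup>j\<close>,
  and \<open>k\<close> is that minimal order. The module of \<open>J\<^sub>m(f)\<close> is cyclic of order \<open>f\<^sup>m\<close> because \<open>f\<close> is
  separable.\<close>

section \<open>Cyclic decompositions of finite modules\<close>

text \<open>Conjugation by the affine matrix with translation part b and linear part u takes
  (\<alpha>, g) to (\<alpha>', g') exactly when g' u = u g and u \<alpha> = \<alpha>' + (g' - 1) b.
  This is where (t - 1)V enters. Minimality of the order is used as follows. If y = \<alpha> + p
  \<beta> has minimal order p^(j+1) and p^j y were in p^(j+1) V, a further correction from pV would
  lower the order. Hence p^j y is outside p^(j+1) V, and this makes the module of y a summand. The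
  argument works for every p in \<open>Phi\<close> and every \<alpha> outside pV, so it also drives
  the existence of primary decompositions. Conversely, no correction from pV lowers the order of a
  generator of a primary summand, so k is an invariant. The polynomial t is absent because it acts
  injectively when g is invertible. In J = S + N, with S the diagonal blocks and N the identity
  blocks above them, S and N commute and f(S) = 0. Hence f(J) = N (f'(S) + N r), and separability
  makes f'(S) invertible. Ones above the diagonal move unit vectors to smaller indices, so the last
  one generates a block; this explains the position of the 1 in \<epsilon>_k.\<close>

text \<open>The hypothesis on p expresses maximality of the ideal (p) as far as it is needed. Modulo
  p^(j+1) every nonzero c is then a unit times p^i with i \<le> j, so its multiples contain the
  socle element p^j. No gcd or unique factorization enters.\<close>

lemma bezout_power:
  fixes p :: "'r::comm_ring_1"
  assumes max: "\<And>d. \<not> p dvd d \<Longrightarrow> \<exists>e s. e * d + s * p = 1"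
    and nd: "\<not> p ^ Suc j dvd c"
  shows "\<exists>a b. a * c + b * p ^ Suc j = p ^ j"
  using nd
proof (induction j arbitrary: c)
  case 0
  then show ?case using max[of c] by auto
next
  case (Suc j)
  show ?case
  proof (cases "p dvd c")
    case True
    then obtain d where d: "c = p * d" by auto
    with Suc.prems have "\<not> p ^ Suc j dvd d" by (auto intro: mult_dvd_mono)
    from Suc.IH[OF this] obtain a b where ab: "a * d + b * p ^ Suc j = p ^ j" by blast
    have "a * c + b * p ^ Suc (Suc j) = p * (a * d + b * p ^ Suc j)"
      by (simp add: d algebra_simps)
    also have "\<dots> = p ^ Suc j" unfolding ab by simp
    finally show ?thesis by blast
  next
    case False
    from max[OF this] obtain e s where es: "e * c + s * p = 1" by blast
    have "(p ^ Suc j * e) * c + s * p ^ Suc (Suc j) = p ^ Suc j * (e * c + s * p)"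
      by (simp add: algebra_simps)
    then show ?thesis unfolding es by auto
  qed
qed

text \<open>A locale of its own, since everything added to \<^locale>\<open>Modules.module\<close> would also be
  instantiated by the interpretation \<open>real_vector\<close>.\<close>

locale ring_module = Modules.module scale
  for scale :: "'r::comm_ring_1 \<Rightarrow> 'v::ab_group_add \<Rightarrow> 'v" (infixr \<open>*s\<close> 75)
begin

text \<open>The annihilator of y contains p^(j+1) but not p^j; by \<open>bezout_power\<close>, any
  further element in it would bring in p^j.\<close>

lemma order_prime_power:
  assumes max: "\<And>d. \<not> p dvd d \<Longrightarrow> \<exists>e s. e * d + s * p = 1"
    and y: "p ^ Suc j *s y = 0" "p ^ j *s y \<noteq> 0"
  shows "c *s y = 0 \<longleftrightarrow> p ^ Suc j dvd c"
proof
  assume "p ^ Suc j dvd c"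
  then obtain d where "c = d * p ^ Suc j" by (auto simp: dvd_def mult.commute)
  then have "c *s y = d *s (p ^ Suc j *s y)" by (simp only: scale_scale)
  then show "c *s y = 0" by (simp only: y scale_zero_right)
next
  assume c: "c *s y = 0"
  show "p ^ Suc j dvd c"
  proof (rule ccontr)
    assume "\<not> ?thesis"
    from bezout_power[OF max this] obtain a b where ab: "a * c + b * p ^ Suc j = p ^ j" by blast
    have "p ^ j *s y = a *s (c *s y) + b *s (p ^ Suc j *s y)"
      unfolding ab[symmetric] by (simp only: scale_left_distrib scale_scale)
    also have "\<dots> = 0" by (simp only: c y(1) scale_zero_right add_0)
    finally show False using y(2) by simp
  qed
qed

lemma subspace_scaled:
  assumes V: "subspace V"
  shows "subspace ((\<lambda>z. a *s z) ` V)"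
proof (rule subspaceI)
  show "0 \<in> (\<lambda>z. a *s z) ` V"
    using subspace_0[OF V] by (intro image_eqI[of _ _ 0]) simp
next
  fix x y assume "x \<in> (\<lambda>z. a *s z) ` V" "y \<in> (\<lambda>z. a *s z) ` V"
  then obtain x' y' where "x = a *s x'" "y = a *s y'" "x' \<in> V" "y' \<in> V" by blast
  then have "x + y = a *s (x' + y')" "x' + y' \<in> V"
    using V by (simp_all add: scale_right_distrib subspace_add)
  then show "x + y \<in> (\<lambda>z. a *s z) ` V" by blast
next
  fix c x assume "x \<in> (\<lambda>z. a *s z) ` V"
  then obtain x' where "x = a *s x'" "x' \<in> V" by blast
  then have "c *s x = a *s (c *s x')" "c *s x' \<in> V"
    using V by (simp_all add: mult.commute subspace_scale)
  then show "c *s x \<in> (\<lambda>z. a *s z) ` V" by blast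
qed

lemma subspace_sum_cyclic:
  assumes "subspace W"
  shows "subspace {w + c *s y |w c. w \<in> W}"
proof (rule subspaceI)
  show "0 \<in> {w + c *s y |w c. w \<in> W}"
    using subspace_0[OF assms] by (auto intro!: exI[of _ 0])
next
  fix u v assume "u \<in> {w + c *s y |w c. w \<in> W}" "v \<in> {w + c *s y |w c. w \<in> W}"
  then obtain w c w' c' where "u = w + c *s y" "v = w' + c' *s y" "w \<in> W" "w' \<in> W" by auto
  then have "u + v = (w + w') + (c + c') *s y" "w + w' \<in> W"
    using assms by (auto simp: algebra_simps subspace_add)
  then show "u + v \<in> {w + c *s y |w c. w \<in> W}" by blast
next
  fix a u assume "u \<in> {w + c *s y |w c. w \<in> W}"
  then obtain w c where "u = w + c *s y" "w \<in> W" by auto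
  then have "a *s u = a *s w + (a * c) *s y" "a *s w \<in> W"
    using assms by (auto simp: algebra_simps subspace_scale)
  then show "a *s u \<in> {w + c *s y |w c. w \<in> W}" by blast
qed

text \<open>The complement is a submodule that is maximal among those containing \<open>p\<^sup>j\<^sup>+\<^sup>1 V\<close> and
  avoiding the socle generator \<open>p\<^sup>j y\<close>.\<close>

lemma cyclic_summand:
  assumes max: "\<And>d. \<not> p dvd d \<Longrightarrow> \<exists>e s. e * d + s * p = 1"
    and V: "subspace V" "finite V" and yV: "y \<in> V"
    and y0: "p ^ Suc j *s y = 0" and nz: "\<And>z. z \<in> V \<Longrightarrow> p ^ j *s y \<noteq> p ^ Suc j *s z"
  obtains W where "subspace W" "W \<subseteq> V" "\<And>c. c *s y \<in> W \<Longrightarrow> c *s y = 0"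
    "V = {w + c *s y |w c. w \<in> W}"
proof -
  define F where "F = {W. subspace W \<and> W \<subseteq> V \<and> (\<lambda>z. p ^ Suc j *s z) ` V \<subseteq> W \<and> p ^ j *s y \<notin> W}"
  have yn: "p ^ j *s y \<noteq> 0" using nz[of 0] subspace_0[OF V(1)] by auto
  note order = order_prime_power[OF max y0 yn]
  have fF: "finite F" by (rule finite_subset[of _ "Pow V"]) (auto simp: F_def V)
  \<comment> \<open>F is nonempty because p^(j+1) V itself belongs to it: \<open>nz\<close> says
    exactly that p^j y is not in this submodule.\<close>
  have "(\<lambda>z. p ^ Suc j *s z) ` V \<in> F"
    using V nz by (auto simp: F_def subspace_scaled subspace_scale simp del: power_Suc)
  with fF obtain W where W: "W \<in> F" and mx: "\<And>W'. W' \<in> F \<Longrightarrow> W \<subseteq> W' \<Longrightarrow> W' = W"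
    using finite_has_maximal[of F] by blast
  from W have sW: "subspace W" and WV: "W \<subseteq> V" and pV: "\<And>z. z \<in> V \<Longrightarrow> p ^ Suc j *s z \<in> W"
    and yW: "p ^ j *s y \<notin> W" by (auto simp: F_def)
  \<comment> \<open>A nonzero c y in W would have the socle generator p^j y among its multiples,
    which W avoids.\<close>
  have ind: "c *s y = 0" if "c *s y \<in> W" for c
  proof (rule ccontr)
    assume "c *s y \<noteq> 0"
    then have "\<not> p ^ Suc j dvd c" using order by simp
    from bezout_power[OF max this] obtain a b where ab: "a * c + b * p ^ Suc j = p ^ j" by blast
    have "p ^ j *s y = a *s (c *s y) + b *s (p ^ Suc j *s y)"
      unfolding ab[symmetric] by (simp only: scale_left_distrib scale_scale)
    then have "p ^ j *s y = a *s (c *s y)" by (simp only: y0 scale_zero_right add_0_right)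
    with yW subspace_scale[OF sW that, of a] show False by simp
  qed
  let ?S = "{w + c *s y |w c. w \<in> W}"
  have sS: "subspace ?S" by (rule subspace_sum_cyclic[OF sW])
  have SV: "?S \<subseteq> V" using WV yV V(1) by (auto intro!: subspace_add subspace_scale)
  have WS: "W \<subseteq> ?S"
  proof
    fix x assume "x \<in> W"
    then have "x = x + 0 *s y \<and> x \<in> W" by simp
    then show "x \<in> ?S" by blast
  qed
  have "V \<subseteq> ?S"
  proof (rule ccontr)
    assume "\<not> V \<subseteq> ?S"
    then obtain v0 where v0: "v0 \<in> V" "v0 \<notin> ?S" by blast
    \<comment> \<open>The sequence v0, p v0, p^2 v0, ... reaches \<open>?S\<close> at the latest at
      p^(j+1) v0. The term v just before the first one in \<open>?S\<close> is outside, while p v is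
      inside.\<close>
    define i where "i = (LEAST i. p ^ i *s v0 \<in> ?S)"
    have ex: "p ^ Suc j *s v0 \<in> ?S" using pV[OF v0(1)] WS by blast
    have i1: "p ^ i *s v0 \<in> ?S" unfolding i_def using ex by (rule LeastI)
    have i0: "i \<noteq> 0" using i1 v0(2) by (intro notI) simp
    define v where "v = p ^ (i - 1) *s v0"
    have vV: "v \<in> V" using v0 V by (simp add: v_def subspace_scale)
    have vS: "v \<notin> ?S" unfolding v_def
      using not_less_Least[of "i - 1" "\<lambda>i. p ^ i *s v0 \<in> ?S"] i0 unfolding i_def[symmetric] by auto
    have "p *s v \<in> ?S" using i1 i0 unfolding v_def scale_scale power_Suc[symmetric] by simp
    then obtain w c where pv: "p *s v = w + c *s y" and w: "w \<in> W" by auto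
    \<comment> \<open>Multiplying p v = w + c y by p^j shows that p^j c y is in W, hence zero, and
      therefore p divides c.\<close>
    have "p ^ Suc j *s v = p ^ j *s (p *s v)" by (simp add: mult.commute)
    also have "\<dots> = p ^ j *s w + (p ^ j * c) *s y" by (simp add: pv scale_right_distrib)
    finally have "(p ^ j * c) *s y = p ^ Suc j *s v - p ^ j *s w" by simp
    then have "(p ^ j * c) *s y \<in> W" using pV[OF vV] w sW
      by (simp only: subspace_diff subspace_scale)
    then have "p ^ Suc j dvd p ^ j * c" using ind order by blast
    have "p dvd c"
    proof (rule ccontr)
      assume "\<not> p dvd c"
      from max[OF this] obtain e s where es: "e * c + s * p = 1" by blast
      have "p ^ j = e * (p ^ j * c) + s * p ^ Suc j"
        using arg_cong[OF es, of "(*) (p ^ j)"] by (simp add: algebra_simps)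
      with \<open>p ^ Suc j dvd p ^ j * c\<close> have "p ^ Suc j dvd p ^ j"
        by (metis dvd_add dvd_mult dvd_triv_right)
      with order yn show False by blast
    qed
    then obtain c' where c': "c = p * c'" by auto
    \<comment> \<open>Since c = p c', subtracting c' y from v moves p v into W without moving v into
      \<open>?S\<close>.\<close>
    define v' where "v' = v - c' *s y"
    have v'V: "v' \<in> V" using vV yV V by (simp add: v'_def subspace_diff subspace_scale)
    have v'S: "v' \<notin> ?S"
    proof
      assume "v' \<in> ?S"
      then obtain w d where "v' = w + d *s y" "w \<in> W" by auto
      then have "v = w + (d + c') *s y" by (simp add: v'_def algebra_simps)
      with \<open>w \<in> W\<close> vS show False by blast
    qed
    have pv': "p *s v' = w" by (simp add: v'_def scale_right_diff_distrib pv c')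
    let ?W' = "{w + c *s v' |w c. w \<in> W}"
    have WW': "W \<subseteq> ?W'"
    proof
      fix x assume "x \<in> W"
      then have "x = x + 0 *s v' \<and> x \<in> W" by simp
      then show "x \<in> ?W'" by blast
    qed
    then have "?W' \<in> F \<Longrightarrow> W = ?W'" using mx[of ?W'] by simp
    moreover have "v' \<in> ?W'" using subspace_0[OF sW] by (auto intro!: exI[of _ 0] exI[of _ 1])
    ultimately have "?W' \<notin> F" using v'S WS by blast
    moreover have "subspace ?W'" by (rule subspace_sum_cyclic[OF sW])
    moreover have "?W' \<subseteq> V" using WV v'V V(1) by (auto intro!: subspace_add subspace_scale)
    moreover have "(\<lambda>z. p ^ Suc j *s z) ` V \<subseteq> ?W'"
      using pV WW' by blast
    ultimately have "p ^ j *s y \<in> ?W'" by (simp add: F_def)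
    then obtain w' d where eq: "p ^ j *s y = w' + d *s v'" and w': "w' \<in> W" by auto
    \<comment> \<open>Maximality of W forced p^j y = w' + d v'. As p v' is in W, the coefficient d
      must be invertible modulo p, and the equation can be solved for v' in terms of W and
      y.\<close>
    have "\<not> p dvd d"
    proof
      assume "p dvd d"
      then obtain d' where "d = d' * p" by (auto simp: dvd_def mult.commute)
      then have "d *s v' = d' *s w" by (simp flip: pv')
      with eq w w' sW have "p ^ j *s y \<in> W" by (simp add: subspace_add subspace_scale)
      with yW show False by simp
    qed
    from max[OF this] obtain e s where es: "e * d + s * p = 1" by blast
    have "v' = (e * d + s * p) *s v'" by (simp add: es)
    also have "\<dots> = e *s (d *s v') + s *s w" by (simp add: scale_left_distrib pv'[symmetric])
    also have "d *s v' = p ^ j *s y - w'" by (simp add: eq)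
    finally have "v' = (s *s w - e *s w') + (e * p ^ j) *s y"
      by (simp add: algebra_simps)
    moreover have "s *s w - e *s w' \<in> W" using sW w w' by (simp add: subspace_diff subspace_scale)
    ultimately show False using v'S by blast
  qed
  with SV have "V = ?S" by blast
  with that[OF sW WV ind] show thesis by blast
qed

text \<open>Modifying \<open>\<alpha>\<close> modulo \<open>pV\<close> so that its order \<open>p\<^sup>j\<^sup>+\<^sup>1\<close> is minimal makes it generate a summand.\<close>

lemma ex_minimal_order_representative:
  assumes V: "subspace V" "finite V" and a: "\<alpha> \<in> V" "\<And>z. z \<in> V \<Longrightarrow> \<alpha> \<noteq> p *s z"
  obtains \<beta> j where "\<beta> \<in> V" "p ^ Suc j *s (\<alpha> + p *s \<beta>) = 0"
    "\<And>z. z \<in> V \<Longrightarrow> p ^ j *s (\<alpha> + p *s \<beta>) \<noteq> p ^ Suc j *s z"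
proof -
  define Q where "Q k \<longleftrightarrow> (\<exists>\<beta>\<in>V. p ^ k *s (\<alpha> + p *s \<beta>) = 0)" for k
  have "\<not> inj (\<lambda>i. p ^ i *s \<alpha>)"
  proof
    assume "inj (\<lambda>i::nat. p ^ i *s \<alpha>)"
    then have "infinite (range (\<lambda>i::nat. p ^ i *s \<alpha>))" by (rule range_inj_infinite)
    moreover have "range (\<lambda>i::nat. p ^ i *s \<alpha>) \<subseteq> V" using V a by (auto simp: subspace_scale)
    ultimately show False using V finite_subset by blast
  qed
  then obtain i j where ij: "p ^ i *s \<alpha> = p ^ j *s \<alpha>" "i < j"
    unfolding inj_def by (metis linorder_neqE_nat)
  \<comment> \<open>For i < j the equality p^i \<alpha> = p^j \<alpha> reads p^i (\<alpha> - p^(j-i)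
    \<alpha>) = 0, and p^(j-i) \<alpha> is in pV. So \<beta> = - p^(j-i-1) \<alpha> witnesses Q
    i.\<close>
  have "p ^ j = p ^ (i + Suc (j - i - 1))" using ij(2) by simp
  then have "p ^ j = p ^ i * (p * p ^ (j - i - 1))" by (simp only: power_add power_Suc)
  then have "p ^ i *s (\<alpha> + p *s (- (p ^ (j - i - 1) *s \<alpha>))) = 0"
    using ij(1) by (simp add: scale_right_diff_distrib del: power_Suc)
  then have "Q i" unfolding Q_def using V a by (blast intro: subspace_neg subspace_scale)
  define k where "k = (LEAST k. Q k)"
  have Qk: "Q k" unfolding k_def using \<open>Q i\<close> by (rule LeastI)
  have min: "\<not> Q l" if "l < k" for l using not_less_Least that unfolding k_def by blast
  have "\<not> Q 0"
  proof
    assume "Q 0"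
    then obtain \<beta> where "\<beta> \<in> V" "\<alpha> + p *s \<beta> = 0" by (auto simp: Q_def)
    then have "\<alpha> = p *s (- \<beta>)" "- \<beta> \<in> V" using V by (auto simp: subspace_neg eq_neg_iff_add_eq_0)
    with a(2) show False by blast
  qed
  with Qk obtain l where l: "k = Suc l" by (cases k) auto
  from Qk obtain \<beta> where b: "\<beta> \<in> V" "p ^ Suc l *s (\<alpha> + p *s \<beta>) = 0" by (auto simp: Q_def l)
  \<comment> \<open>Otherwise \<beta> - z would give a representative that p^l already kills,
    against the choice of k = l + 1.\<close>
  have "p ^ l *s (\<alpha> + p *s \<beta>) \<noteq> p ^ Suc l *s z" if "z \<in> V" for z
  proof
    assume e: "p ^ l *s (\<alpha> + p *s \<beta>) = p ^ Suc l *s z"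
    have "p ^ Suc l *s z = p ^ l *s (p *s z)" by (simp add: mult.commute)
    with e have "p ^ l *s (\<alpha> + p *s (\<beta> - z)) = 0"
      by (simp add: scale_right_distrib scale_right_diff_distrib algebra_simps)
    moreover have "\<beta> - z \<in> V" using V b that by (simp add: subspace_diff)
    ultimately have "Q l" unfolding Q_def by blast
    with min[of l] l show False by simp
  qed
  with that[OF b] show thesis by blast
qed

text \<open>Coefficients are functions on all natural numbers, and values from the length of gs on
  do not matter. This spares length conditions and makes sums and multiples of combinations
  pointwise.\<close>

definition comb :: "('r \<times> 'v) list \<Rightarrow> (nat \<Rightarrow> 'r) \<Rightarrow> 'v" where
  "comb gs c = (\<Sum>i<length gs. c i *s snd (gs ! i))"

text \<open>\<open>V\<close> is the direct sum of cyclic modules; each summand is given by its order and a generator.\<close>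

definition cyclic_decomp :: "'v set \<Rightarrow> ('r \<times> 'v) list \<Rightarrow> bool" where
  "cyclic_decomp V gs \<longleftrightarrow> V = range (comb gs) \<and>
     (\<forall>c. comb gs c = 0 \<longleftrightarrow> (\<forall>i<length gs. fst (gs ! i) dvd c i))"

lemma comb_Nil [simp]: "comb [] c = 0"
  by (simp add: comb_def)

lemma comb_Cons [simp]: "comb (g # gs) c = c 0 *s snd g + comb gs (c \<circ> Suc)"
  unfolding comb_def length_Cons by (subst sum.lessThan_Suc_shift) simp

lemma comb_add: "comb gs c + comb gs d = comb gs (\<lambda>i. c i + d i)"
  by (simp add: comb_def scale_left_distrib sum.distrib)

lemma comb_diff: "comb gs c - comb gs d = comb gs (\<lambda>i. c i - d i)"
  by (simp add: comb_def scale_left_diff_distrib sum_subtractf)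

lemma comb_scale: "a *s comb gs c = comb gs (\<lambda>i. a * c i)"
  by (simp add: comb_def scale_sum_right)

lemma comb_delta: "i < length gs \<Longrightarrow> comb gs (\<lambda>l. if l = i then a else 0) = a *s snd (gs ! i)"
  by (simp add: comb_def if_distrib[of "\<lambda>x. x *s _"] sum.delta cong: if_cong)

lemma cyclic_decomp_eq_iff:
  assumes "cyclic_decomp V gs"
  shows "comb gs c = comb gs d \<longleftrightarrow> (\<forall>i<length gs. fst (gs ! i) dvd c i - d i)"
proof -
  have "comb gs c = comb gs d \<longleftrightarrow> comb gs (\<lambda>i. c i - d i) = 0" by (simp flip: comb_diff)
  with assms show ?thesis by (simp add: cyclic_decomp_def)
qed

lemma cyclic_decomp_range: "cyclic_decomp V gs \<Longrightarrow> V = range (comb gs)"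
  by (simp add: cyclic_decomp_def)

lemma cyclic_decomp_eq_0_iff:
  "cyclic_decomp V gs \<Longrightarrow> comb gs c = 0 \<longleftrightarrow> (\<forall>i<length gs. fst (gs ! i) dvd c i)"
  by (simp add: cyclic_decomp_def)

text \<open>Injectivity of multiplication by a can be tested on each summand separately. With a = t
  this yields the invertibility of the representatives.\<close>

lemma cyclic_decomp_mult_inj:
  assumes d: "cyclic_decomp V gs" and a: "\<And>g c. g \<in> set gs \<Longrightarrow> fst g dvd a * c \<Longrightarrow> fst g dvd c"
    and v: "v \<in> V" "a *s v = 0"
  shows "v = 0"
proof -
  from v obtain c where c: "v = comb gs c" using cyclic_decomp_range[OF d] by blast
  note eq0 = cyclic_decomp_eq_0_iff[OF d]
  have "comb gs (\<lambda>i. a * c i) = 0" using v(2) unfolding c comb_scale .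
  then show ?thesis using a nth_mem unfolding c eq0 by blast
qed

lemma cyclic_decomp_generator:
  assumes "cyclic_decomp V gs" "i < length gs"
  shows "snd (gs ! i) \<in> V"
  using assms comb_delta[of i gs 1] unfolding cyclic_decomp_def by (metis rangeI scale_one)

lemma cyclic_decomp_Nil [simp]: "cyclic_decomp V [] \<longleftrightarrow> V = {0}"
  by (auto simp: cyclic_decomp_def)

lemma cyclic_decomp_Cons:
  assumes W: "cyclic_decomp W gs" and o: "\<And>c. c *s y = 0 \<longleftrightarrow> r dvd c"
    and ind: "\<And>c. c *s y \<in> W \<Longrightarrow> c *s y = 0" and V: "V = {w + c *s y |w c. w \<in> W}"
  shows "cyclic_decomp V ((r, y) # gs)"
  unfolding cyclic_decomp_def
proof (intro conjI allI)
  have rW: "W = range (comb gs)" using W by (simp add: cyclic_decomp_def)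
  show "V = range (comb ((r, y) # gs))"
  proof (intro equalityI subsetI)
    fix v assume "v \<in> V"
    then obtain c a where "v = comb gs c + a *s y" by (auto simp: V rW)
    then have "v = comb ((r, y) # gs) (case_nat a c)" by (simp add: comp_def add.commute)
    then show "v \<in> range (comb ((r, y) # gs))" by blast
  next
    fix v assume "v \<in> range (comb ((r, y) # gs))"
    then obtain c where "v = comb gs (c \<circ> Suc) + c 0 *s y" by (auto simp: add.commute)
    then show "v \<in> V" unfolding V rW by blast
  qed
  fix c
  have "comb ((r, y) # gs) c = 0 \<longleftrightarrow> c 0 *s y = 0 \<and> comb gs (c \<circ> Suc) = 0"
  proof
    assume z: "comb ((r, y) # gs) c = 0"
    have "c 0 *s y = comb gs (\<lambda>i. (-1) * (c \<circ> Suc) i)"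
      using z unfolding comb_scale[symmetric] by (simp add: eq_neg_iff_add_eq_0 comp_def)
    then have "c 0 *s y = 0" using ind rW by blast
    with z show "c 0 *s y = 0 \<and> comb gs (c \<circ> Suc) = 0" by simp
  qed simp
  also have "\<dots> \<longleftrightarrow> r dvd c 0 \<and> (\<forall>i<length gs. fst (gs ! i) dvd c (Suc i))"
    using W by (simp add: cyclic_decomp_def o)
  also have "\<dots> \<longleftrightarrow> (\<forall>i<length ((r, y) # gs). fst (((r, y) # gs) ! i) dvd c i)"
    by (auto simp: less_Suc_eq_0_disj)
  finally show "comb ((r, y) # gs) c = 0 \<longleftrightarrow> (\<forall>i<length ((r, y) # gs). fst (((r, y) # gs) ! i) dvd c i)" .
qed

text \<open>A decomposition found by induction has its summands in an uncontrolled order; here it is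
  brought into the order of the blocks of a given matrix.\<close>

lemma cyclic_decomp_permute:
  assumes d: "cyclic_decomp V gs" and m: "mset gs' = mset gs"
  shows "cyclic_decomp V gs'"
proof -
  obtain \<pi> where \<pi>: "\<pi> permutes {..<length gs}" and gs': "permute_list \<pi> gs = gs'"
    using mset_eq_permutation[OF m] by blast
  have len: "length gs' = length gs" using gs' by auto
  have nth: "gs' ! i = gs ! \<pi> i" if "i < length gs" for i
    using permute_list_nth[OF \<pi> that] gs' by simp
  have comb: "comb gs' c = comb gs (c \<circ> inv_into UNIV \<pi>)" for c
  proof -
    have "comb gs' c = (\<Sum>i<length gs. (c \<circ> inv_into UNIV \<pi>) (\<pi> i) *s snd (gs ! \<pi> i))"
      unfolding comb_def len by (rule sum.cong) (auto simp: nth permutes_inverses[OF \<pi>])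
    also have "\<dots> = comb gs (c \<circ> inv_into UNIV \<pi>)"
      unfolding comb_def by (rule sum.permute[OF \<pi>, symmetric, unfolded comp_def, simplified])
    finally show ?thesis .
  qed
  have "range (comb gs') = range (comb gs)"
  proof (intro equalityI subsetI)
    fix x assume "x \<in> range (comb gs)"
    then obtain c where "x = comb gs c" by blast
    also have "\<dots> = comb gs' (c \<circ> \<pi>)" by (simp add: comb comp_assoc permutes_inv_o[OF \<pi>])
    finally show "x \<in> range (comb gs')" by blast
  qed (auto simp: comb)
  moreover have "comb gs' c = 0 \<longleftrightarrow> (\<forall>i<length gs'. fst (gs' ! i) dvd c i)" for c
  proof -
    have "comb gs' c = 0 \<longleftrightarrow> (\<forall>i\<in>{..<length gs}. fst (gs ! i) dvd c (inv_into UNIV \<pi> i))"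
      using d by (auto simp: comb cyclic_decomp_def)
    also have "\<dots> \<longleftrightarrow> (\<forall>i\<in>\<pi> ` {..<length gs}. fst (gs ! i) dvd c (inv_into UNIV \<pi> i))"
      by (simp add: permutes_image[OF \<pi>])
    also have "\<dots> \<longleftrightarrow> (\<forall>i<length gs'. fst (gs' ! i) dvd c i)"
      by (auto simp: len nth permutes_inverses[OF \<pi>])
    finally show ?thesis .
  qed
  ultimately show ?thesis using d by (simp add: cyclic_decomp_def)
qed

text \<open>Each order is split as b g, where g plays the role of its gcd with a. On a summand with
  generator y, multiplication by a kills c y exactly when b divides c, so the kernel is generated by
  b y, whose order is g.\<close>

lemma cyclic_decomp_kernel:
  assumes d: "cyclic_decomp V (map (\<lambda>(b, g, y). (b * g, y)) L)"
    and L: "\<And>b g y c. (b, g, y) \<in> set L \<Longrightarrow> b * g dvd a * c \<longleftrightarrow> b dvd c"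
      "\<And>b g y c. (b, g, y) \<in> set L \<Longrightarrow> b * g dvd b * c \<longleftrightarrow> g dvd c"
  shows "cyclic_decomp {v \<in> V. a *s v = 0} (map (\<lambda>(b, g, y). (g, b *s y)) L)"
proof -
  let ?L = "map (\<lambda>(b, g, y). (b * g, y)) L" and ?K = "map (\<lambda>(b, g, y). (g, b *s y)) L"
  let ?b = "\<lambda>i. fst (L ! i)" and ?g = "\<lambda>i. fst (snd (L ! i))"
  have K: "comb ?K c = comb ?L (\<lambda>i. ?b i * c i)" for c
    unfolding comb_def by (rule sum.cong) (auto simp: case_prod_beta mult.commute)
  have L0: "comb ?L c = 0 \<longleftrightarrow> (\<forall>i<length L. ?b i * ?g i dvd c i)" for c
    using d by (simp add: cyclic_decomp_def case_prod_beta)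
  have L': "?b i * ?g i dvd a * c \<longleftrightarrow> ?b i dvd c" "?b i * ?g i dvd ?b i * c \<longleftrightarrow> ?g i dvd c"
    if "i < length L" for i c
    using L[of "?b i" "?g i" "snd (snd (L ! i))"] nth_mem[OF that] by simp_all
  have ker: "a *s comb ?L c = 0 \<longleftrightarrow> (\<forall>i<length L. ?b i dvd c i)" for c
    unfolding comb_scale L0 using L' by auto
  have "{v \<in> V. a *s v = 0} = range (comb ?K)"
  proof (intro equalityI subsetI)
    fix v assume "v \<in> {v \<in> V. a *s v = 0}"
    then obtain c where v: "v = comb ?L c" and "a *s v = 0" using d by (auto simp: cyclic_decomp_def)
    then have "\<forall>i<length L. \<exists>e. c i = ?b i * e" using ker by (auto simp: dvd_def)
    then obtain e where e: "\<And>i. i < length L \<Longrightarrow> c i = ?b i * e i" by metis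
    have "v = comb ?K e" unfolding v K unfolding comb_def by (rule sum.cong) (auto simp: e)
    then show "v \<in> range (comb ?K)" by blast
  next
    fix v assume "v \<in> range (comb ?K)"
    then obtain c where v: "v = comb ?K c" by blast
    have "v \<in> V" using d by (auto simp: v K cyclic_decomp_def)
    moreover have "a *s v = 0" unfolding v K ker by simp
    ultimately show "v \<in> {v \<in> V. a *s v = 0}" by simp
  qed
  moreover have "comb ?K c = 0 \<longleftrightarrow> (\<forall>i<length ?K. fst (?K ! i) dvd c i)" for c
    unfolding K L0 using L' by (auto simp: case_prod_beta)
  ultimately show ?thesis unfolding cyclic_decomp_def by blast
qed

end

section \<open>Isomorphisms between direct sums of cyclic modules\<close>

definition module_iso ::
  "('r \<Rightarrow> 'b::ab_group_add \<Rightarrow> 'b) \<Rightarrow> ('r \<Rightarrow> 'c::ab_group_add \<Rightarrow> 'c) \<Rightarrow> 'b set \<Rightarrow> 'c set \<Rightarrow> ('b \<Rightarrow> 'c) \<Rightarrow> bool" where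
  "module_iso s1 s2 V1 V2 \<phi> \<longleftrightarrow> bij_betw \<phi> V1 V2 \<and>
     (\<forall>x\<in>V1. \<forall>y\<in>V1. \<phi> (x + y) = \<phi> x + \<phi> y) \<and> (\<forall>a. \<forall>x\<in>V1. \<phi> (s1 a x) = s2 a (\<phi> x))"

text \<open>Equality of two combinations is the same divisibility condition on both sides, so
  keeping the coefficients is well defined and injective. That corresponding generators are matched
  matters later: it sends the representative of \<alpha> to \<epsilon>_k.\<close>

lemma ex_module_iso:
  assumes "ring_module s1" "ring_module s2"
    and d1: "ring_module.cyclic_decomp s1 V1 gs1" and d2: "ring_module.cyclic_decomp s2 V2 gs2"
    and eq: "map fst gs1 = map fst gs2"
  obtains \<phi> where "module_iso s1 s2 V1 V2 \<phi>" "\<And>i. i < length gs1 \<Longrightarrow> \<phi> (snd (gs1 ! i)) = snd (gs2 ! i)"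
proof -
  interpret m1: ring_module s1 by fact
  interpret m2: ring_module s2 by fact
  have len: "length gs1 = length gs2" using eq by (metis length_map)
  have fst: "fst (gs1 ! i) = fst (gs2 ! i)" if "i < length gs2" for i
    using eq that len by (metis nth_map)
  have eq_iff: "m1.comb gs1 c = m1.comb gs1 d \<longleftrightarrow> m2.comb gs2 c = m2.comb gs2 d" for c d
    unfolding m1.cyclic_decomp_eq_iff[OF d1] m2.cyclic_decomp_eq_iff[OF d2] using len fst by auto
  have V1: "V1 = range (m1.comb gs1)" and V2: "V2 = range (m2.comb gs2)"
    using d1 d2 by (auto simp: m1.cyclic_decomp_def m2.cyclic_decomp_def)
  define \<phi> where "\<phi> v = m2.comb gs2 (SOME c. m1.comb gs1 c = v)" for v
  have \<phi>: "\<phi> (m1.comb gs1 c) = m2.comb gs2 c" for c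
    unfolding \<phi>_def eq_iff[symmetric] by (rule someI[of _ c]) simp
  have "bij_betw \<phi> V1 V2"
    unfolding bij_betw_def inj_on_def V1 V2 by (auto simp: \<phi> eq_iff intro: rev_image_eqI)
  then have "module_iso s1 s2 V1 V2 \<phi>"
    unfolding module_iso_def V1
    by (auto simp: m1.comb_add m2.comb_add m1.comb_scale m2.comb_scale \<phi>)
  moreover have "\<phi> (snd (gs1 ! i)) = snd (gs2 ! i)" if "i < length gs1" for i
    using \<phi>[of "\<lambda>l. if l = i then 1 else 0"] that len by (simp add: m1.comb_delta m2.comb_delta)
  ultimately show thesis by (rule that)
qed

section \<open>Primary decompositions over a polynomial ring\<close>

text \<open>A nonzero element g of least degree in the ideal (d, p) divides both. It is not an
  associate of p, since p does not divide d, so it is a unit. This supplies the hypothesis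
  \<open>max\<close> of the module lemmas.\<close>

lemma irreducible_bezout:
  fixes p :: "'a::field poly"
  assumes p: "irreducible p" and d: "\<not> p dvd d"
  shows "\<exists>e s. e * d + s * p = 1"
proof -
  define I where "I = {e * d + s * p |e s. True}"
  have lin: "u - w * g \<in> I" if "u \<in> I" "g \<in> I" for u w g
  proof -
    from that obtain e s e' s' where "u = e * d + s * p" "g = e' * d + s' * p" by (auto simp: I_def)
    then have "u - w * g = (e - w * e') * d + (s - w * s') * p" by (simp add: algebra_simps)
    then show ?thesis unfolding I_def by blast
  qed
  have "p = 0 * d + 1 * p" "d = 1 * d + 0 * p" by simp_all
  then have pd: "p \<in> I" "d \<in> I" unfolding I_def by blast+
  have "p \<noteq> 0" using p by auto
  define g where "g = arg_min degree (\<lambda>g. g \<in> I \<and> g \<noteq> 0)"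
  have g: "g \<in> I" "g \<noteq> 0" and min: "\<And>h. h \<in> I \<Longrightarrow> h \<noteq> 0 \<Longrightarrow> degree g \<le> degree h"
    using arg_min_nat_lemma[of "\<lambda>g. g \<in> I \<and> g \<noteq> 0" p degree] pd(1) \<open>p \<noteq> 0\<close>
    unfolding g_def by auto
  have dvd: "g dvd u" if "u \<in> I" for u
  proof (rule ccontr)
    assume "\<not> g dvd u"
    then have "u mod g \<noteq> 0" by (simp add: mod_eq_0_iff_dvd)
    moreover have "u mod g = u - (u div g) * g" by (simp add: minus_div_mult_eq_mod)
    ultimately show False using min[of "u mod g"] lin[OF that g(1)] degree_mod_less'[of g u] g(2)
      by fastforce
  qed
  from dvd[OF pd(1)] obtain u where u: "p = g * u" by auto
  have "is_unit g"
  proof (rule ccontr)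
    assume "\<not> is_unit g"
    with p u have "is_unit u" by (auto dest: irreducibleD)
    then have "p dvd g" using u by (simp add: mult_unit_dvd_iff)
    with dvd[OF pd(2)] d show False by (meson dvd_trans)
  qed
  then obtain h where h: "g * h = 1" by (auto simp: dvd_def)
  from g(1) obtain e s where "g = e * d + s * p" by (auto simp: I_def)
  with h have "(h * e) * d + (h * s) * p = 1" by (simp add: algebra_simps)
  then show ?thesis by blast
qed

section \<open>Separability of irreducible polynomials over a finite field\<close>

text \<open>The Frobenius map is additive and has trivial kernel, so it is injective, and on a
  finite field also surjective.\<close>

lemma ex_CHAR_root:
  fixes a :: "'a::{field, finite}"
  shows "\<exists>r. r ^ CHAR('a) = a"
proof -
  have pr: "prime CHAR('a)"
    by (rule prime_CHAR_semidom) (simp add: finite_imp_CHAR_pos)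
  have "inj (\<lambda>x::'a. x ^ CHAR('a))"
  proof (rule injI)
    fix x y :: 'a assume "x ^ CHAR('a) = y ^ CHAR('a)"
    moreover have "((x - y) + y) ^ CHAR('a) = (x - y) ^ CHAR('a) + y ^ CHAR('a)"
      by (rule freshmans_dream[OF pr refl])
    ultimately show "x = y" by simp
  qed
  then have "surj (\<lambda>x::'a. x ^ CHAR('a))" by (simp add: finite_UNIV_inj_surj)
  then show ?thesis by (metis surjD)
qed

text \<open>For degree reasons f can divide f' only if f' = 0. Then only exponents divisible by the
  characteristic occur in f, and taking roots of the coefficients exhibits f as a proper
  power.\<close>

lemma irreducible_not_dvd_pderiv:
  fixes f :: "'a::{field, finite} poly"
  assumes f: "irreducible f"
  shows "\<not> f dvd pderiv f"
proof
  assume dvd: "f dvd pderiv f"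
  let ?p = "CHAR('a)"
  have pr: "prime ?p" by (rule prime_CHAR_semidom) (simp add: finite_imp_CHAR_pos)
  have f0: "f \<noteq> 0" using f by auto
  have fu: "\<not> is_unit f" using f by (auto simp: irreducible_def)
  have "degree f > 0" using fu f0 by (metis is_unit_iff_degree neq0_conv)
  have d0: "pderiv f = 0"
  proof (rule ccontr)
    assume "pderiv f \<noteq> 0"
    with dvd have "degree f \<le> degree (pderiv f)" by (rule dvd_imp_degree_le)
    moreover have "degree (pderiv f) \<le> degree f - 1"
      by (rule degree_le) (auto simp: coeff_pderiv coeff_eq_0)
    ultimately show False using \<open>degree f > 0\<close> by simp
  qed
  have cf: "?p dvd i" if "coeff f i \<noteq> 0" for i
  proof (cases i)
    case (Suc m)
    have "coeff (pderiv f) m = 0" using d0 by simp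
    with that Suc have "of_nat i = (0::'a)" by (simp add: coeff_pderiv)
    then show ?thesis by (simp add: of_nat_eq_0_iff_char_dvd)
  qed simp
  obtain r :: "'a \<Rightarrow> 'a" where r: "\<And>a. r a ^ ?p = a" using ex_CHAR_root by metis
  \<comment> \<open>The range of i is generous: for i * ?p beyond the degree of f the coefficient is
    0, and such terms vanish in the power of g.\<close>
  define g where "g = (\<Sum>i\<le>degree f. monom (r (coeff f (i * ?p))) i)"
  have "g ^ ?p = (\<Sum>i\<le>degree f. monom (r (coeff f (i * ?p))) i ^ ?p)"
    unfolding g_def by (rule freshmans_dream_sum) (simp_all add: pr)
  also have "\<dots> = (\<Sum>i\<le>degree f. monom (coeff f (i * ?p)) (i * ?p))"
    by (simp add: monom_power r)
  also have "\<dots> = f"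
  proof (rule poly_eqI)
    fix k
    have "coeff (\<Sum>i\<le>degree f. monom (coeff f (i * ?p)) (i * ?p)) k =
        (\<Sum>i\<le>degree f. if i * ?p = k then coeff f k else 0)"
      unfolding coeff_sum by (rule sum.cong) auto
    also have "\<dots> = coeff f k"
    proof (cases "coeff f k = 0")
      case False
      with cf obtain m where m: "k = m * ?p" by (auto simp: dvd_def mult.commute)
      have "k \<le> degree f" using False by (rule le_degree)
      then have "m \<le> degree f" using m pr prime_gt_0_nat[OF pr]
        by (metis Suc_leI le_trans mult.right_neutral mult_le_mono2 One_nat_def)
      moreover have "\<And>i. i * ?p = k \<longleftrightarrow> i = m" using m prime_gt_0_nat[OF pr] by auto
      ultimately show ?thesis by (simp only:) (simp add: sum.delta')
    qed (simp cong: if_cong)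
    finally show "coeff (\<Sum>i\<le>degree f. monom (coeff f (i * ?p)) (i * ?p)) k = coeff f k" .
  qed
  finally have gf: "f = g * g ^ (?p - 1)" using prime_gt_0_nat[OF pr]
    by (metis power_minus_mult mult.commute)
  then have "is_unit g \<or> is_unit (g ^ (?p - 1))" using f by (auto dest: irreducibleD)
  moreover have "?p - 1 \<noteq> 0" using prime_gt_1_nat[OF pr] by simp
  ultimately have "is_unit g" by (auto simp: is_unit_power_iff)
  with gf fu show False by (metis is_unit_mult_iff is_unit_power_iff)
qed

section \<open>Arithmetic of monic irreducible polynomials\<close>

lemma monic_irreducible_dvd_eq:
  fixes f g :: "'a::field poly"
  assumes f: "irreducible f" "lead_coeff f = 1" and g: "irreducible g" "lead_coeff g = 1"
    and dvd: "f dvd g"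
  shows "f = g"
proof -
  from dvd obtain u where u: "g = f * u" by auto
  have "\<not> is_unit f" using f by (auto simp: irreducible_def)
  with u g have "is_unit u" by (auto dest: irreducibleD)
  then obtain c where c: "u = [:c:]" using is_unit_polyE by metis
  have "lead_coeff g = lead_coeff f * c" unfolding u c by (simp add: lead_coeff_mult)
  then have "c = 1" using f g by simp
  then show ?thesis using u c by (simp add: one_pCons)
qed

lemma Phi_not_dvd_t:
  assumes "f \<in> Phi"
  shows "\<not> f dvd [:0, 1:]"
  using assms monic_irreducible_dvd_eq[of f "[:0, 1:]"] irreducible_linear_field_poly[of 1 0]
  by (auto simp: Phi_def)

lemma Phi_irreducible: "f \<in> Phi \<Longrightarrow> irreducible f"
  by (simp add: Phi_def)

lemma Phi_nonzero: "f \<in> Phi \<Longrightarrow> f \<noteq> 0"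
  by (auto simp: Phi_def)

lemma Phi_degree_pos: "f \<in> Phi \<Longrightarrow> degree f > 0"
  using is_unit_iff_degree[of f] by (auto simp: Phi_def irreducible_def)

lemma Phi_degree_power: "f \<in> Phi \<Longrightarrow> degree (f ^ k) = degree f * k"
  by (simp add: degree_power_eq Phi_nonzero mult.commute)

lemma t_minus_1_Phi: "t_minus_1 \<in> Phi"
  by (auto simp: Phi_def irreducible_linear_field_poly)

text \<open>Distinct members of \<open>Phi\<close> are coprime. Hence multiplication by p^j is
  injective on the summands belonging to other irreducibles.\<close>

lemma Phi_dvd_power_mult_iff:
  fixes f p :: "'a::field poly"
  assumes "f \<in> Phi" "p \<in> Phi" "f \<noteq> p"
  shows "f ^ k dvd p ^ j * c \<longleftrightarrow> f ^ k dvd c"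
proof (cases "k = 0")
  case False
  have pf: "prime_elem f" using assms by (simp add: Phi_irreducible field_poly_irreducible_imp_prime)
  have "\<not> f dvd p ^ j" using prime_elem_dvd_power[OF pf, of p j] monic_irreducible_dvd_eq[of f p] assms
    by (auto simp: Phi_def)
  with pf False show ?thesis by (auto dest: prime_power_dvd_multD)
qed simp

lemma infinite_UNIV_poly: "infinite (UNIV :: 'a::field poly set)"
proof -
  have "inj (\<lambda>n. monom (1::'a) n)"
    by (rule injI) (metis degree_monom_eq zero_neq_one)
  then show ?thesis using infinite_iff_countable_subset by blast
qed

text \<open>The condition on coefficients, unlike \<open>degree p < d\<close>, keeps the zero
  polynomial when d = 0.\<close>

lemma card_poly_degree_less:
  "card {p :: 'a::{field, finite} poly. \<forall>i\<ge>d. coeff p i = 0} = CARD('a) ^ d"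
proof -
  have "bij_betw (\<lambda>p. \<lambda>i\<in>{..<d}. coeff p i) {p :: 'a poly. \<forall>i\<ge>d. coeff p i = 0} ({..<d} \<rightarrow>\<^sub>E UNIV)"
  proof (rule bij_betwI')
    fix p q :: "'a poly"
    assume pq: "p \<in> {p. \<forall>i\<ge>d. coeff p i = 0}" "q \<in> {p. \<forall>i\<ge>d. coeff p i = 0}"
    show "(\<lambda>i\<in>{..<d}. coeff p i) = (\<lambda>i\<in>{..<d}. coeff q i) \<longleftrightarrow> p = q"
    proof
      assume e: "(\<lambda>i\<in>{..<d}. coeff p i) = (\<lambda>i\<in>{..<d}. coeff q i)"
      show "p = q"
      proof (rule poly_eqI)
        fix i show "coeff p i = coeff q i"
          using fun_cong[OF e, of i] pq by (cases "i < d") auto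
      qed
    qed simp
  next
    fix h :: "nat \<Rightarrow> 'a" assume h: "h \<in> {..<d} \<rightarrow>\<^sub>E UNIV"
    define p where "p = Abs_poly (\<lambda>i. if i < d then h i else 0)"
    have p: "coeff p i = (if i < d then h i else 0)" for i
      unfolding p_def by (subst coeff_Abs_poly[of d]) auto
    have "h = (\<lambda>i\<in>{..<d}. coeff p i)" using h by (auto simp: p restrict_def PiE_def extensional_def)
    moreover have "p \<in> {p. \<forall>i\<ge>d. coeff p i = 0}" by (simp add: p)
    ultimately show "\<exists>p\<in>{p. \<forall>i\<ge>d. coeff p i = 0}. h = (\<lambda>i\<in>{..<d}. coeff p i)" by blast
  qed simp
  then show ?thesis by (simp add: bij_betw_same_card card_PiE)
qed

section \<open>Existence of primary decompositions\<close>

locale poly_module = ring_module scale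
  for scale :: "'a::field poly \<Rightarrow> 'v::ab_group_add \<Rightarrow> 'v" (infixr \<open>*s\<close> 75)
begin

text \<open>The pair (f, k) is stored in place of the order f^k, so that \<open>map fst gs\<close>
  can be compared directly with a list of blocks.\<close>

definition primary_decomp :: "'v set \<Rightarrow> (('a poly \<times> nat) \<times> 'v) list \<Rightarrow> bool" where
  "primary_decomp V gs \<longleftrightarrow> cyclic_decomp V (map (\<lambda>((f, k), y). (f ^ k, y)) gs) \<and>
     (\<forall>((f, k), y) \<in> set gs. f \<in> Phi \<and> 1 \<le> k)"

text \<open>There are infinitely many polynomials and finitely many vectors, so some nonzero
  polynomial kills a nonzero vector. One of least degree over all such vectors is irreducible: if a
  b kills v, then either b kills v or a kills the nonzero vector b v.\<close>

lemma ex_irreducible_annihilator: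
  assumes V: "subspace V" "finite V" and V0: "V \<noteq> {0}"
  obtains p v where "irreducible p" "lead_coeff p = 1" "v \<in> V" "v \<noteq> 0" "p *s v = 0"
proof -
  define Q where "Q p \<longleftrightarrow> p \<noteq> 0 \<and> (\<exists>v\<in>V. v \<noteq> 0 \<and> p *s v = 0)" for p
  obtain v0 where v0: "v0 \<in> V" "v0 \<noteq> 0" using V0 subspace_0[OF V(1)] by auto
  have "\<not> inj (\<lambda>c. c *s v0)"
  proof
    assume "inj (\<lambda>c. c *s v0)"
    then have "infinite (range (\<lambda>c. c *s v0))" using finite_imageD infinite_UNIV_poly by blast
    moreover have "range (\<lambda>c. c *s v0) \<subseteq> V" using V v0 by (auto simp: subspace_scale)
    ultimately show False using V finite_subset by blast
  qed
  then obtain c d where "c \<noteq> d" "c *s v0 = d *s v0" by (auto simp: inj_def)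
  then have Qcd: "Q (c - d)" unfolding Q_def using v0 by (auto simp: scale_left_diff_distrib)
  define p where "p = arg_min degree Q"
  have Qp: "Q p" and min: "\<And>q. Q q \<Longrightarrow> degree p \<le> degree q"
    using arg_min_nat_lemma[of Q, OF Qcd] unfolding p_def by auto
  from Qp obtain v where p0: "p \<noteq> 0" and v: "v \<in> V" "v \<noteq> 0" "p *s v = 0" by (auto simp: Q_def)
  define q where "q = smult (inverse (lead_coeff p)) p"
  have q0: "q \<noteq> 0" and lq: "lead_coeff q = 1" and dq: "degree q = degree p"
    using p0 by (simp_all add: q_def)
  have "q *s v = [:inverse (lead_coeff p):] *s (p *s v)" by (simp add: q_def)
  then have qv: "q *s v = 0" using v by simp
  have "irreducible q"
  proof (rule irreducibleI[OF q0])
    show "\<not> is_unit q"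
    proof
      assume "is_unit q"
      then obtain u where "1 = u * q" by (auto simp: dvd_def mult.commute)
      then have "v = u *s (q *s v)" by simp
      with qv v show False by simp
    qed
  next
    fix a b assume ab: "q = a * b"
    show "is_unit a \<or> is_unit b"
    proof (rule ccontr)
      assume n: "\<not> ?thesis"
      have ab0: "a \<noteq> 0" "b \<noteq> 0" using q0 ab by auto
      have dg: "degree q = degree a + degree b" using ab ab0 by (simp add: degree_mult_eq)
      have "degree a > 0" "degree b > 0" using n ab0 by (auto simp: is_unit_iff_degree)
      then have "\<not> Q a" "\<not> Q b" using min dg dq by fastforce+
      moreover have "a *s (b *s v) = 0" using qv ab by simp
      moreover have "b *s v \<in> V" using V v by (simp add: subspace_scale)
      ultimately show False using ab0 v by (auto simp: Q_def)
    qed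
  qed
  with that lq v qv show thesis by blast
qed

text \<open>The generator split off is a prescribed \<alpha> up to a correction from pV. An
  arbitrary \<alpha> outside pV serves the induction for existence; the translation part of an
  affine matrix serves the classification. Stating the result as a passage from decompositions of W
  to those of V leaves open how W is decomposed.\<close>

lemma split_off_primary:
  assumes V: "subspace V" "finite V" and p: "p \<in> Phi"
    and a: "\<alpha> \<in> V" "\<And>z. z \<in> V \<Longrightarrow> \<alpha> \<noteq> p *s z"
  shows "\<exists>\<beta> j W. \<beta> \<in> V \<and> subspace W \<and> W \<subset> V \<and>
    (\<forall>gs. primary_decomp W gs \<longrightarrow> primary_decomp V (((p, Suc j), \<alpha> + p *s \<beta>) # gs))"
proof -
  have max: "\<exists>e s. e * d + s * p = 1" if "\<not> p dvd d" for d
    using irreducible_bezout Phi_irreducible[OF p] that by blast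
  obtain \<beta> j where \<beta>: "\<beta> \<in> V" and y0: "p ^ Suc j *s (\<alpha> + p *s \<beta>) = 0"
    and nz: "\<And>z. z \<in> V \<Longrightarrow> p ^ j *s (\<alpha> + p *s \<beta>) \<noteq> p ^ Suc j *s z"
    using ex_minimal_order_representative[OF V a] by blast
  let ?y = "\<alpha> + p *s \<beta>"
  have yV: "?y \<in> V" using V a \<beta> by (simp add: subspace_add subspace_scale)
  obtain W where W: "subspace W" "W \<subseteq> V" and ind: "\<And>c. c *s ?y \<in> W \<Longrightarrow> c *s ?y = 0"
    and VW: "V = {w + c *s ?y |w c. w \<in> W}"
    using cyclic_summand[OF max V yV y0 nz] by blast
  have yn: "p ^ j *s ?y \<noteq> 0" using nz[of 0] subspace_0[OF V(1)] by auto
  then have "?y \<noteq> 0" by auto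
  then have "?y \<notin> W" using ind[of 1] by auto
  with yV W have "W \<subset> V" by blast
  moreover have "primary_decomp V (((p, Suc j), ?y) # gs)" if "primary_decomp W gs" for gs
    using that p cyclic_decomp_Cons[OF _ order_prime_power[OF max y0 yn] ind VW]
    unfolding primary_decomp_def by (auto simp del: power_Suc)
  ultimately show ?thesis using \<beta> W by blast
qed

theorem ex_primary_decomp:
  assumes "subspace V" "finite V" and inj: "\<And>v. v \<in> V \<Longrightarrow> [:0, 1:] *s v = 0 \<Longrightarrow> v = 0"
  shows "\<exists>gs. primary_decomp V gs"
  using assms
proof (induction "card V" arbitrary: V rule: less_induct)
  case (less V)
  note V = less.prems(1,2)
  show ?case
  proof (cases "V = {0}")
    case True
    then have "primary_decomp V []" by (simp add: primary_decomp_def)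
    then show ?thesis by blast
  next
    case False
    obtain p v where p: "irreducible p" "lead_coeff p = 1" and v: "v \<in> V" "v \<noteq> 0" "p *s v = 0"
      using ex_irreducible_annihilator[OF V False] by blast
    then have pP: "p \<in> Phi" using less.prems(3)[of v] by (auto simp: Phi_def)
    \<comment> \<open>Multiplication by p kills v and is therefore not injective on V; as V is
      finite, it is not surjective either, and some \<alpha> lies outside pV.\<close>
    have "\<not> V \<subseteq> (\<lambda>z. p *s z) ` V"
    proof
      assume "V \<subseteq> (\<lambda>z. p *s z) ` V"
      then have "(\<lambda>z. p *s z) ` V = V" using V by (auto simp: subspace_scale)
      then have "inj_on (\<lambda>z. p *s z) V" using V by (intro eq_card_imp_inj_on) simp_all
      then have "v = 0" using v subspace_0[OF V(1)]
        by (intro inj_onD[of "\<lambda>z. p *s z" V v 0]) simp_all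
      with v show False by simp
    qed
    then obtain \<alpha> where a: "\<alpha> \<in> V" "\<And>z. z \<in> V \<Longrightarrow> \<alpha> \<noteq> p *s z" by blast
    obtain \<beta> j W where "\<beta> \<in> V" and W: "subspace W" "W \<subset> V"
      and step: "\<And>gs. primary_decomp W gs \<Longrightarrow> primary_decomp V (((p, Suc j), \<alpha> + p *s \<beta>) # gs)"
      using split_off_primary[OF V pP a] by auto
    have "card W < card V" using W V by (simp add: psubset_card_mono)
    moreover have "finite W" by (rule finite_subset[OF psubset_imp_subset[OF W(2)] V(2)])
    ultimately have "\<exists>gs. primary_decomp W gs"
    proof (rule less.hyps[OF _ W(1)])
      fix v assume "v \<in> W" "[:0, 1:] *s v = 0"
      then show "v = 0" using less.prems(3) W(2) by auto
    qed
    then obtain gs where "primary_decomp W gs" ..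
    from step[OF this] show ?thesis ..
  qed
qed

lemma primary_decomp_permute:
  assumes "primary_decomp V gs" "mset gs' = mset gs"
  shows "primary_decomp V gs'"
proof -
  let ?h = "\<lambda>((f, k), y). (f ^ k, y)"
  have "mset (map ?h gs') = mset (map ?h gs)" using assms(2) by simp
  then have "cyclic_decomp V (map ?h gs')"
    using assms(1) unfolding primary_decomp_def by (blast intro: cyclic_decomp_permute)
  moreover have "set gs' = set gs" using assms(2) by (rule mset_eq_setD)
  ultimately show ?thesis using assms(1) unfolding primary_decomp_def by simp
qed

lemma primary_decomp_mult_inj:
  assumes d: "primary_decomp V gs" and v: "v \<in> V" "[:0, 1:] *s v = 0"
  shows "v = 0"
proof (rule cyclic_decomp_mult_inj[OF _ _ v])
  let ?h = "\<lambda>((f, k), y). (f ^ k, y)"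
  show "cyclic_decomp V (map ?h gs)" using d by (simp add: primary_decomp_def)
  fix g c assume g: "g \<in> set (map ?h gs)" "fst g dvd [:0, 1:] * c"
  then obtain f k y where fk: "((f, k), y) \<in> set gs" "fst g = f ^ k" by auto
  then have f: "f \<in> Phi" "1 \<le> k" using d by (auto simp: primary_decomp_def)
  then have "prime_elem f" by (simp add: Phi_irreducible field_poly_irreducible_imp_prime)
  then show "fst g dvd c"
    using g(2) f Phi_not_dvd_t[OF f(1)] prime_power_dvd_multD[of f k "[:0, 1:]" c] fk(2) by simp
qed

end

section \<open>Counting kernels, and uniqueness of the types\<close>

locale finite_poly_module = poly_module scale
  for scale :: "'a::{field, finite} poly \<Rightarrow> 'v::ab_group_add \<Rightarrow> 'v" (infixr \<open>*s\<close> 75)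
begin

text \<open>Remainders modulo the orders are a normal form for coefficients, so V is counted by
  tuples of polynomials of bounded degree.\<close>

lemma card_cyclic_decomp:
  assumes d: "cyclic_decomp V gs" and n0: "\<And>i. i < length gs \<Longrightarrow> fst (gs ! i) \<noteq> 0"
  shows "card V = CARD('a) ^ (\<Sum>i<length gs. degree (fst (gs ! i)))"
proof -
  let ?R = "\<lambda>i. {p :: 'a poly. \<forall>l\<ge>degree (fst (gs ! i)). coeff p l = 0}"
  have "bij_betw (comb gs) (Pi\<^sub>E {..<length gs} ?R) V"
  proof (rule bij_betwI')
    fix c e assume c: "c \<in> Pi\<^sub>E {..<length gs} ?R" and e: "e \<in> Pi\<^sub>E {..<length gs} ?R"
    show "comb gs c = comb gs e \<longleftrightarrow> c = e"
    proof
      assume "comb gs c = comb gs e"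
      then have dv: "\<forall>i<length gs. fst (gs ! i) dvd c i - e i" using cyclic_decomp_eq_iff[OF d] by blast
      show "c = e"
      proof (rule PiE_ext[OF c e])
        fix i assume "i \<in> {..<length gs}"
        then have i: "i < length gs" by simp
        show "c i = e i"
        proof (rule ccontr)
          assume ne: "c i \<noteq> e i"
          then have le: "degree (fst (gs ! i)) \<le> degree (c i - e i)" using dv i by (simp add: dvd_imp_degree_le)
          have "c i \<in> ?R i" "e i \<in> ?R i" using c e i by auto
          then have "coeff (c i - e i) (degree (c i - e i)) = 0" using le by simp
          with ne show False by (simp only: leading_coeff_0_iff right_minus_eq)
        qed
      qed
    qed simp
  next
    fix c show "comb gs c \<in> V" using d by (simp add: cyclic_decomp_def)
  next
    fix v assume "v \<in> V"
    then obtain c where v: "v = comb gs c" using d by (auto simp: cyclic_decomp_def)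
    let ?e = "\<lambda>i\<in>{..<length gs}. c i mod fst (gs ! i)"
    have "?e \<in> Pi\<^sub>E {..<length gs} ?R"
    unfolding restrict_PiE_iff
    proof
      fix i assume "i \<in> {..<length gs}"
      with n0[of i] degree_mod_less[of "fst (gs ! i)" "c i"]
      show "c i mod fst (gs ! i) \<in> ?R i" by (auto simp: coeff_eq_0)
    qed
    moreover have "v = comb gs ?e"
      unfolding v cyclic_decomp_eq_iff[OF d] by (simp add: minus_mod_eq_mult_div)
    ultimately show "\<exists>e\<in>Pi\<^sub>E {..<length gs} ?R. v = comb gs e" by blast
  qed
  then have "card V = card (Pi\<^sub>E {..<length gs} ?R)" by (simp add: bij_betw_same_card)
  also have "\<dots> = CARD('a) ^ (\<Sum>i<length gs. degree (fst (gs ! i)))"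
    by (simp add: card_PiE card_poly_degree_less power_sum)
  finally show ?thesis .
qed

lemma card_cyclic_decomp_list:
  assumes "cyclic_decomp V gs" "\<And>g. g \<in> set gs \<Longrightarrow> fst g \<noteq> 0"
  shows "card V = CARD('a) ^ (\<Sum>g\<leftarrow>gs. degree (fst g))"
  using card_cyclic_decomp[OF assms(1)] assms(2) by (simp add: sum_list_sum_nth atLeast0LessThan)

lemma card_primary_decomp:
  assumes d: "primary_decomp V gs"
  shows "card V = CARD('a) ^ (\<Sum>(f, k)\<leftarrow>map fst gs. degree f * k)"
proof -
  have "card V = CARD('a) ^ (\<Sum>g\<leftarrow>map (\<lambda>((f, k), y). (f ^ k, y)) gs. degree (fst g))"
    using d by (intro card_cyclic_decomp_list) (fastforce simp: primary_decomp_def Phi_nonzero)+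
  also have "(\<Sum>g\<leftarrow>map (\<lambda>((f, k), y). (f ^ k, y)) gs. degree (fst g)) = (\<Sum>(f, k)\<leftarrow>map fst gs. degree f * k)"
    unfolding map_map
    by (intro arg_cong[of _ _ sum_list] map_cong refl)
       (use d in \<open>fastforce simp: primary_decomp_def Phi_degree_power\<close>)
  finally show ?thesis .
qed

text \<open>A summand of order f^k with f \<noteq> p contributes nothing to the kernel of p^j, and
  one of order p^k contributes a cyclic module of order p^(min j k).\<close>

lemma card_kernel_primary_decomp:
  assumes d: "primary_decomp V gs" and p: "p \<in> Phi"
  shows "card {v \<in> V. p ^ j *s v = 0} =
    CARD('a) ^ (degree p * (\<Sum>(f, k)\<leftarrow>map fst gs. if f = p then min j k else 0))"
proof -
  \<comment> \<open>The factorization b g of each order that \<open>cyclic_decomp_kernel\<close>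
    asks for, with g the gcd of the order and p^j.\<close>
  define h where "h = (\<lambda>((f, k), y :: 'v).
    if f = p then (p ^ (k - min j k), p ^ min j k, y) else (f ^ k, 1, y))"
  let ?L = "map h gs"
  have P: "f \<in> Phi" if "((f, k), y) \<in> set gs" for f k y using d that by (auto simp: primary_decomp_def)
  have e1: "map (\<lambda>((f, k), y). (f ^ k, y)) gs = map (\<lambda>(b, g, y). (b * g, y)) ?L"
    by (auto simp: h_def simp flip: power_add)
  have "cyclic_decomp {v \<in> V. p ^ j *s v = 0} (map (\<lambda>(b, g, y). (g, b *s y)) ?L)"
  proof (rule cyclic_decomp_kernel)
    show "cyclic_decomp V (map (\<lambda>(b, g, y). (b * g, y)) ?L)"
      using d unfolding primary_decomp_def e1 by blast
  next
    fix b g y c assume "(b, g, y) \<in> set ?L"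
    then obtain f k where fk: "((f, k), y) \<in> set gs" and bg: "(b, g, y) = h ((f, k), y)"
      by (auto simp: h_def split: if_splits)
    show "b * g dvd p ^ j * c \<longleftrightarrow> b dvd c"
    proof (cases "f = p")
      case True
      then have b: "b = p ^ (k - min j k)" "g = p ^ min j k" using bg by (auto simp: h_def)
      show ?thesis
      proof (cases "k \<le> j")
        case True
        then show ?thesis by (simp add: b le_imp_power_dvd dvd_mult2)
      next
        case False
        then show ?thesis using Phi_nonzero[OF p] by (simp add: b mult.commute)
      qed
    next
      case False
      then show ?thesis using bg Phi_dvd_power_mult_iff[OF P[OF fk] p] by (simp add: h_def)
    qed
    show "b * g dvd b * c \<longleftrightarrow> g dvd c"
      using bg Phi_nonzero[OF P[OF fk]] Phi_nonzero[OF p] by (auto simp: h_def split: if_splits)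
  qed
  then have "card {v \<in> V. p ^ j *s v = 0} =
      CARD('a) ^ (\<Sum>g\<leftarrow>map (\<lambda>(b, g, y). (g, b *s y)) ?L. degree (fst g))"
    using Phi_nonzero[OF p] by (intro card_cyclic_decomp_list) (auto simp: h_def split: if_splits)
  also have "(\<Sum>g\<leftarrow>map (\<lambda>(b, g, y). (g, b *s y)) ?L. degree (fst g)) =
      (\<Sum>((f, k), y)\<leftarrow>gs. degree p * (if f = p then min j k else 0))"
    unfolding map_map using Phi_nonzero[OF p]
    by (intro arg_cong[of _ _ sum_list] map_cong) (auto simp: h_def degree_power_eq)
  also have "\<dots> = degree p * (\<Sum>(f, k)\<leftarrow>map fst gs. if f = p then min j k else 0)"
    by (induction gs) (auto simp: algebra_simps)
  finally show ?thesis .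
qed

end

text \<open>Second differences recover multiplicities: from j to j + 1 the sum grows by the number N
  j of exponents greater than j, and N j - N (j + 1) is the multiplicity of j + 1.\<close>

lemma mset_eq_if_kernel_sums_eq:
  fixes ts ts' :: "('b \<times> nat) list"
  assumes "\<And>f k. (f, k) \<in> set ts \<Longrightarrow> f \<in> A \<and> 1 \<le> k" "\<And>f k. (f, k) \<in> set ts' \<Longrightarrow> f \<in> A \<and> 1 \<le> k"
    and S: "\<And>p j. p \<in> A \<Longrightarrow> (\<Sum>(f, k)\<leftarrow>ts. if f = p then min j k else 0) =
      (\<Sum>(f, k)\<leftarrow>ts'. if f = p then min j k else 0)"
  shows "mset ts = mset ts'"
proof (rule multiset_eqI)
  fix x :: "'b \<times> nat"
  obtain p k where x: "x = (p, k)" by (cases x)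
  define s where "s ts j = (\<Sum>(f, k)\<leftarrow>ts. if f = p then min j k else 0)" for ts :: "('b \<times> nat) list" and j
  define N where "N ts j = length (filter (\<lambda>(f, k). f = p \<and> j < k) ts)"
    for ts :: "('b \<times> nat) list" and j :: nat
  have sN: "s ts (Suc j) = s ts j + N ts j" for ts j
    by (induction ts) (auto simp: s_def N_def min_def split: if_splits)
  have Nc: "N ts j = N ts (Suc j) + count (mset ts) (p, Suc j)" for ts j
    by (induction ts) (auto simp: N_def split: if_splits)
  show "count (mset ts) x = count (mset ts') x"
  proof (cases "p \<in> A \<and> k \<ge> 1")
    case True
    then obtain j where k: "k = Suc j" by (cases k) auto
    have "s ts i = s ts' i" for i using S[of p i] True by (simp add: s_def)
    then have "N ts i = N ts' i" for i using sN[of ts i] sN[of ts' i] by simp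
    then show ?thesis using Nc[of ts j] Nc[of ts' j] by (simp add: x k)
  next
    case False
    then have "x \<notin> set ts" "x \<notin> set ts'" using assms(1,2) x by blast+
    then have "x \<notin># mset ts" "x \<notin># mset ts'" by simp_all
    then show ?thesis by (simp only: not_in_iff)
  qed
qed

theorem primary_decomp_unique:
  assumes "finite_poly_module s1" "finite_poly_module s2"
    and d1: "poly_module.primary_decomp s1 V1 gs1" and d2: "poly_module.primary_decomp s2 V2 gs2"
    and iso: "module_iso s1 s2 V1 V2 \<phi>" and "0 \<in> V1"
  shows "mset (map fst gs1) = mset (map fst gs2)"
proof (rule mset_eq_if_kernel_sums_eq[of _ Phi])
  interpret m1: finite_poly_module s1 by fact
  interpret m2: finite_poly_module s2 by fact
  show "f \<in> Phi \<and> 1 \<le> k" if "(f, k) \<in> set (map fst gs1)" for f k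
    using d1 that by (auto simp: m1.primary_decomp_def)
  show "f \<in> Phi \<and> 1 \<le> k" if "(f, k) \<in> set (map fst gs2)" for f k
    using d2 that by (auto simp: m2.primary_decomp_def)
  fix p :: "'a poly" and j assume p: "p \<in> Phi"
  from iso have b: "bij_betw \<phi> V1 V2" and add: "\<And>x y. x \<in> V1 \<Longrightarrow> y \<in> V1 \<Longrightarrow> \<phi> (x + y) = \<phi> x + \<phi> y"
    and sc: "\<And>a x. x \<in> V1 \<Longrightarrow> \<phi> (s1 a x) = s2 a (\<phi> x)"
    by (auto simp: module_iso_def)
  have s1V: "s1 a x \<in> V1" if "x \<in> V1" for a x
    using d1 that unfolding m1.primary_decomp_def m1.cyclic_decomp_def by (auto simp: m1.comb_scale)
  have \<phi>0: "\<phi> 0 = 0" using add[OF \<open>0 \<in> V1\<close> \<open>0 \<in> V1\<close>] by simp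
  have inj0: "\<phi> x = 0 \<longleftrightarrow> x = 0" if "x \<in> V1" for x
    using b \<phi>0 \<open>0 \<in> V1\<close> that by (metis bij_betw_def inj_onD)
  have "\<phi> ` {v \<in> V1. s1 (p ^ j) v = 0} = {v \<in> V2. s2 (p ^ j) v = 0}"
    using b inj0 s1V \<phi>0 by (auto simp: sc[symmetric] bij_betw_def)
  moreover have "inj_on \<phi> {v \<in> V1. s1 (p ^ j) v = 0}"
    using b by (auto simp: bij_betw_def intro: inj_on_subset)
  ultimately have "card {v \<in> V1. s1 (p ^ j) v = 0} = card {v \<in> V2. s2 (p ^ j) v = 0}"
    by (intro bij_betw_same_card[of \<phi>]) (simp add: bij_betw_def)
  then have "CARD('a) ^ (degree p * (\<Sum>(f, k)\<leftarrow>map fst gs1. if f = p then min j k else 0)) =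
      CARD('a) ^ (degree p * (\<Sum>(f, k)\<leftarrow>map fst gs2. if f = p then min j k else 0))"
    using m1.card_kernel_primary_decomp[OF d1 p] m2.card_kernel_primary_decomp[OF d2 p] by simp
  moreover have "CARD('a) > 1"
  proof -
    have "card {0, 1::'a} \<le> CARD('a)" by (rule card_mono) auto
    then show ?thesis by simp
  qed
  moreover have "degree p > 0"
    using p by (rule Phi_degree_pos)
  ultimately show "(\<Sum>(f, k)\<leftarrow>map fst gs1. if f = p then min j k else 0) =
      (\<Sum>(f, k)\<leftarrow>map fst gs2. if f = p then min j k else 0)"
    by (simp add: power_inject_exp)
qed

section \<open>The module of an endomorphism\<close>

text \<open>Scalars are kept general so that the construction can be iterated: \<open>act\<close>
  makes polynomials in one endomorphism the scalars for a second one commuting with it. This is how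
  polynomials in S and N are handled for the Jordan blocks.\<close>

locale module_endo = ring_module s
  for s :: "'r::comm_ring_1 \<Rightarrow> 'v::ab_group_add \<Rightarrow> 'v" +
  fixes T :: "'v \<Rightarrow> 'v"
  assumes T_add: "T (x + y) = T x + T y" and T_scale: "T (s a x) = s a (T x)"
begin

definition act :: "'r poly \<Rightarrow> 'v \<Rightarrow> 'v" where
  "act p v = fold_coeffs (\<lambda>a w. s a v + T w) p 0"

lemma T_0 [simp]: "T 0 = 0"
  using T_add[of 0 0] by simp

lemma act_0 [simp]: "act 0 v = 0"
  by (simp add: act_def)

lemma act_pCons [simp]: "act (pCons a p) v = s a v + T (act p v)"
  by (cases "p = 0 \<and> a = 0") (auto simp: act_def)

lemma act_zero_right [simp]: "act p 0 = 0"
  by (induction p) auto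

lemma act_add_right: "act p (v + w) = act p v + act p w"
  by (induction p) (auto simp: T_add scale_right_distrib algebra_simps)

lemma act_add_left: "act (p + q) v = act p v + act q v"
  by (induction p q rule: poly_induct2) (auto simp: T_add scale_left_distrib algebra_simps)

lemma act_smult: "act (smult a p) v = s a (act p v)"
  by (induction p) (auto simp: T_scale scale_right_distrib)

lemma act_mult: "act (p * q) v = act p (act q v)"
  by (induction p) (auto simp: act_add_left act_smult)

lemma act_const [simp]: "act [:a:] v = s a v"
  by simp

lemma act_X [simp]: "act [:0, 1:] v = T v"
  by simp

lemma act_X_power: "act ([:0, 1:] ^ n) v = (T ^^ n) v"
  by (induction n) (simp_all only: power_0 power_Suc funpow_0 act_mult act_X funpow.simps o_apply
    one_pCons act_const scale_one id_apply)

lemma ring_module_act: "ring_module act"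
  by unfold_locales (auto simp: act_add_left act_add_right act_mult one_pCons)

end

text \<open>Column vectors are modelled as functions vanishing from the dimension on, since the type
  \<open>'a vec\<close> contains all dimensions and is not an additive group.\<close>

definition fun_scale :: "'a::comm_ring_1 \<Rightarrow> (nat \<Rightarrow> 'a) \<Rightarrow> nat \<Rightarrow> 'a" where
  "fun_scale a v = (\<lambda>i. a * v i)"

interpretation fun_scale: ring_module fun_scale
  by unfold_locales (auto simp: fun_scale_def fun_eq_iff algebra_simps)

definition fun_space :: "nat \<Rightarrow> (nat \<Rightarrow> 'a::zero) set" where
  "fun_space n = {v. \<forall>i\<ge>n. v i = 0}"

definition fun_unit :: "nat \<Rightarrow> nat \<Rightarrow> 'a::zero_neq_one" where
  "fun_unit k = (\<lambda>i. if i = k then 1 else 0)"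

text \<open>Truncation at the row dimension gives every matrix, of whatever shape, an endomorphism
  of the whole function space, so the interpretations below are unconditional.\<close>

definition mat_op :: "'a::comm_ring_1 mat \<Rightarrow> (nat \<Rightarrow> 'a) \<Rightarrow> nat \<Rightarrow> 'a" where
  "mat_op A v = (\<lambda>i. if i < dim_row A then \<Sum>j<dim_col A. A $$ (i, j) * v j else 0)"

interpretation mat_op: module_endo fun_scale "mat_op A" for A
  by unfold_locales
    (auto simp: mat_op_def fun_scale_def fun_eq_iff sum.distrib sum_distrib_left algebra_simps)

abbreviation mat_act :: "'a::comm_ring_1 mat \<Rightarrow> 'a poly \<Rightarrow> (nat \<Rightarrow> 'a) \<Rightarrow> nat \<Rightarrow> 'a" where
  "mat_act A \<equiv> mat_op.act A"

interpretation mat_act: finite_poly_module "mat_act A" for A :: "'a::{field, finite} mat"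
  by (intro finite_poly_module.intro poly_module.intro mat_op.ring_module_act)

lemma card_fun_space:
  "finite (fun_space n :: (nat \<Rightarrow> 'a::{field, finite}) set)"
  "card (fun_space n :: (nat \<Rightarrow> 'a) set) = CARD('a) ^ n"
proof -
  have "bij_betw (\<lambda>v. restrict v {..<n}) (fun_space n) ({..<n} \<rightarrow>\<^sub>E (UNIV :: 'a set))"
  proof (rule bij_betwI[of _ _ _ "\<lambda>h i. if i < n then h i else 0"])
    show "(\<lambda>i. if i < n then restrict v {..<n} i else 0) = v" if "v \<in> fun_space n" for v :: "nat \<Rightarrow> 'a"
      using that by (auto simp: fun_space_def)
    show "restrict (\<lambda>i. if i < n then h i else 0) {..<n} = h" if "h \<in> {..<n} \<rightarrow>\<^sub>E UNIV" for h :: "nat \<Rightarrow> 'a"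
      using that by (auto simp: PiE_def extensional_def restrict_def)
  qed (auto simp: fun_space_def)
  then show "finite (fun_space n :: (nat \<Rightarrow> 'a) set)" "card (fun_space n :: (nat \<Rightarrow> 'a) set) = CARD('a) ^ n"
    by (auto simp: bij_betw_finite bij_betw_same_card card_PiE finite_PiE)
qed

lemma fun_space_0 [simp]: "0 \<in> fun_space n"
  by (simp add: fun_space_def)

lemma fun_space_add: "v \<in> fun_space n \<Longrightarrow> w \<in> fun_space n \<Longrightarrow> v + w \<in> fun_space n"
  for v :: "nat \<Rightarrow> 'a::monoid_add"
  by (simp add: fun_space_def)

lemma fun_space_scale: "v \<in> fun_space n \<Longrightarrow> fun_scale a v \<in> fun_space n"
  by (simp add: fun_space_def fun_scale_def)

lemma fun_space_mat_op: "dim_row A \<le> n \<Longrightarrow> mat_op A v \<in> fun_space n"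
  by (simp add: fun_space_def mat_op_def)

lemma fun_space_mat_act: "dim_row A \<le> n \<Longrightarrow> v \<in> fun_space n \<Longrightarrow> mat_act A p v \<in> fun_space n"
  by (induction p) (auto intro!: fun_space_add fun_space_scale simp: fun_space_mat_op)

lemma subspace_fun_space:
  fixes A :: "'a::{field, finite} mat"
  assumes "dim_row A \<le> n"
  shows "mat_act.subspace A (fun_space n)"
  using assms by (intro mat_act.subspaceI) (auto intro: fun_space_add fun_space_mat_act)

lemma fun_unit_space: "k < n \<Longrightarrow> fun_unit k \<in> fun_space n"
  by (simp add: fun_unit_def fun_space_def)

lemma fun_unit_nonzero [simp]: "fun_unit k \<noteq> 0"
  by (auto simp: fun_unit_def fun_eq_iff)

section \<open>The generalized Jordan blocks\<close>

text \<open>The binomial expansion modulo a. It is applied with a = f(S), which kills the generator,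
  and with a = N r, which contributes a higher power of N.\<close>

lemma power_add_split:
  fixes a b :: "'r::comm_ring_1"
  shows "\<exists>c. (a + b) ^ n = a * c + b ^ n"
proof (induction n)
  case (Suc n)
  then obtain c where "(a + b) ^ n = a * c + b ^ n" by blast
  then have "(a + b) ^ Suc n = a * ((a + b) * c + b ^ n) + b ^ Suc n" by (simp add: algebra_simps)
  then show ?case by blast
qed (auto intro: exI[of _ 0])

text \<open>This is the block diagonal part S of \<open>block_J\<close>; \<open>shift_op\<close>
  with d = degree f is the part N formed by the identity blocks above the diagonal.\<close>

definition companion_op :: "nat \<Rightarrow> 'a::comm_ring_1 poly \<Rightarrow> (nat \<Rightarrow> 'a) \<Rightarrow> nat \<Rightarrow> 'a" where
  "companion_op n f v = (\<lambda>i. if i < n then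
     if i mod degree f = degree f - 1
     then - (\<Sum>l<degree f. coeff f l * v (i div degree f * degree f + l)) else v (Suc i) else 0)"

definition shift_op :: "nat \<Rightarrow> nat \<Rightarrow> (nat \<Rightarrow> 'a::zero) \<Rightarrow> nat \<Rightarrow> 'a" where
  "shift_op n d v = (\<lambda>i. if i + d < n then v (i + d) else 0)"

interpretation companion_op: module_endo fun_scale "companion_op n f" for n f
  by unfold_locales
    (auto simp: companion_op_def fun_scale_def fun_eq_iff sum.distrib sum_distrib_left algebra_simps)

text \<open>Whether a further block follows depends on the block only, not on the position inside
  it, since the total size is a multiple of d.\<close>

lemma block_index_less_iff:
  fixes d :: nat
  assumes "i < d * m" "l < d"
  shows "i div d * d + l + d < d * m \<longleftrightarrow> i + d < d * m"
proof -
  have *: "b * d + r + d < d * m \<longleftrightarrow> Suc b < m" if "r < d" for b r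
  proof
    assume "b * d + r + d < d * m"
    then have "d * Suc b < d * m" by (simp add: algebra_simps)
    then show "Suc b < m" by (simp only: mult_less_cancel1)
  next
    assume "Suc b < m"
    then have "d * Suc (Suc b) \<le> d * m" by (intro mult_le_mono2) simp
    with that show "b * d + r + d < d * m" by (simp add: algebra_simps)
  qed
  show ?thesis using *[of l "i div d"] *[of "i mod d" "i div d"] assms by simp
qed

text \<open>S acts in the same way on every block, and N only moves whole blocks.\<close>

lemma companion_shift_commute:
  fixes f :: "'a::comm_ring_1 poly"
  assumes d: "degree f > 0" and n: "n = degree f * m"
  shows "companion_op n f (shift_op n (degree f) v) = shift_op n (degree f) (companion_op n f v)"
proof
  fix i
  let ?d = "degree f"
  show "companion_op n f (shift_op n ?d v) i = shift_op n ?d (companion_op n f v) i"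
  proof (cases "i < n")
    case True
    show ?thesis
    proof (cases "i mod ?d = ?d - 1")
      case last: True
      have "(\<Sum>l<?d. coeff f l * shift_op n ?d v (i div ?d * ?d + l)) =
          (\<Sum>l<?d. if i + ?d < n then coeff f l * v ((i + ?d) div ?d * ?d + l) else 0)"
        using True d block_index_less_iff[of i ?d m]
        by (intro sum.cong refl) (auto simp: shift_op_def n algebra_simps)
      with last True d show ?thesis by (auto simp: companion_op_def shift_op_def)
    next
      case False
      moreover have "i mod ?d < ?d" using d by simp
      ultimately have l: "Suc (i mod ?d) < ?d" by linarith
      have "i div ?d * ?d + Suc (i mod ?d) = Suc i" by (simp add: mod_div_mult_eq)
      then have "Suc i + ?d < n \<longleftrightarrow> i + ?d < n" using block_index_less_iff[OF _ l, of i m] True n by simp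
      with False True show ?thesis by (auto simp: companion_op_def shift_op_def)
    qed
  qed (auto simp: companion_op_def shift_op_def)
qed

lemma sum_block:
  fixes g :: "nat \<Rightarrow> 'a::comm_monoid_add"
  assumes "b < m" "d > 0"
  shows "(\<Sum>j<d * m. if j div d = b then g j else 0) = (\<Sum>l<d. g (b * d + l))"
proof -
  have le: "b * d + l < d * m" if "l < d" for l
  proof -
    have "d * Suc b \<le> d * m" using assms by (intro mult_le_mono2) simp
    with that show ?thesis by (simp add: algebra_simps)
  qed
  have "(\<Sum>j<d * m. if j div d = b then g j else 0) = (\<Sum>j | j < d * m \<and> j div d = b. g j)"
    by (simp add: sum.If_cases Int_def)
  also have "{j. j < d * m \<and> j div d = b} = (\<lambda>l. b * d + l) ` {..<d}"
  proof (intro equalityI subsetI)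
    fix j assume "j \<in> {j. j < d * m \<and> j div d = b}"
    then have "j = b * d + j mod d" "j mod d < d" using assms by (auto simp: mult.commute)
    then show "j \<in> (\<lambda>l. b * d + l) ` {..<d}" by blast
  qed (use le in \<open>auto\<close>)
  also have "(\<Sum>j\<in>(\<lambda>l. b * d + l) ` {..<d}. g j) = (\<Sum>l<d. g (b * d + l))"
    by (subst sum.reindex) (auto simp: inj_on_def)
  finally show ?thesis .
qed

lemma block_J_dim [simp]:
  "dim_row (block_J m f) = degree f * m" "dim_col (block_J m f) = degree f * m"
  by (simp_all add: block_J_def Let_def)

lemma mat_op_block_J:
  fixes f :: "'a::field poly"
  assumes d: "degree f > 0"
  shows "mat_op (block_J m f) v = companion_op (degree f * m) f v + shift_op (degree f * m) (degree f) v"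
proof
  fix i
  let ?d = "degree f" let ?n = "degree f * m"
  show "mat_op (block_J m f) v i = (companion_op ?n f v + shift_op ?n ?d v) i"
  proof (cases "i < ?n")
    case True
    have bm: "i div ?d < m" using True d by (simp add: div_less_iff_less_mult mult.commute)
    let ?C = "companion_J f"
    have eq: "j = i + ?d" if "j div ?d = Suc (i div ?d)" "i mod ?d = j mod ?d" for j
    proof -
      have "j div ?d * ?d + j mod ?d = Suc (i div ?d) * ?d + i mod ?d" using that by simp
      then show ?thesis by simp
    qed
    have "mat_op (block_J m f) v i = (\<Sum>j<?n.
        (if j div ?d = i div ?d then ?C $$ (i mod ?d, j mod ?d) * v j else 0) +
        (if j = i + ?d then v j else 0))"
      unfolding mat_op_def using True d
      by (auto simp: block_J_def Let_def intro!: sum.cong dest: eq)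
    also have "\<dots> = (\<Sum>l<?d. ?C $$ (i mod ?d, l) * v (i div ?d * ?d + l)) + shift_op ?n ?d v i"
      unfolding sum.distrib sum_block[OF bm d]
      by (intro arg_cong2[of _ _ _ _ "(+)"] sum.cong) (auto simp: shift_op_def sum.delta)
    also have "(\<Sum>l<?d. ?C $$ (i mod ?d, l) * v (i div ?d * ?d + l)) = companion_op ?n f v i"
    proof (cases "i mod ?d = ?d - 1")
      case last: True
      then show ?thesis using True d
        by (simp add: companion_op_def companion_J_def Let_def sum_negf)
    next
      case False
      moreover have "i mod ?d < ?d" using d by simp
      ultimately have l: "Suc (i mod ?d) < ?d" by linarith
      have e: "i div ?d * ?d + Suc (i mod ?d) = Suc i" by (simp add: mod_div_mult_eq)
      have "(\<Sum>l<?d. ?C $$ (i mod ?d, l) * v (i div ?d * ?d + l)) =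
          (\<Sum>l<?d. if l = Suc (i mod ?d) then v (i div ?d * ?d + l) else 0)"
        using False l by (intro sum.cong) (auto simp: companion_J_def Let_def)
      also have "\<dots> = v (Suc i)" using l e by (simp add: sum.delta)
      finally show ?thesis using False True by (simp add: companion_op_def)
    qed
    finally show ?thesis by simp
  next
    case False
    then show ?thesis by (simp add: mat_op_def companion_op_def shift_op_def)
  qed
qed

text \<open>Column j of the companion matrix has the entry -coeff f j in the last row, besides a 1
  in row j - 1 when j > 0. Adding coeff f j times the last unit vector cancels the former. This is
  one step of the Horner scheme.\<close>

lemma companion_op_unit:
  fixes f :: "'a::field poly" and m :: nat
  assumes j: "j < degree f"
  defines "n \<equiv> degree f * Suc m"
  shows "fun_scale (coeff f j) (fun_unit (n - 1)) + companion_op n f (fun_unit (degree f * m + j)) =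
    (if j = 0 then 0 else fun_unit (degree f * m + j - 1))"
proof
  fix i
  let ?d = "degree f" let ?y = "fun_unit (n - 1) :: nat \<Rightarrow> 'a"
  have n1: "n - 1 = ?d * m + (?d - 1)" using j by (simp add: n_def)
  have dm: "(?d * b + r) div ?d = b" "(?d * b + r) mod ?d = r" if "r < ?d" for b r
    using that by simp_all
  have d1: "?d - 1 < ?d" using j by simp
  show "(fun_scale (coeff f j) ?y + companion_op n f (fun_unit (?d * m + j))) i =
      (if j = 0 then 0 else fun_unit (?d * m + j - 1)) i"
  proof (cases "i < n \<and> i mod ?d = ?d - 1")
    case True
    have "(\<Sum>l<?d. coeff f l * fun_unit (?d * m + j) (i div ?d * ?d + l)) =
        (if i = n - 1 then coeff f j else 0)"
    proof (cases "i = n - 1")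
      case True
      then have "i div ?d = m" by (simp only: n1 dm[OF d1])
      then have "(\<Sum>l<?d. coeff f l * fun_unit (?d * m + j) (i div ?d * ?d + l)) =
          (\<Sum>l<?d. if l = j then coeff f l else 0)"
        by (intro sum.cong) (auto simp: fun_unit_def mult.commute)
      then show ?thesis using True j by (simp add: sum.delta)
    next
      case False
      have "i div ?d \<noteq> m"
      proof
        assume "i div ?d = m"
        then have "i = ?d * m + (?d - 1)" using True by (metis mult_div_mod_eq)
        with False n1 show False by simp
      qed
      have "i div ?d * ?d + l \<noteq> ?d * m + j" if "l < ?d" for l
      proof
        assume "i div ?d * ?d + l = ?d * m + j"
        then have "(i div ?d * ?d + l) div ?d = (?d * m + j) div ?d" by simp
        with that j \<open>i div ?d \<noteq> m\<close> show False by simp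
      qed
      then show ?thesis using False by (auto simp: fun_unit_def intro!: sum.neutral)
    qed
    moreover have "i \<noteq> ?d * m + j - 1" if "j \<noteq> 0"
    proof
      assume "i = ?d * m + j - 1"
      then have "i = ?d * m + (j - 1)" using that by simp
      moreover have "j - 1 < ?d" using j by simp
      ultimately have "i mod ?d = j - 1" by (simp only: dm)
      with True have "j - 1 = ?d - 1" by simp
      with j that show False by linarith
    qed
    moreover have "companion_op n f (fun_unit (?d * m + j)) i =
        - (\<Sum>l<?d. coeff f l * fun_unit (?d * m + j) (i div ?d * ?d + l))"
      using True by (simp add: companion_op_def)
    moreover have "fun_scale (coeff f j) ?y i = (if i = n - 1 then coeff f j else 0)"
      by (simp add: fun_scale_def fun_unit_def)
    ultimately show ?thesis by (cases "j = 0") (simp_all add: fun_unit_def)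
  next
    case False
    have "(n - 1) mod ?d = ?d - 1" by (simp only: n1 dm[OF d1])
    moreover have "n - 1 < n" using j by (simp add: n_def)
    ultimately have "fun_scale (coeff f j) ?y i = 0" using False
      by (auto simp: fun_scale_def fun_unit_def)
    moreover have "companion_op n f (fun_unit (?d * m + j)) i =
        (if i < n \<and> Suc i = ?d * m + j then 1 else 0)"
      using False by (simp add: companion_op_def fun_unit_def)
    moreover have "i < n" if "Suc i = ?d * m + j" using that j by (simp add: n_def)
    moreover have "Suc i \<noteq> ?d * m" if "i < n"
    proof
      assume e: "Suc i = ?d * m"
      then obtain m' where "m = Suc m'" by (cases m) auto
      with e j have "i = ?d * m' + (?d - 1)" by simp
      then have "i mod ?d = ?d - 1" by (simp only: dm[OF d1])
      with False that show False by simp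
    qed
    moreover have "i = ?d * m + j - 1 \<longleftrightarrow> Suc i = ?d * m + j" if "j \<noteq> 0" using that by linarith
    ultimately show ?thesis by (cases "j = 0") (simp_all add: fun_unit_def)
  qed
qed

text \<open>The Horner scheme for \<open>f\<close>, started at the last unit vector, runs through the unit vectors of
  the last block and ends at \<open>0\<close>.\<close>

lemma companion_op_annihilates:
  fixes f :: "'a::field poly" and m :: nat
  assumes f: "lead_coeff f = 1" and d: "degree f > 0"
  defines "n \<equiv> degree f * Suc m"
  shows "companion_op.act n f f (fun_unit (n - 1)) = 0"
proof -
  let ?y = "fun_unit (n - 1) :: nat \<Rightarrow> 'a"
  \<comment> \<open>\<open>poly_shift j f\<close> is the partial Horner polynomial formed by the
    coefficients of f from j on. The induction goes down from j = degree f, where it is 1 because f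
    is monic.\<close>
  have "companion_op.act n f (poly_shift j f) ?y =
      (if j = 0 then 0 else fun_unit (degree f * m + j - 1))" if "j \<le> degree f" for j
    using that
  proof (induction j rule: inc_induct)
    case base
    have "poly_shift (degree f) f = [:1:]"
      by (rule poly_eqI) (use f in \<open>auto simp: coeff_poly_shift coeff_eq_0 coeff_pCons split: nat.split\<close>)
    then show ?case using d by (simp add: n_def algebra_simps)
  next
    case (step j)
    have "poly_shift j f = pCons (coeff f j) (poly_shift (Suc j) f)"
      by (rule poly_eqI) (auto simp: coeff_poly_shift coeff_pCons split: nat.split)
    then show ?case using step companion_op_unit[of j f m] by (simp add: n_def)
  qed
  from this[of 0] show ?thesis by simp
qed

lemma shift_op_add: "shift_op n d (v + w) = shift_op n d v + shift_op n d w"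
  for v :: "nat \<Rightarrow> 'a::monoid_add"
  by (auto simp: shift_op_def fun_eq_iff)

lemma shift_op_scale: "shift_op n d (fun_scale a v) = fun_scale a (shift_op n d v)"
  by (auto simp: shift_op_def fun_scale_def fun_eq_iff)

text \<open>Commutation with S makes N linear over the polynomials in S, so polynomials in N with
  such coefficients act.\<close>

lemma module_endo_shift:
  fixes f :: "'a::field poly"
  assumes "degree f > 0"
  shows "module_endo (companion_op.act (degree f * m) f) (shift_op (degree f * m) (degree f))"
proof (intro module_endo.intro module_endo_axioms.intro companion_op.ring_module_act shift_op_add)
  let ?n = "degree f * m"
  have z: "shift_op ?n (degree f) 0 = (0 :: nat \<Rightarrow> 'a)" by (auto simp: shift_op_def fun_eq_iff)
  show "shift_op ?n (degree f) (companion_op.act ?n f p v) = companion_op.act ?n f p (shift_op ?n (degree f) v)"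
    for p v
    by (induction p)
       (simp_all only: companion_op.act_0 companion_op.act_pCons z shift_op_add shift_op_scale
         companion_shift_commute[OF assms refl, symmetric])
qed

text \<open>On \<open>J = S + N\<close>, with \<open>S\<close> the block diagonal and \<open>N\<close> the shift part, a polynomial acts
  through its Taylor expansion \<open>p(S + N) = p(S) + N p'(S) + N\<^sup>2 r\<close>.\<close>

lemma mat_act_block_J_taylor:
  fixes f :: "'a::field poly"
  assumes d: "degree f > 0"
  shows "\<exists>r. \<forall>v. mat_act (block_J m f) p v =
    module_endo.act (companion_op.act (degree f * m) f) (shift_op (degree f * m) (degree f))
      (pCons p (pCons (pderiv p) r)) v"
proof (induction p)
  case 0
  interpret biv: module_endo "companion_op.act (degree f * m) f" "shift_op (degree f * m) (degree f)"
    by (rule module_endo_shift[OF d])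
  show ?case by (intro exI[of _ 0]) simp
next
  case (pCons a p)
  let ?n = "degree f * m" let ?S = "companion_op ?n f" let ?N = "shift_op ?n (degree f)"
  interpret biv: module_endo "companion_op.act ?n f" ?N
    by (rule module_endo_shift[OF d])
  from pCons obtain r where r: "\<And>v. mat_act (block_J m f) p v = biv.act (pCons p (pCons (pderiv p) r)) v"
    by blast
  let ?Q = "pCons p (pCons (pderiv p) r)"
  \<comment> \<open>Passing from p to a + t p multiplies the expansion by S + N and adds a. The
    outer variable stands for N and the inner one for S; the coefficient of N becomes p + t p', the
    derivative of a + t p.\<close>
  have eq: "[:[:a:]:] + [:[:0, 1:], 1:] * ?Q =
      pCons (pCons a p) (pCons (pderiv (pCons a p)) (smult [:0, 1:] r + pCons (pderiv p) r))"
    by (simp add: pderiv_pCons)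
  have "mat_act (block_J m f) (pCons a p) v = biv.act ([:[:a:]:] + [:[:0, 1:], 1:] * ?Q) v" for v
  proof -
    have "mat_act (block_J m f) (pCons a p) v =
        fun_scale a v + (?S (biv.act ?Q v) + ?N (biv.act ?Q v))"
      by (simp only: mat_op.act_pCons mat_op_block_J[OF d] r)
    also have "fun_scale a v = biv.act [:[:a:]:] v"
      by (simp only: biv.act_const companion_op.act_const)
    also have "?S (biv.act ?Q v) = biv.act [:[:0, 1:]:] (biv.act ?Q v)"
      by (simp only: biv.act_const companion_op.act_X)
    also have "?N (biv.act ?Q v) = biv.act [:0, 1:] (biv.act ?Q v)"
      by (simp only: biv.act_X)
    finally have "mat_act (block_J m f) (pCons a p) v = biv.act [:[:a:]:] v +
        (biv.act [:[:0, 1:]:] (biv.act ?Q v) + biv.act [:0, 1:] (biv.act ?Q v))" .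
    moreover have X: "[:[:0, 1:], 1:] = ([:[:0, 1:]:] + [:0, 1:] :: 'a poly poly)" by simp
    ultimately show ?thesis
      by (simp only: X distrib_right biv.act_add_left biv.act_mult)
  qed
  then show ?case unfolding eq by blast
qed

lemma shift_op_unit:
  "shift_op n d (fun_unit (k + d)) = (if k + d < n then fun_unit k else 0)"
  "k < d \<Longrightarrow> shift_op n d (fun_unit k) = 0"
  by (auto simp: shift_op_def fun_unit_def fun_eq_iff)

lemma shift_op_power_unit:
  assumes "i \<le> m" "d > 0"
  shows "(shift_op (d * Suc m) d ^^ i) (fun_unit (d * Suc m - 1)) = fun_unit (d * (m - i) + (d - 1))"
  using assms(1)
proof (induction i)
  case 0
  have "d * Suc m - 1 = d * m + (d - 1)" using assms(2) by simp
  then show ?case by simp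
next
  case (Suc i)
  then have mi: "m - i = Suc (m - Suc i)" by simp
  have "d * (m - i) + (d - 1) = (d * (m - Suc i) + (d - 1)) + d" unfolding mi by simp
  moreover have "(d * (m - Suc i) + (d - 1)) + d < d * Suc m"
  proof -
    have "d * Suc (m - i) \<le> d * Suc m" by (intro mult_le_mono2) simp
    moreover have "d * Suc (m - i) = d * (m - Suc i) + d + d" unfolding mi by simp
    ultimately show ?thesis using assms(2) by linarith
  qed
  ultimately show ?case using Suc shift_op_unit(1)[of "d * Suc m" d "d * (m - Suc i) + (d - 1)"]
    by (simp only: funpow.simps o_apply Suc_leD if_True)
qed

text \<open>As f(S) y = 0, f(J)^i acts on y as N^i (f'(S) + N r)^i. For i = m + 1 this is 0, since
  N^(m+1) y = 0. For i = m only f'(S)^m z with z = N^m y is left; z has order f under S, and f does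
  not divide f'^m by separability, so this is nonzero.\<close>

lemma block_J_order:
  fixes f :: "'a::{field, finite} poly" and m :: nat
  assumes f: "f \<in> Phi"
  defines "y \<equiv> fun_unit (degree f * Suc m - 1)"
  shows "mat_act (block_J (Suc m) f) c y = 0 \<longleftrightarrow> f ^ Suc m dvd c"
proof -
  let ?d = "degree f" let ?n = "degree f * Suc m" let ?J = "block_J (Suc m) f"
  have d: "?d > 0" using f by (rule Phi_degree_pos)
  have lf: "lead_coeff f = 1" and irr: "irreducible f" using f by (auto simp: Phi_def)
  have max: "\<And>d. \<not> f dvd d \<Longrightarrow> \<exists>e s. e * d + s * f = 1" using irreducible_bezout[OF irr] by blast
  interpret S: ring_module "companion_op.act ?n f" by (rule companion_op.ring_module_act)
  interpret biv: module_endo "companion_op.act ?n f" "shift_op ?n ?d"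
    by (rule module_endo_shift[OF d])
  obtain r where r: "\<And>v. mat_act ?J f v = biv.act (pCons f (pCons (pderiv f) r)) v"
    using mat_act_block_J_taylor[OF d] by blast
  let ?Q = "pCons f (pCons (pderiv f) r)" let ?X = "[:0, 1:] :: 'a poly poly"
  let ?z = "fun_unit (?d - 1) :: nat \<Rightarrow> 'a"
  have fy: "companion_op.act ?n f f y = 0"
    unfolding y_def by (rule companion_op_annihilates[OF lf d])
  have Xm: "biv.act (?X ^ m) y = ?z"
    using shift_op_power_unit[of m m ?d] d unfolding biv.act_X_power y_def by simp
  have XSm: "biv.act (?X ^ Suc m) y = 0"
    unfolding power_Suc biv.act_mult Xm biv.act_X using d by (intro shift_op_unit(2)) simp
  have pow: "mat_act ?J (f ^ i) y = biv.act (?X ^ i * ([:pderiv f:] + ?X * r) ^ i) y" for i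
  proof -
    have "mat_act ?J (f ^ i) v = biv.act (?Q ^ i) v" for v
      by (induction i arbitrary: v)
         (simp_all only: power_0 power_Suc mat_op.act_mult biv.act_mult r one_pCons
           mat_op.act_const biv.act_const fun_scale.scale_one S.scale_one companion_op.act_const)
    moreover have "?Q = [:f:] + ?X * ([:pderiv f:] + ?X * r)" by simp
    moreover obtain e where "([:f:] + ?X * ([:pderiv f:] + ?X * r)) ^ i =
        [:f:] * e + (?X * ([:pderiv f:] + ?X * r)) ^ i"
      using power_add_split by blast
    moreover have "biv.act ([:f:] * e) y = 0"
      unfolding mult.commute[of "[:f:]"] biv.act_mult biv.act_const fy by (rule biv.act_zero_right)
    ultimately show ?thesis by (simp only: biv.act_add_left add_0 power_mult_distrib)
  qed
  have top: "mat_act ?J (f ^ Suc m) y = 0"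
    unfolding pow mult.commute[of "?X ^ Suc m"] biv.act_mult XSm by (rule biv.act_zero_right)
  obtain e where e: "([:pderiv f:] + ?X * r) ^ m = ?X * r * e + [:pderiv f:] ^ m"
    using power_add_split[of "?X * r" "[:pderiv f:]" m] by (auto simp: add.commute)
  have const_pow: "[:pderiv f:] ^ m = [:pderiv f ^ m:]" by (induction m) (simp_all add: one_pCons)
  have "mat_act ?J (f ^ m) y = biv.act (r * e * ?X ^ Suc m + [:pderiv f ^ m:] * ?X ^ m) y"
    unfolding pow e const_pow by (rule arg_cong[of _ _ "\<lambda>q. biv.act q y"]) (simp only: algebra_simps power_Suc)
  also have "\<dots> = companion_op.act ?n f (pderiv f ^ m) ?z"
    by (simp only: biv.act_add_left biv.act_mult XSm Xm biv.act_const biv.act_zero_right add_0)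
  finally have low: "mat_act ?J (f ^ m) y = companion_op.act ?n f (pderiv f ^ m) ?z" .
  have fz: "companion_op.act ?n f f ?z = 0"
  proof -
    have "companion_op.act ?n f f ?z = biv.act [:f:] (biv.act (?X ^ m) y)"
      by (simp only: Xm biv.act_const)
    also have "\<dots> = biv.act (?X ^ m) (biv.act [:f:] y)"
      unfolding biv.act_mult[symmetric] by (simp only: mult.commute)
    finally show ?thesis by (simp only: biv.act_const fy biv.act_zero_right)
  qed
  have "\<not> f dvd pderiv f ^ m"
    using irreducible_not_dvd_pderiv[OF irr] prime_elem_dvd_power field_poly_irreducible_imp_prime[OF irr]
    by blast
  moreover have z: "companion_op.act ?n f (f ^ Suc 0) ?z = 0" "companion_op.act ?n f (f ^ 0) ?z \<noteq> 0"
    by (simp_all only: power_Suc power_0 mult_1_right fz S.scale_one fun_unit_nonzero simp_thms)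
  have "companion_op.act ?n f (pderiv f ^ m) ?z = 0 \<longleftrightarrow> f ^ Suc 0 dvd pderiv f ^ m"
    by (rule S.order_prime_power[OF _ z]) (rule max)
  ultimately have "mat_act ?J (f ^ m) y \<noteq> 0" unfolding low by (simp only: power_Suc0_right) blast
  then show ?thesis using mat_act.order_prime_power[OF max top] by blast
qed

text \<open>Counting replaces a spanning argument: a cyclic module of order f^(m+1) has as many
  elements as the whole space.\<close>

lemma range_cyclic_block_J:
  fixes f :: "'a::{field, finite} poly" and m :: nat
  assumes f: "f \<in> Phi"
  defines "y \<equiv> fun_unit (degree f * Suc m - 1)"
  shows "fun_space (degree f * Suc m) = range (\<lambda>c. mat_act (block_J (Suc m) f) c y)"
proof -
  let ?n = "degree f * Suc m" let ?J = "block_J (Suc m) f"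
  let ?R = "range (\<lambda>c. mat_act ?J c y)"
  have d: "degree f > 0" using f by (rule Phi_degree_pos)
  have "mat_act.cyclic_decomp ?J ?R [(f ^ Suc m, y)]"
    using block_J_order[OF f, of m] unfolding y_def[symmetric] mat_act.cyclic_decomp_def
    by (auto simp: image_def)
  then have "card ?R = CARD('a) ^ ?n"
    by (subst mat_act.card_cyclic_decomp_list)
       (auto simp: Phi_nonzero[OF f] Phi_degree_power[OF f] simp del: power_Suc mult_Suc_right)
  moreover have "?R \<subseteq> fun_space ?n"
    using d by (auto simp: y_def intro!: fun_space_mat_act fun_unit_space)
  ultimately show ?thesis using card_fun_space[where 'a='a, of ?n]
    by (metis card_subset_eq)
qed

section \<open>Block diagonal sums\<close>

definition fun_shift :: "nat \<Rightarrow> (nat \<Rightarrow> 'a::zero) \<Rightarrow> nat \<Rightarrow> 'a" where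
  "fun_shift r w = (\<lambda>i. if i < r then 0 else w (i - r))"

lemma fun_shift_0 [simp]: "fun_shift r 0 = 0"
  by (auto simp: fun_shift_def)

lemma fun_shift_add: "fun_shift r (v + w) = fun_shift r v + fun_shift r w"
  for v :: "nat \<Rightarrow> 'a::monoid_add"
  by (auto simp: fun_shift_def fun_eq_iff)

lemma fun_shift_scale: "fun_shift r (fun_scale a w) = fun_scale a (fun_shift r w)"
  by (auto simp: fun_shift_def fun_scale_def fun_eq_iff)

lemma fun_shift_eq_0 [simp]: "fun_shift r w = 0 \<longleftrightarrow> w = 0"
proof
  assume "fun_shift r w = 0"
  then have "fun_shift r w (r + i) = 0" for i by simp
  then show "w = 0" by (simp add: fun_shift_def fun_eq_iff)
qed simp

lemma fun_shift_unit: "fun_shift r (fun_unit k) = fun_unit (r + k)"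
  by (auto simp: fun_shift_def fun_unit_def fun_eq_iff)

lemma sum_lessThan_add: "(\<Sum>j<r + s. g j) = (\<Sum>j<r. g j) + (\<Sum>j<s. g (r + j))"
  for g :: "nat \<Rightarrow> 'a::comm_monoid_add"
  by (induction s) (auto simp: algebra_simps)

context
  fixes A D B :: "'a::field mat" and r s :: nat
  assumes A: "A \<in> carrier_mat r r" and D: "D \<in> carrier_mat s s"
  defines "B \<equiv> four_block_mat A (0\<^sub>m r s) (0\<^sub>m s r) D"
begin

lemma mat_op_diag_left: "v \<in> fun_space r \<Longrightarrow> mat_op B v = mat_op A v"
  using A D unfolding mat_op_def B_def
  by (auto simp: fun_eq_iff sum_lessThan_add fun_space_def)

lemma mat_op_diag_right: "mat_op B (fun_shift r w) = fun_shift r (mat_op D w)"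
proof
  fix i
  show "mat_op B (fun_shift r w) i = fun_shift r (mat_op D w) i"
    using A D unfolding mat_op_def B_def
    by (auto simp: sum_lessThan_add fun_shift_def intro!: sum.cong sum.neutral)
qed

lemma mat_act_diag_left: "v \<in> fun_space r \<Longrightarrow> mat_act B p v = mat_act A p v"
  using A by (induction p) (auto simp: mat_op_diag_left fun_space_mat_act)

lemma mat_act_diag_right: "mat_act B p (fun_shift r w) = fun_shift r (mat_act D p w)"
  by (induction p)
    (simp_all only: mat_op.act_0 mat_op.act_pCons fun_shift_0 mat_op_diag_right fun_shift_add fun_shift_scale)

end

lemma fun_space_split:
  fixes v :: "nat \<Rightarrow> 'a::monoid_add"
  assumes "v \<in> fun_space (r + s)"
  obtains u w where "u \<in> fun_space r" "w \<in> fun_space s" "v = fun_shift r w + u"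
proof
  show "(\<lambda>i. if i < r then v i else 0) \<in> fun_space r" by (simp add: fun_space_def)
  show "(\<lambda>i. v (r + i)) \<in> fun_space s" using assms by (simp add: fun_space_def)
  show "v = fun_shift r (\<lambda>i. v (r + i)) + (\<lambda>i. if i < r then v i else 0)"
    by (auto simp: fun_shift_def fun_eq_iff)
qed

definition block_size :: "'a::zero poly \<times> nat \<Rightarrow> nat" where
  "block_size t = degree (fst t) * snd t"

text \<open>The last coordinate of each block, counted from 0. The unit vector there generates the
  block.\<close>

definition block_ends :: "('a::zero poly \<times> nat) list \<Rightarrow> nat list" where
  "block_ends ts = map (\<lambda>i. sum_list (map block_size (take (Suc i) ts)) - 1) [0..<length ts]"

definition block_diag :: "('a::field poly \<times> nat) list \<Rightarrow> 'a mat" where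
  "block_diag ts = diag_block_mat (map (\<lambda>(f, k). block_J k f) ts)"

lemma length_block_ends [simp]: "length (block_ends ts) = length ts"
  by (simp add: block_ends_def)

text \<open>Subtraction of natural numbers is truncated, so r + x - 1 = r + (x - 1) requires x > 0;
  hence the sizes are assumed positive.\<close>

lemma block_ends_Cons:
  assumes "\<And>t. t \<in> set ts \<Longrightarrow> block_size t > 0"
  shows "block_ends (t # ts) = (block_size t - 1) # map ((+) (block_size t)) (block_ends ts)"
proof (rule nth_equalityI)
  fix i assume i: "i < length (block_ends (t # ts))"
  show "block_ends (t # ts) ! i = ((block_size t - 1) # map ((+) (block_size t)) (block_ends ts)) ! i"
  proof (cases i)
    case (Suc l)
    with i obtain t' ts' where ts: "ts = t' # ts'" by (cases ts) auto
    then have "block_size t' > 0" using assms by simp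
    with i Suc show ?thesis by (simp add: block_ends_def ts del: upt_Suc)
  qed (simp add: block_ends_def del: upt_Suc)
qed simp

lemma block_diag_carrier:
  "block_diag ts \<in> carrier_mat (sum_list (map block_size ts)) (sum_list (map block_size ts))"
  by (auto simp: block_diag_def dim_diag_block_mat block_size_def[abs_def] o_def case_prod_beta
      intro!: carrier_matI)

lemma block_diag_Cons:
  "block_diag ((f, k) # ts) = four_block_mat (block_J k f)
    (0\<^sub>m (degree f * k) (sum_list (map block_size ts)))
    (0\<^sub>m (sum_list (map block_size ts)) (degree f * k)) (block_diag ts)"
  using block_diag_carrier[of ts] by (simp add: block_diag_def Let_def)

text \<open>The first block is cyclic with its last unit vector as generator; it meets the shifted
  decomposition of the remaining blocks trivially and spans the space together with it.\<close>

theorem primary_decomp_block_diag: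
  fixes ts :: "('a::{field, finite} poly \<times> nat) list"
  assumes "\<And>f k. (f, k) \<in> set ts \<Longrightarrow> f \<in> Phi \<and> 1 \<le> k"
  shows "mat_act.primary_decomp (block_diag ts) (fun_space (sum_list (map block_size ts)))
    (zip ts (map fun_unit (block_ends ts)))"
  using assms
proof (induction ts)
  case Nil
  have "fun_space 0 = {0 :: nat \<Rightarrow> 'a}" by (auto simp: fun_space_def)
  then show ?case by (simp add: mat_act.primary_decomp_def)
next
  case (Cons t ts)
  obtain f k where t: "t = (f, k)" by (cases t)
  with Cons.prems[of f k] have f: "f \<in> Phi" and k: "1 \<le> k" by auto
  then obtain m where m: "k = Suc m" by (cases k) auto
  let ?r = "degree f * k" let ?s = "sum_list (map block_size ts)"
  let ?A = "block_J k f" let ?D = "block_diag ts" let ?B = "block_diag (t # ts)"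
  let ?ord = "\<lambda>((f, k), y). (f ^ k, y)"
  let ?gs = "zip ts (map fun_unit (block_ends ts)) :: (('a poly \<times> nat) \<times> (nat \<Rightarrow> 'a)) list"
  let ?hs = "map (\<lambda>(t, y). (t, fun_shift ?r y)) ?gs"
  let ?y = "fun_unit (?r - 1) :: nat \<Rightarrow> 'a"
  have A: "?A \<in> carrier_mat ?r ?r" and D: "?D \<in> carrier_mat ?s ?s"
    by (auto simp: block_diag_carrier)
  have Bdef: "?B = four_block_mat ?A (0\<^sub>m ?r ?s) (0\<^sub>m ?s ?r) ?D"
    by (simp add: t block_diag_Cons)
  note left = mat_act_diag_left[OF A D, folded Bdef] and right = mat_act_diag_right[OF A D, folded Bdef]
  have size: "block_size t' > 0" if "t' \<in> set (t # ts)" for t'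
    using Cons.prems[of "fst t'" "snd t'"] that Phi_degree_pos[of "fst t'"] by (simp add: block_size_def)
  have IH: "mat_act.cyclic_decomp ?D (fun_space ?s) (map ?ord ?gs)"
    and gsP: "\<forall>((f, k), y)\<in>set ?gs. f \<in> Phi \<and> 1 \<le> k"
    using Cons.IH[OF Cons.prems] unfolding mat_act.primary_decomp_def by (blast intro: list.set_intros)+
  have comb: "mat_act.comb ?B (map ?ord ?hs) c = fun_shift ?r (mat_act.comb ?D (map ?ord ?gs) c)" for c
  proof -
    have "mat_act.comb ?B (map ?ord (map (\<lambda>(t, y). (t, fun_shift ?r y)) gs)) c =
        fun_shift ?r (mat_act.comb ?D (map ?ord gs) c)"
      for gs :: "(('a poly \<times> nat) \<times> (nat \<Rightarrow> 'a)) list" and c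
      by (induction gs arbitrary: c) (auto simp: right fun_shift_add)
    then show ?thesis .
  qed
  have W: "mat_act.cyclic_decomp ?B (fun_shift ?r ` fun_space ?s) (map ?ord ?hs)"
    using IH unfolding mat_act.cyclic_decomp_def comb fun_shift_eq_0
    by (auto simp: comb image_image case_prod_beta) 
  have yr: "?y \<in> fun_space ?r" using size[of t] by (intro fun_unit_space) (simp add: t block_size_def)
  have order: "mat_act ?B c ?y = 0 \<longleftrightarrow> f ^ k dvd c" for c
    using block_J_order[OF f, of m] left[OF yr] by (simp add: m)
  have range: "fun_space ?r = range (\<lambda>c. mat_act ?B c ?y)"
    using range_cyclic_block_J[OF f, of m] left[OF yr] by (simp add: m)
  have "mat_act.cyclic_decomp ?B (fun_space (?r + ?s)) ((f ^ k, ?y) # map ?ord ?hs)"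
  proof (rule mat_act.cyclic_decomp_Cons[OF W order])
    fix c assume "mat_act ?B c ?y \<in> fun_shift ?r ` fun_space ?s"
    moreover have "mat_act ?B c ?y \<in> fun_space ?r" unfolding range by blast
    ultimately show "mat_act ?B c ?y = 0"
      by (auto simp: fun_space_def fun_shift_def fun_eq_iff)
  next
    show "fun_space (?r + ?s) = {w + mat_act ?B c ?y |w c. w \<in> fun_shift ?r ` fun_space ?s}"
    proof (intro equalityI subsetI)
      fix v :: "nat \<Rightarrow> 'a" assume "v \<in> fun_space (?r + ?s)"
      then obtain u w where u: "u \<in> fun_space ?r" and w: "w \<in> fun_space ?s" and v: "v = fun_shift ?r w + u"
        by (rule fun_space_split)
      from u obtain c where "u = mat_act ?B c ?y" unfolding range by blast
      with v w show "v \<in> {w + mat_act ?B c ?y |w c. w \<in> fun_shift ?r ` fun_space ?s}" by blast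
    next
      fix v assume "v \<in> {w + mat_act ?B c ?y |w c. w \<in> fun_shift ?r ` fun_space ?s}"
      then obtain w c where w: "w \<in> fun_space ?s" and v: "v = fun_shift ?r w + mat_act ?B c ?y" by blast
      have "mat_act ?B c ?y \<in> fun_space ?r" unfolding range by blast
      then show "v \<in> fun_space (?r + ?s)" using w by (auto simp: v fun_space_def fun_shift_def)
    qed
  qed
  moreover have "zip (t # ts) (map fun_unit (block_ends (t # ts))) = (t, ?y) # ?hs"
    using size by (simp add: block_ends_Cons zip_map2 t block_size_def fun_shift_unit case_prod_beta)
  moreover have "sum_list (map block_size (t # ts)) = ?r + ?s" by (simp add: t block_size_def)
  ultimately show ?case using gsP f k unfolding mat_act.primary_decomp_def
    by (auto simp: t)
qed

section \<open>Block types\<close>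

text \<open>\<open>J_lambda\<close> is a diagonal sum of diagonal sums; this flattens it to a single
  list of blocks.\<close>

lemma diag_block_mat_concat:
  "diag_block_mat (map diag_block_mat Bss) = diag_block_mat (concat Bss)"
  by (induction Bss) (simp_all add: diag_block_mat_append Let_def)

definition block_types ::
  "(('a::field poly \<Rightarrow> nat list) \<Rightarrow> ('a poly \<times> nat) list) \<Rightarrow> ('a poly \<Rightarrow> nat list) \<Rightarrow> ('a poly \<times> nat) list" where
  "block_types ord \<Lambda> =
     concat (map (\<lambda>i. replicate (count_list (\<Lambda> t_minus_1) i) (t_minus_1, i))
       [1..<Suc (Max (insert 0 (set (\<Lambda> t_minus_1))))]) @
     map (\<lambda>(f, i). (f, \<Lambda> f ! i)) (ord \<Lambda>)"

lemma J_lambda_eq_block_diag: "J_lambda ord \<Lambda> = block_diag (block_types ord \<Lambda>)"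
proof -
  let ?\<mu> = "\<Lambda> t_minus_1" let ?r = "Max (insert 0 (set (\<Lambda> t_minus_1)))"
  let ?Bs = "map (\<lambda>i. replicate (count_list ?\<mu> i) (block_J i t_minus_1)) [1..<Suc ?r] @
    [map (\<lambda>(f, i). block_J (\<Lambda> f ! i) f) (ord \<Lambda>)]"
  have "map (E_block ?\<mu>) [1..<Suc ?r] @ [J_minus ord \<Lambda>] = map diag_block_mat ?Bs"
    by (simp add: E_block_def[abs_def] J_minus_def del: upt_Suc)
  then have "J_lambda ord \<Lambda> = diag_block_mat (concat ?Bs)"
    unfolding J_lambda_def Let_def by (simp only: diag_block_mat_concat)
  also have "concat ?Bs = map (\<lambda>(f, k). block_J k f) (block_types ord \<Lambda>)"
    by (simp add: block_types_def map_concat case_prod_beta comp_def del: upt_Suc)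
  finally show ?thesis by (simp add: block_diag_def)
qed

text \<open>Only multiplicities count, so the notion fits the types of an arbitrary decomposition as
  well as the ordered list of blocks.\<close>

definition encodes :: "('a::field poly \<Rightarrow> nat list) \<Rightarrow> ('a poly \<times> nat) list \<Rightarrow> bool" where
  "encodes \<Lambda> ts \<longleftrightarrow> (\<forall>f k. count (mset ts) (f, k) = (if f \<in> Phi then count_list (\<Lambda> f) k else 0))"

lemma count_mset_eq_count_list: "count (mset xs) x = count_list xs x"
  by (induction xs) auto

lemma count_list_pos_iff [simp]: "0 < count_list xs x \<longleftrightarrow> x \<in> set xs"
  by (induction xs) auto

lemma encodes_mem_iff:
  assumes "encodes \<Lambda> ts"
  shows "(f, k) \<in> set ts \<longleftrightarrow> f \<in> Phi \<and> k \<in> set (\<Lambda> f)"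
proof -
  have "(f, k) \<in> set ts \<longleftrightarrow> count (mset ts) (f, k) \<noteq> 0" by (simp add: count_mset_eq_count_list)
  also have "\<dots> \<longleftrightarrow> f \<in> Phi \<and> k \<in> set (\<Lambda> f)"
    using assms by (simp add: encodes_def)
  finally show ?thesis .
qed

lemma PPhi_partition: "\<Lambda> \<in> PPhi m \<Longrightarrow> f \<in> Phi \<Longrightarrow> is_partition (\<Lambda> f)"
  unfolding PPhi_def by auto

lemma encodes_valid:
  assumes "encodes \<Lambda> ts" "\<Lambda> \<in> PPhi m" "(f, k) \<in> set ts"
  shows "f \<in> Phi \<and> 1 \<le> k"
proof -
  have f: "f \<in> Phi" "k \<in> set (\<Lambda> f)" using assms encodes_mem_iff by blast+
  then have "k \<noteq> 0" using PPhi_partition[OF assms(2) f(1)] unfolding is_partition_def by (intro notI) simp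
  with f show ?thesis by simp
qed

lemma encodes_block_types:
  assumes ord: "is_block_order ord" and L: "\<Lambda> \<in> PPhi m"
  shows "encodes \<Lambda> (block_types ord \<Lambda>)"
  unfolding encodes_def
proof (intro allI)
  fix f :: "'a poly" and k
  let ?\<mu> = "\<Lambda> t_minus_1" let ?r = "Max (insert 0 (set (\<Lambda> t_minus_1)))"
  let ?g = "\<lambda>i. replicate (count_list ?\<mu> i) (t_minus_1 :: 'a poly, i)"
  have fst: "count (mset (concat (map ?g [1..<Suc r]))) (f, k) =
      (if f = t_minus_1 \<and> 1 \<le> k \<and> k \<le> r then count_list ?\<mu> k else 0)" for r
    by (induction r) (auto simp: le_Suc_eq)
  have "count_list ?\<mu> k = 0" if "\<not> (1 \<le> k \<and> k \<le> ?r)"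
  proof -
    have "k \<le> ?r" if "k \<in> set ?\<mu>" using that by (intro Max_ge) auto
    moreover have "0 \<notin> set ?\<mu>" using PPhi_partition[OF L t_minus_1_Phi] by (simp add: is_partition_def)
    ultimately have "k \<notin> set ?\<mu>" using that by (cases "k = 0") auto
    then show ?thesis by (simp add: count_list_0_iff)
  qed
  then have part1: "count (mset (concat (map ?g [1..<Suc ?r]))) (f, k) =
      (if f = t_minus_1 then count_list ?\<mu> k else 0)" unfolding fst by auto
  let ?S = "{(f, i). f \<in> Phi \<and> f \<noteq> (t_minus_1 :: 'a poly) \<and> i < length (\<Lambda> f)}"
  have dist: "distinct (ord \<Lambda>)" and set: "set (ord \<Lambda>) = ?S"
    using ord L unfolding is_block_order_def by blast+
  have "count (mset (map (\<lambda>(f, i). (f, \<Lambda> f ! i)) (ord \<Lambda>))) (f, k) =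
      length (filter (\<lambda>(g, i). g = f \<and> \<Lambda> g ! i = k) xs)" if "xs = ord \<Lambda>" for xs
    unfolding that[symmetric] by (induction xs) auto
  also have "length (filter (\<lambda>(g, i). g = f \<and> \<Lambda> g ! i = k) (ord \<Lambda>)) =
      card {(g, i) \<in> ?S. g = f \<and> \<Lambda> g ! i = k}"
    using dist set by (subst distinct_card[symmetric]) (auto intro!: arg_cong[of _ _ card])
  also have "\<dots> = (if f \<in> Phi \<and> f \<noteq> t_minus_1 then count_list (\<Lambda> f) k else 0)"
  proof (cases "f \<in> Phi \<and> f \<noteq> t_minus_1")
    case True
    have "{(g, i) \<in> ?S. g = f \<and> \<Lambda> g ! i = k} = Pair f ` {i. i < length (\<Lambda> f) \<and> \<Lambda> f ! i = k}"
      using True by auto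
    also have "card \<dots> = card {i. i < length (\<Lambda> f) \<and> \<Lambda> f ! i = k}"
      by (rule card_image) (simp add: inj_on_def)
    also have "\<dots> = count_list (\<Lambda> f) k"
      by (simp add: count_list_eq_length_filter length_filter_conv_card eq_commute)
    finally show ?thesis using True by simp
  next
    case False
    then have e: "{(g, i) \<in> ?S. g = f \<and> \<Lambda> g ! i = k} = {}" by auto
    show ?thesis unfolding e using False by auto
  qed
  finally have part2: "count (mset (map (\<lambda>(f, i). (f, \<Lambda> f ! i)) (ord \<Lambda>))) (f, k) =
      (if f \<in> Phi \<and> f \<noteq> t_minus_1 then count_list (\<Lambda> f) k else 0)" by simp
  show "count (mset (block_types ord \<Lambda>)) (f, k) = (if f \<in> Phi then count_list (\<Lambda> f) k else 0)"
    unfolding block_types_def mset_append count_union part1 part2 using t_minus_1_Phi by auto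
qed

lemma sum_mset_sum:
  "finite A \<Longrightarrow> (\<Sum>x\<in>#(\<Sum>a\<in>A. M a). h x) = (\<Sum>a\<in>A. \<Sum>x\<in>#M a. h x)"
  by (induction rule: finite_induct) auto

lemma encodes_sum:
  assumes enc: "encodes \<Lambda> ts" and fin: "finite {f \<in> Phi. \<Lambda> f \<noteq> []}"
  shows "(\<Sum>f \<in> {f \<in> Phi. \<Lambda> f \<noteq> []}. degree f * sum_list (\<Lambda> f)) = sum_list (map block_size ts)"
proof -
  let ?F = "{f \<in> Phi. \<Lambda> f \<noteq> []}"
  have pair: "count (image_mset (Pair g) M) (f, k) = (if f = g then count M k else 0)"
    for M :: "nat multiset" and f g :: "'a poly" and k
    by (induction M) auto
  have "mset ts = (\<Sum>g\<in>?F. image_mset (Pair g) (mset (\<Lambda> g)))"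
  proof (rule multiset_eqI)
    fix t :: "'a poly \<times> nat"
    obtain f k where t: "t = (f, k)" by (cases t)
    have "count (\<Sum>g\<in>?F. image_mset (Pair g) (mset (\<Lambda> g))) t =
        (\<Sum>g\<in>?F. if f = g then count (mset (\<Lambda> g)) k else 0)"
      unfolding t count_sum pair ..
    also have "\<dots> = (if f \<in> Phi then count_list (\<Lambda> f) k else 0)"
      using fin by (simp add: sum.delta count_mset_eq_count_list)
    finally show "count (mset ts) t = count (\<Sum>g\<in>?F. image_mset (Pair g) (mset (\<Lambda> g))) t"
      using enc by (simp add: encodes_def t)
  qed
  then have "sum_list (map block_size ts) = (\<Sum>t\<in>#(\<Sum>g\<in>?F. image_mset (Pair g) (mset (\<Lambda> g))). block_size t)"
    by (simp flip: sum_mset_sum_list)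
  also have "\<dots> = (\<Sum>g\<in>?F. \<Sum>k\<in>#mset (\<Lambda> g). degree g * k)"
    unfolding sum_mset_sum[OF fin] by (simp add: block_size_def image_mset.compositionality comp_def)
  also have "\<dots> = (\<Sum>f\<in>?F. degree f * sum_list (\<Lambda> f))"
    by (simp add: sum_mset_distrib_left[symmetric] sum_mset_sum_list)
  finally show ?thesis by simp
qed

lemma encodes_size:
  assumes "encodes \<Lambda> ts" "\<Lambda> \<in> PPhi m"
  shows "sum_list (map block_size ts) = m"
  using assms encodes_sum[OF assms(1)] by (auto simp: PPhi_def)

lemma encodes_unique:
  assumes e: "encodes \<Lambda> ts" "encodes \<Lambda>' ts'" and L: "\<Lambda> \<in> PPhi m" "\<Lambda>' \<in> PPhi m'"
    and m: "mset ts = mset ts'"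
  shows "\<Lambda> = \<Lambda>'"
proof
  fix f
  show "\<Lambda> f = \<Lambda>' f"
  proof (cases "f \<in> Phi")
    case True
    have "mset (\<Lambda> f) = mset (\<Lambda>' f)"
      using e m True by (intro multiset_eqI) (metis encodes_def count_mset_eq_count_list)
    \<comment> \<open>Partitions are weakly decreasing, so their reversals are sorted and determined
      by their multisets.\<close>
    then have "mset (rev (\<Lambda> f)) = mset (rev (\<Lambda>' f))" by simp
    moreover have "sorted (rev (\<Lambda> f))" "sorted (rev (\<Lambda>' f))"
      using PPhi_partition[OF L(1) True] PPhi_partition[OF L(2) True]
      by (simp_all add: is_partition_def sorted_wrt_rev)
    ultimately have "rev (\<Lambda> f) = rev (\<Lambda>' f)" by (metis properties_for_sort)
    then show ?thesis by simp
  next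
    case False
    then show ?thesis using L unfolding PPhi_def by (auto dest!: PiE_arb[of _ _ _ f])
  qed
qed

lemma ex_encodes:
  fixes ts :: "('a::field poly \<times> nat) list"
  assumes ts: "\<And>f k. (f, k) \<in> set ts \<Longrightarrow> f \<in> Phi \<and> 1 \<le> k"
  shows "\<exists>\<Lambda> \<in> PPhi (sum_list (map block_size ts)). encodes \<Lambda> ts"
proof -
  define \<Lambda> where "\<Lambda> = (\<lambda>f\<in>Phi. rev (sort (map snd (filter (\<lambda>t. fst t = f) ts))))"
  have \<Lambda>: "count_list (\<Lambda> f) k = count (mset ts) (f, k)" if "f \<in> Phi" for f k
  proof -
    have "count (mset (map snd (filter (\<lambda>t. fst t = f) ts))) k = count (mset ts) (f, k)"
      by (induction ts) auto
    moreover have "mset (\<Lambda> f) = mset (map snd (filter (\<lambda>t. fst t = f) ts))"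
      using that by (simp add: \<Lambda>_def)
    ultimately show ?thesis by (simp only: count_mset_eq_count_list[symmetric])
  qed
  have enc: "encodes \<Lambda> ts"
    unfolding encodes_def
  proof (intro allI)
    fix f k
    show "count (mset ts) (f, k) = (if f \<in> Phi then count_list (\<Lambda> f) k else 0)"
    proof (cases "f \<in> Phi")
      case False
      then have "(f, k) \<notin> set ts" using ts by blast
      with False show ?thesis by (simp add: count_mset_eq_count_list count_list_0_iff)
    qed (simp add: \<Lambda>)
  qed
  have "{f \<in> Phi. \<Lambda> f \<noteq> []} \<subseteq> fst ` set ts"
  proof
    fix f assume "f \<in> {f \<in> Phi. \<Lambda> f \<noteq> []}"
    then obtain k where "f \<in> Phi" "k \<in> set (\<Lambda> f)" by (cases "\<Lambda> f") auto
    then have "(f, k) \<in> set ts" using encodes_mem_iff[OF enc] by blast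
    then show "f \<in> fst ` set ts" by force
  qed
  then have fin: "finite {f \<in> Phi. \<Lambda> f \<noteq> []}" by (rule finite_subset) simp
  have "is_partition (\<Lambda> f)" if "f \<in> Phi" for f
  proof -
    have "0 \<notin> set (\<Lambda> f)" using ts[of f 0] encodes_mem_iff[OF enc, of f 0] that by auto
    moreover have "sorted_wrt (\<ge>) (\<Lambda> f)" using that by (simp add: \<Lambda>_def sorted_wrt_rev)
    ultimately show ?thesis by (simp add: is_partition_def)
  qed
  then have "\<Lambda> \<in> Phi \<rightarrow>\<^sub>E {\<mu>. is_partition \<mu>}" by (auto simp: \<Lambda>_def)
  then have "\<Lambda> \<in> PPhi (sum_list (map block_size ts))"
    unfolding PPhi_def using fin encodes_sum[OF enc fin] by simp
  with enc show ?thesis by blast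
qed

lemma block_ends_nth:
  "i < length ts \<Longrightarrow> block_ends ts ! i = sum_list (map block_size (take (Suc i) ts)) - 1"
  by (simp add: block_ends_def del: upt_Suc)

text \<open>The coordinate in the definition of \<open>\<epsilon>\<^sub>k\<close> is that of the generator of the last block of
  size \<open>k\<close>.\<close>

lemma epsilon_position:
  assumes k: "1 \<le> k" "k \<in> set (\<Lambda> t_minus_1)"
  shows "\<exists>i < length (block_types ord \<Lambda>). block_types ord \<Lambda> ! i = (t_minus_1, k) \<and>
    block_ends (block_types ord \<Lambda>) ! i = (\<Sum>i = 1..k. i * count_list (\<Lambda> t_minus_1) i) - 1"
proof -
  let ?\<mu> = "\<Lambda> t_minus_1" let ?r = "Max (insert 0 (set (\<Lambda> t_minus_1)))"
  let ?g = "\<lambda>i. replicate (count_list ?\<mu> i) (t_minus_1 :: 'a poly, i)"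
  let ?A = "concat (map ?g [1..<Suc k])"
  have "k \<le> ?r" using k by (intro Max_ge) auto
  then have "[1..<Suc ?r] = [1..<Suc k] @ [Suc k..<Suc ?r]"
    using upt_add_eq_append[of 1 "Suc k" "?r - k"] by (simp del: upt_Suc)
  then obtain B where B: "block_types ord \<Lambda> = ?A @ B" unfolding block_types_def by simp
  obtain c where c: "count_list ?\<mu> k = Suc c" using k(2) by (metis count_list_0_iff not0_implies_Suc)
  \<comment> \<open>The segment \<open>?A\<close> consists of the blocks of E^(1), ..., E^(k). Since
    k is a part, it ends in a block of size k, and its total size is the sum in the definition of
    \<epsilon>_k.\<close>
  have A: "?A = (concat (map ?g [1..<k]) @ replicate c (t_minus_1, k)) @ [(t_minus_1, k)]"
    using k(1) by (simp add: c replicate_append_same)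
  let ?i = "length ?A - 1"
  have len: "length ?A > 0" "?i < length ?A" unfolding A by simp_all
  have "?A ! ?i = (t_minus_1, k)" unfolding A by (simp only: length_append_singleton diff_Suc_1 nth_append_length)
  then have "block_types ord \<Lambda> ! ?i = (t_minus_1, k)" using len(2) unfolding B by (simp only: nth_append if_True)
  moreover have "sum_list (map block_size ?A) = (\<Sum>i = 1..k. i * count_list ?\<mu> i)"
    by (induction k) (auto simp: block_size_def sum_list_replicate)
  then have "block_ends (block_types ord \<Lambda>) ! ?i = (\<Sum>i = 1..k. i * count_list ?\<mu> i) - 1"
  proof -
    assume sum: "sum_list (map block_size ?A) = (\<Sum>i = 1..k. i * count_list ?\<mu> i)"
    have "take (Suc ?i) (?A @ B) = ?A" using len(1) by (simp del: upt_Suc)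
    moreover have "?i < length (?A @ B)" using len(2) by simp
    ultimately show ?thesis unfolding B using sum by (simp only: block_ends_nth)
  qed
  ultimately show ?thesis using len(2) unfolding B by (intro exI[of _ ?i]) simp
qed

section \<open>Rearranging lists with prescribed images\<close>

lemma ex_list_map_eq:
  assumes "mset (map h xs) = mset ys"
  shows "\<exists>xs'. mset xs' = mset xs \<and> map h xs' = ys"
proof -
  obtain \<pi> where p: "\<pi> permutes {..<length (map h xs)}" "permute_list \<pi> (map h xs) = ys"
    using mset_eq_permutation[OF assms[symmetric]] by blast
  then have "\<pi> permutes {..<length xs}" by simp
  then have "mset (permute_list \<pi> xs) = mset xs" "map h (permute_list \<pi> xs) = ys"
    using p(2) by (simp_all add: permute_list_map)
  then show ?thesis by blast
qed

text \<open>Several summands may share the type (t - 1, k), while \<epsilon>_k singles out the last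
  of these blocks. The rearrangement must therefore put a chosen element at a chosen
  position.\<close>

lemma ex_list_map_eq_nth:
  assumes m: "mset (map h (g # gs)) = mset ys" and i: "i < length ys" "ys ! i = h g"
  shows "\<exists>xs. mset xs = mset (g # gs) \<and> map h xs = ys \<and> xs ! i = g"
proof -
  have ys: "ys = take i ys @ h g # drop (Suc i) ys" using id_take_nth_drop[OF i(1)] i(2) by simp
  then have "mset ys = mset (take i ys @ drop (Suc i) ys) + {#h g#}"
    by (metis mset_append mset.simps(2) union_mset_add_mset_right add_mset_add_single)
  with m have "mset (map h gs) = mset (take i ys @ drop (Suc i) ys)" by simp
  then obtain hs where hs: "mset hs = mset gs" "map h hs = take i ys @ drop (Suc i) ys"
    using ex_list_map_eq by blast
  let ?xs = "take i hs @ g # drop i hs"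
  have "mset ?xs = add_mset g (mset (take i hs @ drop i hs))" by (simp only: mset_append) simp
  then have "mset ?xs = mset (g # gs)" unfolding append_take_drop_id using hs(1) by simp
  moreover have "map h ?xs = ys"
  proof -
    have "map h (take i hs) = take i ys" "map h (drop i hs) = drop (Suc i) ys"
      using hs(2) i(1) by (simp_all add: take_map[symmetric] drop_map[symmetric])
    then show ?thesis by (subst ys) simp
  qed
  moreover have "length (take i hs) = i"
    using arg_cong[OF hs(2), of length] i(1) by simp
  then have "?xs ! i = g" by (metis nth_append_length)
  ultimately show ?thesis by blast
qed

section \<open>Matrices as operators\<close>

definition fun_of_vec :: "'a::zero vec \<Rightarrow> nat \<Rightarrow> 'a" where
  "fun_of_vec v = (\<lambda>i. if i < dim_vec v then v $ i else 0)"

lemma fun_of_vec_space: "v \<in> carrier_vec l \<Longrightarrow> fun_of_vec v \<in> fun_space l"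
  by (auto simp: fun_of_vec_def fun_space_def)

lemma fun_of_vec_inj: "v \<in> carrier_vec l \<Longrightarrow> w \<in> carrier_vec l \<Longrightarrow> fun_of_vec v = fun_of_vec w \<longleftrightarrow> v = w"
  by (auto simp: fun_of_vec_def fun_eq_iff vec_eq_iff)

lemma fun_of_vec_vec: "f \<in> fun_space l \<Longrightarrow> fun_of_vec (vec l f) = f"
  by (auto simp: fun_of_vec_def fun_space_def fun_eq_iff)

lemma fun_of_vec_add:
  "v \<in> carrier_vec l \<Longrightarrow> w \<in> carrier_vec l \<Longrightarrow> fun_of_vec (v + w) = fun_of_vec v + fun_of_vec w"
  for v w :: "'a::monoid_add vec"
  by (auto simp: fun_of_vec_def fun_eq_iff)

lemma fun_of_vec_mult:
  "A \<in> carrier_mat l l \<Longrightarrow> v \<in> carrier_vec l \<Longrightarrow> fun_of_vec (A *\<^sub>v v) = mat_op A (fun_of_vec v)"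
  by (auto simp: fun_of_vec_def mat_op_def fun_eq_iff scalar_prod_def atLeast0LessThan intro!: sum.cong)

lemma fun_of_vec_unit: "k < l \<Longrightarrow> fun_of_vec (unit_vec l k) = fun_unit k"
  by (auto simp: fun_of_vec_def fun_unit_def fun_eq_iff)

lemma fun_of_vec_zero: "fun_of_vec (0\<^sub>v l) = 0"
  by (auto simp: fun_of_vec_def fun_eq_iff)

lemma mat_op_mult:
  assumes "A \<in> carrier_mat l l" "B \<in> carrier_mat l l" "v \<in> fun_space l"
  shows "mat_op (A * B) v = mat_op A (mat_op B v)"
proof -
  let ?v = "vec l v"
  have v: "?v \<in> carrier_vec l" by simp
  have Bv: "B *\<^sub>v ?v \<in> carrier_vec l" and AB: "A * B \<in> carrier_mat l l" using assms by auto
  have "mat_op (A * B) (fun_of_vec ?v) = fun_of_vec ((A * B) *\<^sub>v ?v)"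
    by (rule fun_of_vec_mult[OF AB v, symmetric])
  also have "(A * B) *\<^sub>v ?v = A *\<^sub>v (B *\<^sub>v ?v)" by (rule assoc_mult_mat_vec[OF assms(1,2) v])
  also have "fun_of_vec \<dots> = mat_op A (mat_op B (fun_of_vec ?v))"
    by (simp only: fun_of_vec_mult[OF assms(1) Bv] fun_of_vec_mult[OF assms(2) v])
  finally show ?thesis by (simp only: fun_of_vec_vec[OF assms(3)])
qed

lemma mat_op_one: "v \<in> fun_space l \<Longrightarrow> mat_op (1\<^sub>m l) v = v"
  using fun_of_vec_mult[of "1\<^sub>m l" l "vec l v"] by (simp add: fun_of_vec_vec)

lemma mat_op_unit: "j < dim_col A \<Longrightarrow> i < dim_row A \<Longrightarrow> mat_op A (fun_unit j) i = A $$ (i, j)"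
  by (simp add: mat_op_def fun_unit_def if_distrib[of "(*) _"] sum.delta cong: if_cong)

lemma mat_op_eqI:
  assumes "A \<in> carrier_mat l l" "B \<in> carrier_mat l l" "\<And>v. v \<in> fun_space l \<Longrightarrow> mat_op A v = mat_op B v"
  shows "A = B"
proof (rule eq_matI)
  fix i j assume ij: "i < dim_row B" "j < dim_col B"
  then have "mat_op A (fun_unit j) i = mat_op B (fun_unit j) i" using assms by (simp add: fun_unit_space)
  then show "A $$ (i, j) = B $$ (i, j)" using ij assms by (simp add: mat_op_unit)
qed (use assms in auto)

lemma carrier_GL: "carrier (GL n) = {A. A \<in> carrier_mat n n \<and> det A \<noteq> 0}"
proof -
  have "A \<in> Units (ring_mat TYPE('a) n ()) \<longleftrightarrow> A \<in> carrier_mat n n \<and> det A \<noteq> 0" for A :: "'a mat"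
    using det_non_zero_imp_unit[of A n "()"] unit_imp_det_non_zero[of A n "()"]
    by (auto simp: Units_def ring_mat_def)
  then show ?thesis by (auto simp: GL_def units_of_def)
qed

lemma GL_simps:
  "mult (GL n) = (*)" "one (GL n) = 1\<^sub>m n"
  by (simp_all add: GL_def units_of_def ring_mat_def)

lemma group_GL: "group (GL n)"
proof -
  interpret ring "ring_mat TYPE('a::field) n ()" by (rule ring_mat)
  show "group (GL n :: 'a mat monoid)" unfolding GL_def by (rule units_group)
qed

lemma GL_iff_inj:
  fixes A :: "'a::field mat"
  assumes A: "A \<in> carrier_mat l l"
  shows "A \<in> carrier (GL l) \<longleftrightarrow> (\<forall>v \<in> fun_space l. mat_op A v = 0 \<longrightarrow> v = 0)"
proof -
  have "(\<exists>v. v \<in> carrier_vec l \<and> v \<noteq> 0\<^sub>v l \<and> A *\<^sub>v v = 0\<^sub>v l) \<longleftrightarrow> (\<exists>v \<in> fun_space l. v \<noteq> 0 \<and> mat_op A v = 0)"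
  proof
    assume "\<exists>v. v \<in> carrier_vec l \<and> v \<noteq> 0\<^sub>v l \<and> A *\<^sub>v v = 0\<^sub>v l"
    then obtain v where v: "v \<in> carrier_vec l" "v \<noteq> 0\<^sub>v l" "A *\<^sub>v v = 0\<^sub>v l" by blast
    have "fun_of_vec v \<noteq> 0" using v fun_of_vec_inj[of v l "0\<^sub>v l"] by (simp add: fun_of_vec_zero)
    moreover have "mat_op A (fun_of_vec v) = 0"
      using fun_of_vec_mult[OF A v(1)] v(3) by (simp add: fun_of_vec_zero)
    ultimately show "\<exists>v \<in> fun_space l. v \<noteq> 0 \<and> mat_op A v = 0" using fun_of_vec_space[OF v(1)] by blast
  next
    assume "\<exists>v \<in> fun_space l. v \<noteq> 0 \<and> mat_op A v = 0"
    then obtain v where v: "v \<in> fun_space l" "v \<noteq> 0" "mat_op A v = 0" by blast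
    have "vec l v \<noteq> 0\<^sub>v l" using fun_of_vec_vec[OF v(1)] v(2) by (metis fun_of_vec_zero)
    moreover have "fun_of_vec (A *\<^sub>v vec l v) = fun_of_vec (0\<^sub>v l)"
      using fun_of_vec_mult[OF A, of "vec l v"] v by (simp add: fun_of_vec_vec fun_of_vec_zero)
    then have "A *\<^sub>v vec l v = 0\<^sub>v l" using A by (subst (asm) fun_of_vec_inj[of _ l]) auto
    ultimately show "\<exists>v. v \<in> carrier_vec l \<and> v \<noteq> 0\<^sub>v l \<and> A *\<^sub>v v = 0\<^sub>v l" by (intro exI[of _ "vec l v"]) simp
  qed
  then show ?thesis using A det_0_iff_vec_prod_zero_field[OF A] by (auto simp: carrier_GL)
qed

lemma mat_act_scalar: "mat_act A [:a:] v = fun_scale a v"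
  by (rule mat_op.act_const)

lemma mat_act_X: "mat_act A [:0, 1:] v = mat_op A v"
  by (rule mat_op.act_X)

lemma mat_act_t_minus_1: "mat_act A t_minus_1 v = mat_op A v - v"
  by (auto simp: fun_scale_def fun_eq_iff mat_op.T_0)

lemma fun_space_sum_unit:
  fixes v :: "nat \<Rightarrow> 'a::comm_ring_1"
  assumes "v \<in> fun_space l"
  shows "v = (\<Sum>j<l. fun_scale (v j) (fun_unit j))"
proof
  fix i
  have "(\<Sum>j<l. fun_scale (v j) (fun_unit j)) i = (\<Sum>j<l. fun_scale (v j) (fun_unit j) i)"
    by (induction l) auto
  also have "\<dots> = (\<Sum>j<l. if j = i then v i else 0)"
    by (intro sum.cong) (auto simp: fun_scale_def fun_unit_def)
  also have "\<dots> = v i" using assms by (auto simp: fun_space_def sum.delta)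
  finally show "v i = (\<Sum>j<l. fun_scale (v j) (fun_unit j)) i" ..
qed

lemma matrix_of_module_iso:
  fixes A B :: "'a::{field, finite} mat"
  assumes A: "A \<in> carrier_mat l l" and B: "B \<in> carrier_mat l l"
    and iso: "module_iso (mat_act A) (mat_act B) (fun_space l) (fun_space l) \<phi>"
  shows "\<exists>u \<in> carrier (GL l). B * u = u * A \<and> (\<forall>v \<in> fun_space l. mat_op u v = \<phi> v)"
proof -
  let ?V = "fun_space l :: (nat \<Rightarrow> 'a) set"
  from iso have bij: "bij_betw \<phi> ?V ?V"
    and add: "\<And>x y. x \<in> ?V \<Longrightarrow> y \<in> ?V \<Longrightarrow> \<phi> (x + y) = \<phi> x + \<phi> y"
    and sc: "\<And>a x. x \<in> ?V \<Longrightarrow> \<phi> (mat_act A a x) = mat_act B a (\<phi> x)"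
    by (auto simp: module_iso_def)
  have scale: "\<phi> (fun_scale a x) = fun_scale a (\<phi> x)" if "x \<in> ?V" for a x
    using sc[OF that, of "[:a:]"] by (simp only: mat_act_scalar)
  have op: "\<phi> (mat_op A x) = mat_op B (\<phi> x)" if "x \<in> ?V" for x
    using sc[OF that, of "[:0, 1:]"] by (simp only: mat_act_X)
  have \<phi>0: "\<phi> 0 = 0" using add[of 0 0] by simp
  have \<phi>V: "\<phi> x \<in> ?V" if "x \<in> ?V" for x using bij that by (auto simp: bij_betw_def)
  define u where "u = mat l l (\<lambda>(i, j). \<phi> (fun_unit j) i)"
  have u: "u \<in> carrier_mat l l" by (simp add: u_def)
  have uphi: "mat_op u v = \<phi> v" if v: "v \<in> ?V" for v
  proof -
    \<comment> \<open>\<phi> is additive only on vectors of length l, so membership of the partial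
      sums is carried through the induction.\<close>
    have "\<phi> (\<Sum>j<k. fun_scale (v j) (fun_unit j)) = (\<Sum>j<k. fun_scale (v j) (\<phi> (fun_unit j))) \<and>
        (\<Sum>j<k. fun_scale (v j) (fun_unit j)) \<in> ?V" if "k \<le> l" for k
      using that
    proof (induction k)
      case (Suc k)
      then have u: "fun_unit k \<in> ?V" by (intro fun_unit_space) simp
      from Suc have IH: "\<phi> (\<Sum>j<k. fun_scale (v j) (fun_unit j)) = (\<Sum>j<k. fun_scale (v j) (\<phi> (fun_unit j)))"
        "(\<Sum>j<k. fun_scale (v j) (fun_unit j)) \<in> ?V" by auto
      show ?case unfolding sum.lessThan_Suc
        using fun_space_add[OF IH(2) fun_space_scale[OF u]]
        by (simp only: add[OF IH(2) fun_space_scale[OF u]] scale[OF u] IH(1) simp_thms)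
    qed (simp add: \<phi>0)
    then have "\<phi> v = (\<Sum>j<l. fun_scale (v j) (\<phi> (fun_unit j)))"
      using fun_space_sum_unit[OF v] by (metis order_refl)
    moreover have "mat_op u v = (\<Sum>j<l. fun_scale (v j) (\<phi> (fun_unit j)))"
    proof
      fix i
      have "(\<Sum>j<k. fun_scale (v j) (\<phi> (fun_unit j))) i = (\<Sum>j<k. v j * \<phi> (fun_unit j) i)" for k
        by (induction k) (auto simp: fun_scale_def)
      moreover have "\<phi> (fun_unit j) i = 0" if "j < l" "\<not> i < l" for j
        using \<phi>V[OF fun_unit_space[OF that(1)]] that(2) by (simp add: fun_space_def)
      ultimately show "mat_op u v i = (\<Sum>j<l. fun_scale (v j) (\<phi> (fun_unit j))) i"
        by (auto simp: mat_op_def u_def mult.commute intro!: sum.cong)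
    qed
    ultimately show ?thesis by simp
  qed
  have "u \<in> carrier (GL l)"
    unfolding GL_iff_inj[OF u]
  proof (intro ballI impI)
    fix v assume v: "v \<in> ?V" "mat_op u v = 0"
    then have "\<phi> v = \<phi> 0" by (simp add: uphi \<phi>0)
    then show "v = 0" using bij v(1) fun_space_0 unfolding bij_betw_def by (blast dest: inj_onD)
  qed
  moreover have "B * u = u * A"
  proof (rule mat_op_eqI[of _ l])
    fix v assume v: "v \<in> ?V"
    have "mat_op A v \<in> ?V" using A by (intro fun_space_mat_op) auto
    then show "mat_op (B * u) v = mat_op (u * A) v"
      using v by (simp add: mat_op_mult[OF B u] mat_op_mult[OF u A] uphi op)
  qed (use A B u in auto)
  ultimately show ?thesis using uphi by blast
qed

lemma GL_inverse:
  assumes "u \<in> carrier (GL l)"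
  obtains w where "w \<in> carrier (GL l)" "u * w = 1\<^sub>m l" "w * u = 1\<^sub>m l"
  using group.r_inv[OF group_GL assms] group.l_inv[OF group_GL assms] group.inv_closed[OF group_GL assms]
  by (auto simp: GL_simps)

lemma module_iso_of_matrix:
  fixes A B u :: "'a::{field, finite} mat"
  assumes A: "A \<in> carrier_mat l l" and B: "B \<in> carrier_mat l l"
    and u: "u \<in> carrier (GL l)" and eq: "B * u = u * A"
  shows "module_iso (mat_act A) (mat_act B) (fun_space l) (fun_space l) (mat_op u)"
proof -
  let ?V = "fun_space l :: (nat \<Rightarrow> 'a) set"
  obtain w where w: "w \<in> carrier (GL l)" "u * w = 1\<^sub>m l" "w * u = 1\<^sub>m l" by (rule GL_inverse[OF u])
  have uc: "u \<in> carrier_mat l l" and wc: "w \<in> carrier_mat l l" using u w by (auto simp: carrier_GL)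
  have uV: "mat_op u v \<in> ?V" for v using uc by (intro fun_space_mat_op) auto
  have wV: "mat_op w v \<in> ?V" for v using wc by (intro fun_space_mat_op) auto
  have AV: "mat_act A p v \<in> ?V" if "v \<in> ?V" for p v using A that by (intro fun_space_mat_act) auto
  have "bij_betw (mat_op u) ?V ?V"
  proof (rule bij_betwI[of _ _ _ "mat_op w"])
    fix v assume v: "v \<in> ?V"
    show "mat_op w (mat_op u v) = v" using mat_op_mult[OF wc uc v] w v by (simp add: mat_op_one)
    show "mat_op u (mat_op w v) = v" using mat_op_mult[OF uc wc v] w v by (simp add: mat_op_one)
  qed (use uV wV in auto)
  moreover have "mat_op u (mat_act A p v) = mat_act B p (mat_op u v)" if v: "v \<in> ?V" for p v
  proof (induction p)
    case (pCons a p)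
    have "mat_op u (mat_op A (mat_act A p v)) = mat_op B (mat_op u (mat_act A p v))"
      using mat_op_mult[OF uc A AV[OF v]] mat_op_mult[OF B uc AV[OF v]] eq by simp
    then show ?case
      using pCons by (simp only: mat_op.act_pCons mat_op.T_add mat_op.T_scale)
  qed (simp only: mat_op.act_0 mat_op.T_0)
  ultimately show ?thesis unfolding module_iso_def by (simp add: mat_op.T_add)
qed

section \<open>The affine group\<close>

lemma affine_mat_carrier:
  "\<alpha> \<in> carrier_vec l \<Longrightarrow> g \<in> carrier_mat l l \<Longrightarrow> affine_mat \<alpha> g \<in> carrier_mat (Suc l) (Suc l)"
  by (auto simp: affine_mat_def)

lemma affine_mat_index:
  assumes "\<alpha> \<in> carrier_vec l" "g \<in> carrier_mat l l" "i < Suc l" "j < Suc l"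
  shows "affine_mat \<alpha> g $$ (i, j) =
    (if i = 0 then if j = 0 then 1 else 0 else if j = 0 then \<alpha> $ (i - 1) else g $$ (i - 1, j - 1))"
  using assms by (auto simp: affine_mat_def mat_of_cols_def)

lemma affine_mat_inj:
  assumes c: "\<alpha> \<in> carrier_vec l" "g \<in> carrier_mat l l" "\<beta> \<in> carrier_vec l" "u \<in> carrier_mat l l"
  shows "affine_mat \<alpha> g = affine_mat \<beta> u \<longleftrightarrow> \<alpha> = \<beta> \<and> g = u"
proof
  assume e: "affine_mat \<alpha> g = affine_mat \<beta> u"
  have "\<alpha> = \<beta>"
  proof (rule eq_vecI)
    fix i assume "i < dim_vec \<beta>"
    then show "\<alpha> $ i = \<beta> $ i"
      using arg_cong[OF e, of "\<lambda>M. M $$ (Suc i, 0)"] c by (simp add: affine_mat_index[of _ l])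
  qed (use c in auto)
  moreover have "g = u"
  proof (rule eq_matI)
    fix i j assume "i < dim_row u" "j < dim_col u"
    then show "g $$ (i, j) = u $$ (i, j)"
      using arg_cong[OF e, of "\<lambda>M. M $$ (Suc i, Suc j)"] c by (simp add: affine_mat_index[of _ l])
  qed (use c in auto)
  ultimately show "\<alpha> = \<beta> \<and> g = u" by simp
qed simp

lemma affine_mat_mult:
  assumes c: "\<alpha> \<in> carrier_vec l" "g \<in> carrier_mat l l" "\<beta> \<in> carrier_vec l" "u \<in> carrier_mat l l"
  shows "affine_mat \<alpha> g * affine_mat \<beta> u = affine_mat (\<alpha> + g *\<^sub>v \<beta>) (g * u)"
proof (rule eq_matI)
  have c': "\<alpha> + g *\<^sub>v \<beta> \<in> carrier_vec l" "g * u \<in> carrier_mat l l" using c by auto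
  note A = affine_mat_carrier[OF c(1,2)] affine_mat_carrier[OF c(3,4)] affine_mat_carrier[OF c']
  fix i j assume "i < dim_row (affine_mat (\<alpha> + g *\<^sub>v \<beta>) (g * u))" "j < dim_col (affine_mat (\<alpha> + g *\<^sub>v \<beta>) (g * u))"
  then have ij: "i < Suc l" "j < Suc l" using A by auto
  have "(affine_mat \<alpha> g * affine_mat \<beta> u) $$ (i, j) =
      (\<Sum>k<Suc l. affine_mat \<alpha> g $$ (i, k) * affine_mat \<beta> u $$ (k, j))"
    using A ij by (simp add: scalar_prod_def atLeast0LessThan)
  also have "\<dots> = affine_mat \<alpha> g $$ (i, 0) * affine_mat \<beta> u $$ (0, j) +
      (\<Sum>k<l. affine_mat \<alpha> g $$ (i, Suc k) * affine_mat \<beta> u $$ (Suc k, j))"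
    by (rule sum.lessThan_Suc_shift)
  also have "\<dots> = affine_mat (\<alpha> + g *\<^sub>v \<beta>) (g * u) $$ (i, j)"
    using ij c c' by (auto simp: affine_mat_index[of _ l] scalar_prod_def atLeast0LessThan intro!: sum.cong)
  finally show "(affine_mat \<alpha> g * affine_mat \<beta> u) $$ (i, j) = affine_mat (\<alpha> + g *\<^sub>v \<beta>) (g * u) $$ (i, j)" .
qed (use c in \<open>auto simp: affine_mat_def\<close>)

lemma affine_mat_one: "affine_mat (0\<^sub>v l) (1\<^sub>m l) = 1\<^sub>m (Suc l)"
  using affine_mat_carrier[of "0\<^sub>v l" l "1\<^sub>m l"]
  by (intro eq_matI) (auto simp: affine_mat_index[of _ l])

lemma GA_set_Suc:
  "GA_set (Suc l) = {affine_mat \<alpha> g |\<alpha> g. \<alpha> \<in> carrier_vec l \<and> g \<in> carrier (GL l)}"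
  by (simp add: GA_set_def)

lemma affine_inverse:
  fixes \<alpha> :: "'a::field vec"
  assumes a: "\<alpha> \<in> carrier_vec l" and g: "g \<in> carrier (GL l)"
  shows "\<exists>B \<in> GA_set (Suc l). affine_mat \<alpha> g * B = 1\<^sub>m (Suc l) \<and> B * affine_mat \<alpha> g = 1\<^sub>m (Suc l)"
proof -
  obtain w where w: "w \<in> carrier (GL l)" "g * w = 1\<^sub>m l" "w * g = 1\<^sub>m l" by (rule GL_inverse[OF g])
  have gc: "g \<in> carrier_mat l l" and wc: "w \<in> carrier_mat l l" using g w by (auto simp: carrier_GL)
  \<comment> \<open>The product rule for affine matrices forces \<alpha> + g b = 0 for the
    translation part b of the inverse.\<close>
  let ?b = "w *\<^sub>v (- \<alpha>)"
  have na: "- \<alpha> \<in> carrier_vec l" using a by simp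
  have b: "?b \<in> carrier_vec l" using wc na by simp
  have "g *\<^sub>v ?b = - \<alpha>" using assoc_mult_mat_vec[OF gc wc na] w(2) na by simp
  then have "\<alpha> + g *\<^sub>v ?b = 0\<^sub>v l" using a by simp
  moreover have "?b + w *\<^sub>v \<alpha> = w *\<^sub>v 0\<^sub>v l"
    using mult_add_distrib_mat_vec[OF wc na a] a by simp
  then have "?b + w *\<^sub>v \<alpha> = 0\<^sub>v l" using wc by auto
  ultimately have "affine_mat \<alpha> g * affine_mat ?b w = 1\<^sub>m (Suc l)" "affine_mat ?b w * affine_mat \<alpha> g = 1\<^sub>m (Suc l)"
    using w(2,3) by (simp_all only: affine_mat_mult[OF a gc b wc] affine_mat_mult[OF b wc a gc] affine_mat_one)
  moreover have "affine_mat ?b w \<in> GA_set (Suc l)" unfolding GA_set_Suc using b w(1) by blast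
  ultimately show ?thesis by blast
qed

lemma group_GA: "group (GA (Suc l) :: 'a::field mat monoid)"
proof -
  interpret GL: group "GL (Suc l) :: 'a mat monoid" by (rule group_GL)
  let ?H = "GA_set (Suc l) :: 'a mat set"
  have closed: "A * B \<in> ?H" if AB: "A \<in> ?H" "B \<in> ?H" for A B
  proof -
    obtain \<alpha> g \<beta> u where AB': "A = affine_mat \<alpha> g" "B = affine_mat \<beta> u" "\<alpha> \<in> carrier_vec l" "\<beta> \<in> carrier_vec l"
      and gu: "g \<in> carrier (GL l)" "u \<in> carrier (GL l)" using AB unfolding GA_set_Suc by blast
    have c: "g \<in> carrier_mat l l" "u \<in> carrier_mat l l" using gu by (auto simp: carrier_GL)
    have "g * u \<in> carrier (GL l)"
      using monoid.m_closed[OF group.is_monoid[OF group_GL] gu] by (simp only: GL_simps)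
    moreover have "\<alpha> + g *\<^sub>v \<beta> \<in> carrier_vec l" using AB' c by auto
    ultimately have "affine_mat (\<alpha> + g *\<^sub>v \<beta>) (g * u) \<in> ?H" unfolding GA_set_Suc by blast
    then show ?thesis by (simp only: AB'(1,2) affine_mat_mult[OF AB'(3) c(1) AB'(4) c(2)])
  qed
  have sub: "?H \<subseteq> carrier (GL (Suc l))"
  proof
    fix A assume "A \<in> ?H"
    then obtain \<alpha> g where A: "A = affine_mat \<alpha> g" "\<alpha> \<in> carrier_vec l" "g \<in> carrier (GL l)"
      unfolding GA_set_Suc by blast
    then have Ac: "A \<in> carrier_mat (Suc l) (Suc l)" by (auto simp: carrier_GL intro: affine_mat_carrier)
    obtain B where B: "B \<in> ?H" "A * B = 1\<^sub>m (Suc l)" using affine_inverse[OF A(2,3)] A(1) by blast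
    then have Bc: "B \<in> carrier_mat (Suc l) (Suc l)"
      unfolding GA_set_Suc by (auto simp: carrier_GL intro: affine_mat_carrier)
    have "det A * det B = 1" using det_mult[OF Ac Bc] B(2) by simp
    then show "A \<in> carrier (GL (Suc l))" using Ac by (auto simp: carrier_GL)
  qed
  have "subgroup ?H (GL (Suc l))"
  proof (rule GL.subgroupI[OF sub])
    have "1\<^sub>m l \<in> carrier (GL l :: 'a mat monoid)" by (simp add: carrier_GL)
    then have "affine_mat (0\<^sub>v l) (1\<^sub>m l) \<in> ?H" unfolding GA_set_Suc using zero_carrier_vec by blast
    then show "?H \<noteq> {}" by blast
  next
    fix A assume A: "A \<in> ?H"
    then obtain \<alpha> g where A': "A = affine_mat \<alpha> g" "\<alpha> \<in> carrier_vec l" "g \<in> carrier (GL l)"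
      unfolding GA_set_Suc by blast
    obtain B where B: "B \<in> ?H" "B * A = 1\<^sub>m (Suc l)"
      using affine_inverse[OF A'(2,3)] A'(1) by blast
    then have "inv\<^bsub>GL (Suc l)\<^esub> A = B" using A sub by (intro GL.inv_equality) (auto simp: GL_simps)
    with B show "inv\<^bsub>GL (Suc l)\<^esub> A \<in> ?H" by simp
  qed (simp add: GL_simps closed)
  then show ?thesis unfolding GA_def by (rule subgroup.subgroup_is_group) (rule group_GL)
qed

lemma GA_simps:
  "carrier (GA n) = GA_set n" "mult (GA n) = (*)" "one (GA n) = 1\<^sub>m n"
  by (simp_all add: GA_def GL_simps)

text \<open>Without inverses the relation is an equation between two products, which can be compared
  block by block.\<close>

lemma (in group) conjugate_in_iff:
  assumes "x \<in> carrier G" "y \<in> carrier G"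
  shows "conjugate_in G x y \<longleftrightarrow> (\<exists>h \<in> carrier G. y \<otimes> h = h \<otimes> x)"
proof -
  have "y = h \<otimes> x \<otimes> inv h \<longleftrightarrow> y \<otimes> h = h \<otimes> x" if "h \<in> carrier G" for h
    using that assms by (metis inv_solve_right' m_closed)
  then show ?thesis unfolding conjugate_in_def by blast
qed

lemma (in group) conjugate_in_sym:
  assumes "x \<in> carrier G" "y \<in> carrier G" "conjugate_in G x y"
  shows "conjugate_in G y x"
proof -
  obtain h where h: "h \<in> carrier G" "y \<otimes> h = h \<otimes> x" using assms conjugate_in_iff by blast
  then have "x \<otimes> inv h = inv h \<otimes> y" using assms
    by (metis inv_closed inv_solve_left' inv_solve_right' m_assoc m_closed)
  with h assms show ?thesis using conjugate_in_iff inv_closed by blast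
qed

lemma (in group) conjugate_in_trans:
  assumes "x \<in> carrier G" "y \<in> carrier G" "z \<in> carrier G" "conjugate_in G x y" "conjugate_in G y z"
  shows "conjugate_in G x z"
proof -
  obtain h where h: "h \<in> carrier G" "y \<otimes> h = h \<otimes> x" using assms conjugate_in_iff by blast
  obtain k where k: "k \<in> carrier G" "z \<otimes> k = k \<otimes> y" using assms conjugate_in_iff by blast
  have "z \<otimes> (k \<otimes> h) = k \<otimes> (y \<otimes> h)" using h k assms by (metis m_assoc)
  also have "\<dots> = (k \<otimes> h) \<otimes> x" using h k assms by (metis m_assoc)
  finally show ?thesis using h k assms conjugate_in_iff m_closed by blast
qed

text \<open>Comparison of the linear and translation parts of y h = h x. The second equation says
  that u carries \<alpha> to \<alpha>' up to the element (g' - 1) b of (t - 1)V.\<close>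

lemma conjugate_in_GA_iff:
  fixes g g' :: "'a::field mat"
  assumes a: "\<alpha> \<in> carrier_vec l" "\<alpha>' \<in> carrier_vec l" and g: "g \<in> carrier (GL l)" "g' \<in> carrier (GL l)"
  shows "conjugate_in (GA (Suc l)) (affine_mat \<alpha> g) (affine_mat \<alpha>' g') \<longleftrightarrow>
    (\<exists>b \<in> fun_space l. \<exists>u \<in> carrier (GL l). g' * u = u * g \<and>
      b + mat_op u (fun_of_vec \<alpha>) = fun_of_vec \<alpha>' + mat_op g' b)"
proof -
  interpret GA: group "GA (Suc l) :: 'a mat monoid" by (rule group_GA)
  have gc: "g \<in> carrier_mat l l" "g' \<in> carrier_mat l l" using g by (auto simp: carrier_GL)
  have in_GA: "affine_mat \<alpha> g \<in> carrier (GA (Suc l))" "affine_mat \<alpha>' g' \<in> carrier (GA (Suc l))"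
    using a g by (auto simp: GA_simps GA_set_Suc)
  have eq: "affine_mat \<alpha>' g' * affine_mat \<beta> u = affine_mat \<beta> u * affine_mat \<alpha> g \<longleftrightarrow>
      g' * u = u * g \<and>
      fun_of_vec \<beta> + mat_op u (fun_of_vec \<alpha>) = fun_of_vec \<alpha>' + mat_op g' (fun_of_vec \<beta>)"
    if b: "\<beta> \<in> carrier_vec l" and u: "u \<in> carrier (GL l)" for \<beta> u
  proof -
    have uc: "u \<in> carrier_mat l l" using u by (simp add: carrier_GL)
    have c: "g' *\<^sub>v \<beta> \<in> carrier_vec l" "u *\<^sub>v \<alpha> \<in> carrier_vec l" using a b gc uc by auto
    have "affine_mat \<alpha>' g' * affine_mat \<beta> u = affine_mat \<beta> u * affine_mat \<alpha> g \<longleftrightarrow>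
        \<alpha>' + g' *\<^sub>v \<beta> = \<beta> + u *\<^sub>v \<alpha> \<and> g' * u = u * g"
      using a b gc uc c by (simp add: affine_mat_mult[of _ l] affine_mat_inj[of _ l])
    also have "\<alpha>' + g' *\<^sub>v \<beta> = \<beta> + u *\<^sub>v \<alpha> \<longleftrightarrow> fun_of_vec (\<alpha>' + g' *\<^sub>v \<beta>) = fun_of_vec (\<beta> + u *\<^sub>v \<alpha>)"
      using a b c by (subst fun_of_vec_inj[of _ l]) auto
    also have "\<dots> \<longleftrightarrow> fun_of_vec \<beta> + mat_op u (fun_of_vec \<alpha>) = fun_of_vec \<alpha>' + mat_op g' (fun_of_vec \<beta>)"
      using a b c gc uc by (auto simp: fun_of_vec_add[of _ l] fun_of_vec_mult[of _ l])
    finally show ?thesis by blast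
  qed
  have "conjugate_in (GA (Suc l)) (affine_mat \<alpha> g) (affine_mat \<alpha>' g') \<longleftrightarrow>
      (\<exists>\<beta> \<in> carrier_vec l. \<exists>u \<in> carrier (GL l).
        affine_mat \<alpha>' g' * affine_mat \<beta> u = affine_mat \<beta> u * affine_mat \<alpha> g)"
    unfolding GA.conjugate_in_iff[OF in_GA] unfolding GA_simps GA_set_Suc by blast
  also have "\<dots> \<longleftrightarrow> (\<exists>\<beta> \<in> carrier_vec l. \<exists>u \<in> carrier (GL l). g' * u = u * g \<and>
      fun_of_vec \<beta> + mat_op u (fun_of_vec \<alpha>) = fun_of_vec \<alpha>' + mat_op g' (fun_of_vec \<beta>))"
    using eq by blast
  also have "\<dots> \<longleftrightarrow> (\<exists>b \<in> fun_space l. \<exists>u \<in> carrier (GL l). g' * u = u * g \<and>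
      b + mat_op u (fun_of_vec \<alpha>) = fun_of_vec \<alpha>' + mat_op g' b)"
  proof (rule iffI; elim bexE)
    fix b u assume b: "b \<in> fun_space l" and u: "u \<in> carrier (GL l)"
      and "g' * u = u * g \<and> b + mat_op u (fun_of_vec \<alpha>) = fun_of_vec \<alpha>' + mat_op g' b"
    then show "\<exists>\<beta> \<in> carrier_vec l. \<exists>u \<in> carrier (GL l). g' * u = u * g \<and>
      fun_of_vec \<beta> + mat_op u (fun_of_vec \<alpha>) = fun_of_vec \<alpha>' + mat_op g' (fun_of_vec \<beta>)"
      by (intro bexI[of _ "vec l b"] bexI[of _ u]) (simp_all add: fun_of_vec_vec)
  next
    fix \<beta> u assume "\<beta> \<in> carrier_vec l" and "u \<in> carrier (GL l)"
      and "g' * u = u * g \<and>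
        fun_of_vec \<beta> + mat_op u (fun_of_vec \<alpha>) = fun_of_vec \<alpha>' + mat_op g' (fun_of_vec \<beta>)"
    then show "\<exists>b \<in> fun_space l. \<exists>u \<in> carrier (GL l). g' * u = u * g \<and>
        b + mat_op u (fun_of_vec \<alpha>) = fun_of_vec \<alpha>' + mat_op g' b"
      using fun_of_vec_space by blast
  qed
  finally show ?thesis .
qed

section \<open>Classification\<close>

text \<open>In y + p b the generator y has the coefficient 1 + p c, which is prime to p. If p^j
  killed this vector with j < k, then p^k would divide p^j (1 + p c), and p would divide 1.\<close>

lemma (in poly_module) primary_decomp_generator_level:
  assumes d: "primary_decomp V gs" and p: "p \<in> Phi"
    and i: "i < length gs" "gs ! i = ((p, k), y)" and b: "b \<in> V"
    and z: "p ^ j *s (y + p *s b) = 0"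
  shows "k \<le> j"
proof (rule ccontr)
  assume "\<not> k \<le> j"
  let ?gs = "map (\<lambda>((f, k), y). (f ^ k, y)) gs"
  have cd: "cyclic_decomp V ?gs" using d by (simp add: primary_decomp_def)
  from b obtain c where c: "b = comb ?gs c" using cyclic_decomp_range[OF cd] by blast
  let ?e = "\<lambda>l. (if l = i then 1 else 0) + p * c l"
  have "y = comb ?gs (\<lambda>l. if l = i then 1 else 0)" using i by (simp add: comb_delta)
  then have "y + p *s b = comb ?gs ?e" by (simp only: c comb_scale comb_add)
  then have "comb ?gs (\<lambda>l. p ^ j * ?e l) = 0" using z by (simp only: comb_scale)
  then have dv: "\<forall>l<length ?gs. fst (?gs ! l) dvd p ^ j * ?e l"
    by (rule iffD1[OF cyclic_decomp_eq_0_iff[OF cd]])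
  have gi: "fst (?gs ! i) = p ^ k" and il: "i < length ?gs" using i by simp_all
  have "p ^ k dvd p ^ j * (1 + p * c i)" using dv[rule_format, OF il] unfolding gi by simp
  moreover have "p ^ Suc j dvd p ^ k" using \<open>\<not> k \<le> j\<close> by (intro le_imp_power_dvd) simp
  ultimately have "p ^ j * p dvd p ^ j * (1 + p * c i)" unfolding power_Suc2 by (rule dvd_trans[rotated])
  then have "p dvd 1 + p * c i" using Phi_nonzero[OF p] by simp
  then have "is_unit p" by (simp add: dvd_add_left_iff)
  then show False using p by (auto simp: Phi_def irreducible_def)
qed

lemma J_lambda_facts:
  fixes \<Lambda> :: "'a::{field, finite} poly \<Rightarrow> nat list"
  assumes ord: "is_block_order ord" and L: "\<Lambda> \<in> PPhi l"
  defines "ts \<equiv> block_types ord \<Lambda>"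
  shows "J_lambda ord \<Lambda> \<in> carrier (GL l)"
    and "mat_act.primary_decomp (J_lambda ord \<Lambda>) (fun_space l) (zip ts (map fun_unit (block_ends ts)))"
proof -
  have enc: "encodes \<Lambda> ts" unfolding ts_def by (rule encodes_block_types[OF ord L])
  have size: "sum_list (map block_size ts) = l" by (rule encodes_size[OF enc L])
  have c: "J_lambda ord \<Lambda> \<in> carrier_mat l l"
    using block_diag_carrier[of ts] by (simp add: J_lambda_eq_block_diag ts_def[symmetric] size)
  show d: "mat_act.primary_decomp (J_lambda ord \<Lambda>) (fun_space l) (zip ts (map fun_unit (block_ends ts)))"
    using primary_decomp_block_diag[of ts] encodes_valid[OF enc L]
    by (simp add: J_lambda_eq_block_diag ts_def[symmetric] size)
  show "J_lambda ord \<Lambda> \<in> carrier (GL l)"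
    unfolding GL_iff_inj[OF c] using mat_act.primary_decomp_mult_inj[OF d] by (simp only: mat_act_X) blast
qed

lemma epsilon_facts:
  fixes \<Lambda> :: "'a::{field, finite} poly \<Rightarrow> nat list"
  assumes ord: "is_block_order ord" and L: "\<Lambda> \<in> PPhi l" and k: "1 \<le> k \<longrightarrow> k \<in> set (\<Lambda> t_minus_1)"
  defines "ts \<equiv> block_types ord \<Lambda>"
  defines "e \<equiv> epsilon_vec l (\<Lambda> t_minus_1) k :: 'a vec"
  shows "e \<in> carrier_vec l"
    and "k = 0 \<Longrightarrow> fun_of_vec e = 0"
    and "1 \<le> k \<Longrightarrow> \<exists>i < length ts. ts ! i = (t_minus_1, k) \<and>
      zip ts (map fun_unit (block_ends ts)) ! i = ((t_minus_1, k), fun_of_vec e)"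
proof -
  show "e \<in> carrier_vec l" by (simp add: e_def epsilon_vec_def)
  show "fun_of_vec e = 0" if "k = 0" using that by (simp add: e_def epsilon_vec_def fun_of_vec_zero)
  show "\<exists>i < length ts. ts ! i = (t_minus_1, k) \<and>
      zip ts (map fun_unit (block_ends ts)) ! i = ((t_minus_1, k), fun_of_vec e)" if k1: "1 \<le> k"
  proof -
    let ?pos = "(\<Sum>i = 1..k. i * count_list (\<Lambda> t_minus_1) i) - 1"
    let ?gs = "zip ts (map fun_unit (block_ends ts)) :: (('a poly \<times> nat) \<times> (nat \<Rightarrow> 'a)) list"
    obtain i where i: "i < length ts" "ts ! i = (t_minus_1, k)" "block_ends ts ! i = ?pos"
      using epsilon_position[of k \<Lambda> ord] k k1 unfolding ts_def by blast
    then have nth: "?gs ! i = ((t_minus_1, k), fun_unit ?pos)" by simp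
    \<comment> \<open>That the coordinate is less than l follows without arithmetic: the unit vector
      is a generator and so lies in the space.\<close>
    have "mat_act.cyclic_decomp (J_lambda ord \<Lambda>) (fun_space l) (map (\<lambda>((f, k), y). (f ^ k, y)) ?gs)"
      using J_lambda_facts(2)[OF ord L] unfolding ts_def mat_act.primary_decomp_def by blast
    from mat_act.cyclic_decomp_generator[OF this, of i]
    have "fun_unit ?pos \<in> (fun_space l :: (nat \<Rightarrow> 'a) set)" using i nth by simp
    then have "?pos < l" by (auto simp: fun_space_def fun_unit_def not_le[symmetric])
    then have "fun_of_vec e = fun_unit ?pos" using k1 by (simp add: e_def epsilon_vec_def fun_of_vec_unit)
    with i nth show ?thesis by auto
  qed
qed

lemma PaPhi_Suc: "(\<Lambda>, k) \<in> PaPhi (Suc l) \<longleftrightarrow> \<Lambda> \<in> PPhi l \<and> (1 \<le> k \<longrightarrow> k \<in> set (\<Lambda> t_minus_1))"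
  by (simp add: PaPhi_def)

lemma J_affine_Suc:
  "J_affine ord (Suc l) \<Lambda> k = affine_mat (epsilon_vec l (\<Lambda> t_minus_1) k) (J_lambda ord \<Lambda>)"
  by (simp add: J_affine_def)

lemma J_affine_GA:
  fixes \<Lambda> :: "'a::{field, finite} poly \<Rightarrow> nat list"
  assumes "is_block_order ord" "(\<Lambda>, k) \<in> PaPhi (Suc l)"
  shows "J_affine ord (Suc l) \<Lambda> k \<in> carrier (GA (Suc l))"
  using assms J_lambda_facts(1)[of ord \<Lambda> l] epsilon_facts(1)[of ord \<Lambda> l k]
  unfolding PaPhi_Suc J_affine_Suc GA_simps GA_set_Suc by blast

lemma conjugate_J_affine:
  fixes g :: "'a::{field, finite} mat"
  assumes ord: "is_block_order ord" and P: "(\<Lambda>, k) \<in> PaPhi (Suc l)"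
    and a: "\<alpha> \<in> carrier_vec l" and g: "g \<in> carrier (GL l)" and b: "b \<in> fun_space l"
    and iso: "module_iso (mat_act g) (mat_act (J_lambda ord \<Lambda>)) (fun_space l) (fun_space l) \<phi>"
    and eq: "\<phi> (fun_of_vec \<alpha> + mat_act g t_minus_1 b) = fun_of_vec (epsilon_vec l (\<Lambda> t_minus_1) k)"
  shows "conjugate_in (GA (Suc l)) (affine_mat \<alpha> g) (J_affine ord (Suc l) \<Lambda> k)"
proof -
  let ?J = "J_lambda ord \<Lambda>" let ?e = "epsilon_vec l (\<Lambda> t_minus_1) k :: 'a vec"
  let ?V = "fun_space l :: (nat \<Rightarrow> 'a) set"
  have L: "\<Lambda> \<in> PPhi l" and k: "1 \<le> k \<longrightarrow> k \<in> set (\<Lambda> t_minus_1)" using P by (auto simp: PaPhi_Suc)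
  have J: "?J \<in> carrier (GL l)" by (rule J_lambda_facts(1)[OF ord L])
  have gc: "g \<in> carrier_mat l l" and Jc: "?J \<in> carrier_mat l l" using g J by (auto simp: carrier_GL)
  have e: "?e \<in> carrier_vec l" by (rule epsilon_facts(1)[OF ord L k])
  have aV: "fun_of_vec \<alpha> \<in> ?V" by (rule fun_of_vec_space[OF a])
  have xb: "mat_act g t_minus_1 b \<in> ?V" using gc b by (intro fun_space_mat_act) auto
  obtain u where u: "u \<in> carrier (GL l)" "?J * u = u * g" and u\<phi>: "\<And>v. v \<in> ?V \<Longrightarrow> mat_op u v = \<phi> v"
    using matrix_of_module_iso[OF gc Jc iso] by blast
  have \<phi>: "\<phi> (fun_of_vec \<alpha> + mat_act g t_minus_1 b) = \<phi> (fun_of_vec \<alpha>) + mat_act ?J t_minus_1 (\<phi> b)"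
    using iso aV xb b unfolding module_iso_def by metis
  \<comment> \<open>The equation for \<phi> reads \<epsilon>_k = \<phi> \<alpha> + (J - 1) \<phi> b.
    Comparison with c + u \<alpha> = \<epsilon>_k + J c leads to c = - \<phi> b.\<close>
  define c where "c = - \<phi> b"
  have "\<phi> b \<in> ?V" using iso b unfolding module_iso_def bij_betw_def by blast
  then have cV: "c \<in> ?V" by (simp add: c_def fun_space_def)
  have "mat_op ?J c = - mat_op ?J (\<phi> b)"
    using mat_op.T_add[of ?J c "\<phi> b"] by (simp only: c_def) (simp add: eq_neg_iff_add_eq_0)
  moreover have "fun_of_vec ?e = \<phi> (fun_of_vec \<alpha>) + (mat_op ?J (\<phi> b) - \<phi> b)"
    using eq \<phi> by (simp only: mat_act_t_minus_1[of ?J])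
  moreover have "- p + q = (q + (r - p)) + - r" for p q r :: "nat \<Rightarrow> 'a" by simp
  ultimately have "c + mat_op u (fun_of_vec \<alpha>) = fun_of_vec ?e + mat_op ?J c"
    by (simp only: u\<phi>[OF aV] c_def)
  then show ?thesis
    unfolding J_affine_Suc conjugate_in_GA_iff[OF a e g J] using cV u by blast
qed

lemma ex_conjugate_J_affine:
  fixes g :: "'a::{field, finite} mat"
  assumes ord: "is_block_order ord" and a: "\<alpha> \<in> carrier_vec l" and g: "g \<in> carrier (GL l)"
  shows "\<exists>(\<Lambda>, k) \<in> PaPhi (Suc l). conjugate_in (GA (Suc l)) (affine_mat \<alpha> g) (J_affine ord (Suc l) \<Lambda> k)"
proof -
  let ?V = "fun_space l :: (nat \<Rightarrow> 'a) set" let ?x = "t_minus_1 :: 'a poly" let ?a = "fun_of_vec \<alpha>"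
  have gc: "g \<in> carrier_mat l l" using g by (simp add: carrier_GL)
  have V: "mat_act.subspace g ?V" "finite ?V" using gc card_fun_space(1) by (auto intro: subspace_fun_space)
  have inj: "v = 0" if "v \<in> ?V" "mat_act g [:0, 1:] v = 0" for v
    using g that unfolding GL_iff_inj[OF gc] by (simp only: mat_act_X)
  have aV: "?a \<in> ?V" by (rule fun_of_vec_space[OF a])
  \<comment> \<open>The cardinality q^l of V forces the total size of the types to be l, so they are
    encoded by some \<Lambda> in \<open>PPhi l\<close>.\<close>
  have encode: "\<exists>\<Lambda> \<in> PPhi l. mset (block_types ord \<Lambda>) = mset (map fst gs)"
    if d: "mat_act.primary_decomp g ?V gs" for gs
  proof -
    have val: "f \<in> Phi \<and> 1 \<le> k" if "(f, k) \<in> set (map fst gs)" for f k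
      using d that by (auto simp: mat_act.primary_decomp_def)
    have "block_size = (\<lambda>(f :: 'a poly, k). degree f * k)" by (auto simp: block_size_def fun_eq_iff)
    then have "CARD('a) ^ l = CARD('a) ^ sum_list (map block_size (map fst gs))"
      using mat_act.card_primary_decomp[OF d] card_fun_space(2)[where 'a='a, of l] by (simp only:)
    moreover have "CARD('a) > 1"
    proof -
      have "card {0, 1::'a} \<le> CARD('a)" by (rule card_mono) auto
      then show ?thesis by simp
    qed
    ultimately have "sum_list (map block_size (map fst gs)) = l" by (simp add: power_inject_exp)
    then obtain \<Lambda> where L: "\<Lambda> \<in> PPhi l" and e: "encodes \<Lambda> (map fst gs)"
      using ex_encodes[OF val] by blast
    have "mset (block_types ord \<Lambda>) = mset (map fst gs)"
    proof (rule multiset_eqI)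
      fix t show "count (mset (block_types ord \<Lambda>)) t = count (mset (map fst gs)) t"
        using e encodes_block_types[OF ord L] unfolding encodes_def by (cases t) (simp only:)
    qed
    with L show ?thesis by blast
  qed
  have iso: "\<exists>\<phi>. module_iso (mat_act g) (mat_act (J_lambda ord \<Lambda>)) ?V ?V \<phi> \<and>
      (\<forall>i < length gs. \<phi> (snd (gs ! i)) =
        snd (zip (block_types ord \<Lambda>) (map fun_unit (block_ends (block_types ord \<Lambda>))) ! i))"
    if L: "\<Lambda> \<in> PPhi l" and d: "mat_act.primary_decomp g ?V gs" and m: "map fst gs = block_types ord \<Lambda>" for gs \<Lambda>
  proof -
    let ?h = "\<lambda>((f, k), y). (f ^ k, y)" let ?ts = "block_types ord \<Lambda>"
    let ?hs = "zip ?ts (map fun_unit (block_ends ?ts)) :: (('a poly \<times> nat) \<times> (nat \<Rightarrow> 'a)) list"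
    have "map fst ?hs = ?ts" by simp
    moreover have "map fst (map ?h xs) = map (\<lambda>(f, k). f ^ k) (map fst xs)"
      for xs :: "(('a poly \<times> nat) \<times> (nat \<Rightarrow> 'a)) list"
      by (simp add: case_prod_beta)
    ultimately have fst: "map fst (map ?h gs) = map fst (map ?h ?hs)" using m by (simp only:)
    have "mat_act.cyclic_decomp g ?V (map ?h gs)" "mat_act.cyclic_decomp (J_lambda ord \<Lambda>) ?V (map ?h ?hs)"
      using d J_lambda_facts(2)[OF ord L] unfolding mat_act.primary_decomp_def by blast+
    from ex_module_iso[OF mat_op.ring_module_act mat_op.ring_module_act this fst]
    obtain \<phi> where \<phi>: "module_iso (mat_act g) (mat_act (J_lambda ord \<Lambda>)) ?V ?V \<phi>"
      "\<And>i. i < length (map ?h gs) \<Longrightarrow> \<phi> (snd (map ?h gs ! i)) = snd (map ?h ?hs ! i)" by blast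
    have len: "length gs = length ?hs" using arg_cong[OF m, of length] by simp
    have "\<phi> (snd (gs ! i)) = snd (?hs ! i)" if "i < length gs" for i
      using \<phi>(2)[of i] that len by (simp add: case_prod_beta)
    with \<phi>(1) show ?thesis by blast
  qed
  show ?thesis
  proof (cases "\<exists>z \<in> ?V. ?a = mat_act g ?x z")
    case True
    then obtain z where z: "z \<in> ?V" "?a = mat_act g ?x z" by blast
    obtain gs0 where gs0: "mat_act.primary_decomp g ?V gs0" using mat_act.ex_primary_decomp[OF V inj] by blast
    obtain \<Lambda> where L: "\<Lambda> \<in> PPhi l" and m: "mset (block_types ord \<Lambda>) = mset (map fst gs0)"
      using encode[OF gs0] by blast
    obtain gs where gs: "mset gs = mset gs0" "map fst gs = block_types ord \<Lambda>"
      using ex_list_map_eq[OF m[symmetric]] by blast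
    obtain \<phi> where \<phi>: "module_iso (mat_act g) (mat_act (J_lambda ord \<Lambda>)) ?V ?V \<phi>"
      using iso[OF L mat_act.primary_decomp_permute[OF gs0 gs(1)] gs(2)] by blast
    have P: "(\<Lambda>, 0) \<in> PaPhi (Suc l)" using L by (simp add: PaPhi_Suc)
    \<comment> \<open>Here \<alpha> = (t - 1) z, so the correction b = -z turns \<alpha> into 0,
      which is \<epsilon>_0.\<close>
    have nz: "- z \<in> ?V" using z by (simp add: fun_space_def)
    have "?a + mat_act g ?x (- z) = 0" unfolding z(2) mat_act.scale_minus_right by simp
    moreover have "\<phi> 0 = 0"
    proof -
      have "\<phi> (0 + 0) = \<phi> 0 + \<phi> 0" using \<phi> fun_space_0 unfolding module_iso_def by blast
      then show ?thesis by simp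
    qed
    ultimately have "\<phi> (?a + mat_act g ?x (- z)) = fun_of_vec (epsilon_vec l (\<Lambda> ?x) 0)"
      using epsilon_facts(2)[OF ord L, of 0] by simp
    from conjugate_J_affine[OF ord P a g nz \<phi> this] P show ?thesis by blast
  next
    case False
    then obtain b j W where b: "b \<in> ?V" and W: "mat_act.subspace g W" "W \<subset> ?V"
      and step: "\<And>gs. mat_act.primary_decomp g W gs \<Longrightarrow>
        mat_act.primary_decomp g ?V (((?x, Suc j), ?a + mat_act g ?x b) # gs)"
      using mat_act.split_off_primary[OF V t_minus_1_Phi aV] by blast
    have "finite W" by (rule finite_subset[OF psubset_imp_subset[OF W(2)] V(2)])
    moreover have "v = 0" if "v \<in> W" "mat_act g [:0, 1:] v = 0" for v
      using inj[OF psubsetD[OF W(2) that(1)] that(2)] .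
    ultimately obtain gs1 where "mat_act.primary_decomp g W gs1"
      using mat_act.ex_primary_decomp[OF W(1)] by blast
    from step[OF this]
    have gs0: "mat_act.primary_decomp g ?V (((?x, Suc j), ?a + mat_act g ?x b) # gs1)" .
    let ?k = "Suc j" let ?y = "?a + mat_act g ?x b"
    obtain \<Lambda> where L: "\<Lambda> \<in> PPhi l"
      and m: "mset (block_types ord \<Lambda>) = mset (map fst (((?x, ?k), ?y) # gs1))"
      using encode[OF gs0] by blast
    have "(?x, ?k) \<in># mset (block_types ord \<Lambda>)" unfolding m by simp
    then have "(?x, ?k) \<in> set (block_types ord \<Lambda>)" by simp
    then have k: "?k \<in> set (\<Lambda> ?x)" using encodes_mem_iff[OF encodes_block_types[OF ord L]] by blast
    then have P: "(\<Lambda>, ?k) \<in> PaPhi (Suc l)" using L by (simp add: PaPhi_Suc)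
    obtain i where i: "i < length (block_types ord \<Lambda>)" "block_types ord \<Lambda> ! i = (?x, ?k)"
      "zip (block_types ord \<Lambda>) (map fun_unit (block_ends (block_types ord \<Lambda>))) ! i =
        ((?x, ?k), fun_of_vec (epsilon_vec l (\<Lambda> ?x) ?k :: 'a vec))"
      using epsilon_facts(3)[OF ord L, of ?k] k by auto
    have i2: "block_types ord \<Lambda> ! i = fst ((?x, ?k), ?y)" using i(2) by simp
    \<comment> \<open>The corrected \<alpha> is put where \<epsilon>_k has its generator, so that
      \<phi> matches the two.\<close>
    obtain gs where gs: "mset gs = mset (((?x, ?k), ?y) # gs1)" "map fst gs = block_types ord \<Lambda>"
      "gs ! i = ((?x, ?k), ?y)"
      using ex_list_map_eq_nth[OF m[symmetric] i(1) i2] by blast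
    obtain \<phi> where \<phi>: "module_iso (mat_act g) (mat_act (J_lambda ord \<Lambda>)) ?V ?V \<phi>"
      and \<phi>i: "\<And>i. i < length gs \<Longrightarrow> \<phi> (snd (gs ! i)) =
        snd (zip (block_types ord \<Lambda>) (map fun_unit (block_ends (block_types ord \<Lambda>))) ! i)"
      using iso[OF L mat_act.primary_decomp_permute[OF gs0 gs(1)] gs(2)] by blast
    have "i < length gs" using i(1) arg_cong[OF gs(2), of length] by simp
    then have "\<phi> ?y = fun_of_vec (epsilon_vec l (\<Lambda> ?x) ?k)" using \<phi>i[of i] gs(3) i(3) by simp
    from conjugate_J_affine[OF ord P a g b \<phi> this] P show ?thesis by blast
  qed
qed

text \<open>(t - 1)^k kills \<epsilon>_k and hence its image, which represents \<epsilon>_k' modulo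
  (t - 1)V; no representative of that class has order below (t - 1)^k'. This gives one inequality,
  and symmetry of conjugacy gives the other.\<close>

lemma conjugate_J_affine_level_le:
  fixes \<Lambda> :: "'a::{field, finite} poly \<Rightarrow> nat list"
  assumes ord: "is_block_order ord" and P: "(\<Lambda>, k) \<in> PaPhi (Suc l)" "(\<Lambda>', k') \<in> PaPhi (Suc l)"
    and conj: "conjugate_in (GA (Suc l)) (J_affine ord (Suc l) \<Lambda> k) (J_affine ord (Suc l) \<Lambda>' k')"
  shows "\<Lambda> = \<Lambda>' \<and> k' \<le> k"
proof -
  let ?V = "fun_space l :: (nat \<Rightarrow> 'a) set" let ?x = "t_minus_1 :: 'a poly"
  let ?J = "J_lambda ord \<Lambda>" let ?J' = "J_lambda ord \<Lambda>'"
  let ?e = "epsilon_vec l (\<Lambda> ?x) k :: 'a vec" let ?e' = "epsilon_vec l (\<Lambda>' ?x) k' :: 'a vec"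
  have L: "\<Lambda> \<in> PPhi l" "1 \<le> k \<longrightarrow> k \<in> set (\<Lambda> ?x)" and L': "\<Lambda>' \<in> PPhi l" "1 \<le> k' \<longrightarrow> k' \<in> set (\<Lambda>' ?x)"
    using P by (auto simp: PaPhi_Suc)
  note J = J_lambda_facts[OF ord L(1)] and J' = J_lambda_facts[OF ord L'(1)]
  note e = epsilon_facts[OF ord L] and e' = epsilon_facts[OF ord L']
  have Jc: "?J \<in> carrier_mat l l" "?J' \<in> carrier_mat l l" using J(1) J'(1) by (auto simp: carrier_GL)
  obtain b u where b: "b \<in> ?V" and u: "u \<in> carrier (GL l)" "?J' * u = u * ?J"
    and eq: "b + mat_op u (fun_of_vec ?e) = fun_of_vec ?e' + mat_op ?J' b"
    using conj unfolding J_affine_Suc conjugate_in_GA_iff[OF e(1) e'(1) J(1) J'(1)] by blast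
  note iso = module_iso_of_matrix[OF Jc u]
  have fpm: "finite_poly_module (mat_act A)" for A :: "'a mat" by unfold_locales
  have "mset (block_types ord \<Lambda>) = mset (block_types ord \<Lambda>')"
    using primary_decomp_unique[OF fpm fpm J(2) J'(2) iso fun_space_0] by simp
  then have LL: "\<Lambda> = \<Lambda>'"
    using encodes_unique[OF encodes_block_types[OF ord L(1)] encodes_block_types[OF ord L'(1)] L(1) L'(1)] by blast
  \<comment> \<open>For k = 0 the vector is 0, and for k \<ge> 1 it is a generator of order (t -
    1)^k.\<close>
  have xk: "mat_act ?J (?x ^ k) (fun_of_vec ?e) = 0"
  proof (cases "k = 0")
    case True
    then show ?thesis using e(2) by (simp only: mat_op.act_zero_right)
  next
    case False
    let ?ts = "block_types ord \<Lambda>" let ?h = "\<lambda>((f, k), y). (f ^ k, y)"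
    let ?gs = "zip ?ts (map fun_unit (block_ends ?ts)) :: (('a poly \<times> nat) \<times> (nat \<Rightarrow> 'a)) list"
    obtain i where i: "i < length ?ts" "?gs ! i = ((?x, k), fun_of_vec ?e)" using e(3) False by auto
    have cd: "mat_act.cyclic_decomp ?J ?V (map ?h ?gs)"
      using J(2) unfolding mat_act.primary_decomp_def by blast
    have "mat_act.comb ?J (map ?h ?gs) (\<lambda>l. if l = i then ?x ^ k else 0) = 0"
      using cd i unfolding mat_act.cyclic_decomp_def by (auto simp: nth_zip)
    then show ?thesis using i by (subst (asm) mat_act.comb_delta) simp_all
  qed
  let ?f = "mat_op u (fun_of_vec ?e)"
  have f: "?f = fun_of_vec ?e' + mat_act ?J' ?x b"
    using eq unfolding mat_act_t_minus_1 by (simp only: algebra_simps)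
  have "fun_of_vec ?e \<in> ?V" by (rule fun_of_vec_space[OF e(1)])
  then have "mat_act ?J' (?x ^ k) ?f = mat_op u (mat_act ?J (?x ^ k) (fun_of_vec ?e))"
    using iso unfolding module_iso_def by metis
  then have z: "mat_act ?J' (?x ^ k) (fun_of_vec ?e' + mat_act ?J' ?x b) = 0"
    unfolding f xk by (simp only: mat_op.T_0)
  have "k' \<le> k"
  proof (cases "k' = 0")
    case False
    let ?ts = "block_types ord \<Lambda>'"
    let ?gs = "zip ?ts (map fun_unit (block_ends ?ts)) :: (('a poly \<times> nat) \<times> (nat \<Rightarrow> 'a)) list"
    obtain i where i: "i < length ?ts" "?gs ! i = ((?x, k'), fun_of_vec ?e')" using e'(3) False by auto
    then have "i < length ?gs" by simp
    from mat_act.primary_decomp_generator_level[OF J'(2) t_minus_1_Phi this i(2) b z] show ?thesis .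
  qed simp
  with LL show ?thesis by blast
qed

lemma conjugate_J_affine_eq:
  fixes \<Lambda> :: "'a::{field, finite} poly \<Rightarrow> nat list"
  assumes ord: "is_block_order ord" and P: "(\<Lambda>, k) \<in> PaPhi (Suc l)" "(\<Lambda>', k') \<in> PaPhi (Suc l)"
    and conj: "conjugate_in (GA (Suc l)) (J_affine ord (Suc l) \<Lambda> k) (J_affine ord (Suc l) \<Lambda>' k')"
  shows "\<Lambda> = \<Lambda>' \<and> k = k'"
proof -
  interpret GA: group "GA (Suc l) :: 'a mat monoid" by (rule group_GA)
  have "conjugate_in (GA (Suc l)) (J_affine ord (Suc l) \<Lambda>' k') (J_affine ord (Suc l) \<Lambda> k)"
    by (rule GA.conjugate_in_sym[OF J_affine_GA[OF ord P(1)] J_affine_GA[OF ord P(2)] conj])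
  then show ?thesis
    using conjugate_J_affine_level_le[OF ord P conj] conjugate_J_affine_level_le[OF ord P(2,1)] by force
qed

theorem proposition2p5:
  fixes n :: nat
    and ord :: "('a :: {field, finite} poly \<Rightarrow> nat list) \<Rightarrow> ('a poly \<times> nat) list"
  assumes "n \<ge> 1"
    and "is_block_order ord"
  shows "(\<forall>A \<in> carrier (GA n). \<exists>(\<Lambda>, k) \<in> PaPhi n.
            conjugate_in (GA n) A (J_affine ord n \<Lambda> k)) \<and>
         complete_class_reps (GA n) {J_affine ord n \<Lambda> k |\<Lambda> k. (\<Lambda>, k) \<in> PaPhi n} \<and>
         inj_on (\<lambda>(\<Lambda>, k). J_affine ord n \<Lambda> k) (PaPhi n)"
proof -
  obtain l where n: "n = Suc l" using assms(1) by (cases n) auto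
  note ord = assms(2)
  interpret GA: group "GA n :: 'a mat monoid" unfolding n by (rule group_GA)
  let ?R = "{J_affine ord n \<Lambda> k |\<Lambda> k. (\<Lambda>, k) \<in> PaPhi n}"
  have ex: "\<exists>(\<Lambda>, k) \<in> PaPhi n. conjugate_in (GA n) A (J_affine ord n \<Lambda> k)" if "A \<in> carrier (GA n)" for A
    using that ex_conjugate_J_affine[OF ord] unfolding n GA_simps GA_set_Suc by blast
  have R: "?R \<subseteq> carrier (GA n)" using J_affine_GA[OF ord] unfolding n by blast
  have refl: "conjugate_in (GA n) A A" if "A \<in> carrier (GA n)" for A :: "'a mat"
    unfolding GA.conjugate_in_iff[OF that that] using that by (intro bexI[of _ "\<one>\<^bsub>GA n\<^esub>"]) simp_all
  have uniq: "x = y" if "x \<in> ?R" "y \<in> ?R" "conjugate_in (GA n) x y" for x y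
    using that conjugate_J_affine_eq[OF ord] unfolding n by blast
  have "\<exists>!x. x \<in> ?R \<and> x \<in> C" if CC: "C \<in> conjugacy_classes (GA n)" for C
  proof -
    obtain A where A: "A \<in> carrier (GA n)"
      and "C = orbit (GA n) (\<lambda>h. \<lambda>x\<in>carrier (GA n). h \<otimes>\<^bsub>GA n\<^esub> x \<otimes>\<^bsub>GA n\<^esub> inv\<^bsub>GA n\<^esub> h) A"
      using CC unfolding conjugacy_classes_def orbits_def by blast
    then have C: "C = {h \<otimes>\<^bsub>GA n\<^esub> A \<otimes>\<^bsub>GA n\<^esub> inv\<^bsub>GA n\<^esub> h |h. h \<in> carrier (GA n)}"
      by (simp only: orbit_def restrict_apply'[OF A])
    have C_iff: "y \<in> C \<longleftrightarrow> conjugate_in (GA n) A y" for y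
      unfolding C conjugate_in_def by blast
    obtain \<Lambda> k where "(\<Lambda>, k) \<in> PaPhi n" "conjugate_in (GA n) A (J_affine ord n \<Lambda> k)" using ex[OF A] by blast
    then have "J_affine ord n \<Lambda> k \<in> ?R \<and> J_affine ord n \<Lambda> k \<in> C" using C_iff by blast
    moreover have "x = y" if "x \<in> ?R \<and> x \<in> C" "y \<in> ?R \<and> y \<in> C" for x y
    proof (rule uniq)
      have c: "x \<in> carrier (GA n)" "y \<in> carrier (GA n)" using that R by blast+
      have Axy: "conjugate_in (GA n) A x" "conjugate_in (GA n) A y" using that C_iff by blast+
      show "conjugate_in (GA n) x y"
        by (rule GA.conjugate_in_trans[OF c(1) A c(2) GA.conjugate_in_sym[OF A c(1) Axy(1)] Axy(2)])
    qed (use that in blast)+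
    ultimately show ?thesis by blast
  qed
  then have "complete_class_reps (GA n) ?R" using R unfolding complete_class_reps_def by blast
  \<comment> \<open>Equal representatives are trivially conjugate, so their labels agree.\<close>
  moreover have "inj_on (\<lambda>(\<Lambda>, k). J_affine ord n \<Lambda> k) (PaPhi n)"
  proof (rule inj_onI, clarify)
    fix \<Lambda> k \<Lambda>' k'
    assume P: "(\<Lambda>, k) \<in> PaPhi n" "(\<Lambda>', k') \<in> PaPhi n" and "J_affine ord n \<Lambda> k = J_affine ord n \<Lambda>' k'"
    moreover have "J_affine ord n \<Lambda> k \<in> carrier (GA n)" using P(1) R by blast
    ultimately have "conjugate_in (GA n) (J_affine ord n \<Lambda> k) (J_affine ord n \<Lambda>' k')"
      using refl by simp
    then show "\<Lambda> = \<Lambda>' \<and> k = k'" using conjugate_J_affine_eq[OF ord] P unfolding n by blast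
  qed
  ultimately show ?thesis using ex by blast
qed

end
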